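(* Let $\Lambda\subset\mathbb{R}$ be an interval, $\tau>0$, and let $V:\Lambda\times\mathbb{R}^n\to\mathbb{R}$ be continuous such that (a) for each $\lambda\in\Lambda$ the map $V(\lambda,\cdot):\mathbb{R}^n\to\mathbb{R}$ is even and of class $C^2$; (b) the gradient $\nabla_xV(\lambda,x)$ and the Hessian $\nabla_x^2V(\lambda,x)$ with respect to $x$ depend continuously on $(\lambda,x)$. Consider $$(\mathrm{P}_\lambda)\qquad \dot x(t)=\nabla_xV(\lambda,x(t-\tau))+\nabla_xV(\lambda,x(t-2\tau)),\quad x(t+3\tau)=-x(t)\quad\forall t\in\mathbb{R}.$$ Let $e_1(\lambda)\le\cdots\le e_n(\lambda)$ be all eigenvalues of $\nabla_x^2V(\lambda,0)$, and set $$N(\mu):=\left\{1\le j\le n\;\Big|\;\sqrt3\,e_j(\mu)\tau\in\tfrac{2\pi}{3}+\pi(2\mathbb{Z}+1)\right\}.$$ (I) If $(\mu,0)$ with $\mu\in\Lambda$ is a bifurcation point of $(\mathrm{P}_\lambda)$, then $N(\mu)\neq\emptyset$. (II) Let $\mu$ be an interior point of $\Lambda$. Then $(\mu,0)$ is a bifurcation point of $(\mathrm{P}_\lambda)$ provided that: (A) if $e_j(\mu)>0$, then $\sqrt3\,e_j(\mu)\tau\notin\frac{2\pi}{3}+\pi(2\mathbb{Z}+1)$; (B) $N(\mu)\ne\emptyset$ and there exist two sequences $(\lambda^\pm_m)_m\subset\Lambda$ converging to $\mu$ such that $e_j(\lambda_m^-)<e_j(\mu)<e_j(\lambda_m^+)$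 for all $m\in\mathbb{N}$ and $j\in N(\mu)$. (III) Let $\mu$ be an interior point of $\Lambda$ satisfying (A) and suppose that $N(\mu)\neq\emptyset$ and that for some small $\epsilon>0$ one of the following two conditions holds: (SB.1) $e_j(\lambda)<e_j(\mu)<e_j(\lambda')$ for all $(\lambda,\lambda')\in(\mu-\epsilon,\mu)\times(\mu,\mu+\epsilon)$ and $j\in N(\mu)$; (SB.2) $e_j(\lambda)>e_j(\mu)>e_j(\lambda')$ for all $(\lambda,\lambda')\in(\mu-\epsilon,\mu)\times(\mu,\mu+\epsilon)$ and $j\in N(\mu)$. Then at least one of the following two alternatives holds: (i) $(\mathrm{P}_\mu)$ admits a sequence of nonzero distinct solutions $\{x^l\}_{l=1}^\infty$ such that $x^l\to0$ in $C^1_{\rm loc}(\mathbb{R},\mathbb{R}^n)$ as $l\to\infty$. (ii) There exist left and right neighborhoods $\Lambda^-$ and $\Lambda^+$ of $\mu$ in $\Lambda$ and nonnegative integers $n^+,n^-$ with $n^++n^-\ge2\,\sharp N(\mu)$ such that for $\lambda\in\Lambda^-\setminus\{\mu\}$ (resp. $\lambda\in\Lambda^+\setminus\{\mu\}$), $(\mathrm{P}_\lambda)$ has at least $n^-$ (resp. $n^+$) distinct pairs of nontrivial solutions $\{x^i_\lambda,-x^i_\lambda\}$, $i=1,\dots,n^-$ (resp. $n^+$), which converge to zero in $C^1_{\rm loc}(\mathbb{R},\mathbb{R}^n)$ as $\lambda\to\mu$.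
   Context: Solutions are differentiable maps $x:\mathbb{R}\to\mathbb{R}^n$; $x\equiv0$ is a solution for every $\lambda$. For $\mu\in\Lambda$, $(\mu,0)$ is a bifurcation point of $(\mathrm{P}_\lambda)$ if there exist a sequence $\{\lambda_k\}$ in $\Lambda$ converging to $\mu$ and, for each $k$, a nonzero solution $x^k$ of $(\mathrm{P}_{\lambda_k})$ such that $\|x^k|_{[0,3\tau]}\|_{C^1}\to0$ as $k\to\infty$. $\sharp$ denotes cardinality, and $\frac{2\pi}{3}+\pi(2\mathbb{Z}+1)=\{\frac{2\pi}{3}+(2j+1)\pi:j\in\mathbb{Z}\}$. *)

theory Defs
  imports "HOL-Analysis.Analysis" "HOL-Computational_Algebra.Polynomial"
begin

definition gradient :: "('a::real_inner \<Rightarrow> real) \<Rightarrow> 'a \<Rightarrow> 'a" where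
  "gradient f x = (THE D. GDERIV f x :> D)"

definition hessian :: "(real ^ 'n \<Rightarrow> real) \<Rightarrow> real ^ 'n \<Rightarrow> real ^ 'n ^ 'n" where
  "hessian f x = jacobian (gradient f) (at x)"

definition class_C2 :: "(real ^ 'n \<Rightarrow> real) \<Rightarrow> bool" where
  "class_C2 f \<longleftrightarrow>
     (\<forall>x. f differentiable at x) \<and>
     (\<forall>x. gradient f differentiable at x) \<and>
     continuous_on UNIV (hessian f)"

lemma gradient_eqI:
  assumes "GDERIV f x :> D"
  shows "gradient f x = D"
  unfolding gradient_def
proof (rule the_equality, rule assms)
  fix D' assume "GDERIV f x :> D'"
  with assms have "(\<lambda>h. h \<bullet> D) = (\<lambda>h. h \<bullet> D')"
    unfolding gderiv_def by (rule has_derivative_unique)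
  then have "(D' - D) \<bullet> (D' - D) = 0"
    by (metis inner_diff_right right_minus_eq)
  then show "D' = D" by simp
qed

lemma GDERIV_gradient:
  fixes f :: "'a::euclidean_space \<Rightarrow> real"
  assumes "f differentiable at x"
  shows "GDERIV f x :> gradient f x"
proof -
  obtain F where F: "(f has_derivative F) (at x)"
    using assms by (auto simp: differentiable_def)
  interpret F: bounded_linear F
    using F by (rule has_derivative_bounded_linear)
  have "F h = h \<bullet> (\<Sum>b\<in>Basis. F b *\<^sub>R b)" for h
  proof -
    have "F h = F (\<Sum>b\<in>Basis. (h \<bullet> b) *\<^sub>R b)" by (simp add: euclidean_representation)
    also have "\<dots> = h \<bullet> (\<Sum>b\<in>Basis. F b *\<^sub>R b)"
      by (simp add: F.sum F.scaleR inner_sum_right mult.commute)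
    finally show ?thesis .
  qed
  then have "F = (\<lambda>h. h \<bullet> (\<Sum>b\<in>Basis. F b *\<^sub>R b))" by blast
  with F have "GDERIV f x :> (\<Sum>b\<in>Basis. F b *\<^sub>R b)"
    by (simp add: gderiv_def)
  with gradient_eqI show ?thesis by metis
qed

definition charpoly :: "real ^ 'n ^ 'n \<Rightarrow> real poly" where
  "charpoly A = det (mat [:0, 1:] - (\<chi> i j. [:A $ i $ j:]))"

lemma poly_charpoly_eq_0_iff:
  "poly (charpoly A) c = 0 \<longleftrightarrow> (\<exists>v. v \<noteq> 0 \<and> A *v v = c *s v)"
proof -
  have "poly (charpoly A) c = det (mat c - A)"
    by (simp add: charpoly_def det_def poly_sum poly_prod mat_def of_int_poly
        if_distrib[where f = "\<lambda>p. poly p c"] cong: if_cong)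
  also have "\<dots> = 0 \<longleftrightarrow> (\<exists>v. v \<noteq> 0 \<and> (mat c - A) *v v = 0)"
    by (metis invertible_det_nz invertible_left_inverse matrix_left_invertible_ker)
  also have "\<dots> \<longleftrightarrow> (\<exists>v. v \<noteq> 0 \<and> A *v v = c *s v)"
  proof -
    have "mat c *v v = c *s v" for v :: "real ^ 'n"
      by (simp add: vec_eq_iff mat_def matrix_vector_mult_def if_distrib[where f = "\<lambda>a. a * _"]
          cong: if_cong)
    then show ?thesis by (metis matrix_vector_mult_diff_rdistrib right_minus_eq)
  qed
  finally show ?thesis .
qed

text \<open>All eigenvalues \<open>e 1 \<le> \<dots> \<le> e n\<close> of an \<open>n \<times> n\<close> matrix, listed with multiplicity.
  The values of \<open>e\<close> outside \<open>{1..n}\<close> are irrelevant.\<close>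

definition ordered_eigenvalues :: "real ^ 'n ^ 'n \<Rightarrow> (nat \<Rightarrow> real) \<Rightarrow> bool" where
  "ordered_eigenvalues A e \<longleftrightarrow>
     mono_on {1..CARD('n)} e \<and> charpoly A = (\<Prod>j = 1..CARD('n). [:- e j, 1:])"

definition solution ::
  "real \<Rightarrow> (real \<Rightarrow> real ^ 'n \<Rightarrow> real) \<Rightarrow> real \<Rightarrow> (real \<Rightarrow> real ^ 'n) \<Rightarrow> bool" where
  "solution \<tau> V l x \<longleftrightarrow>
     (\<forall>t. (x has_vector_derivative
             gradient (V l) (x (t - \<tau>)) + gradient (V l) (x (t - 2 * \<tau>))) (at t)) \<and>
     (\<forall>t. x (t + 3 * \<tau>) = - x t)"

definition nonzero_solution ::
  "real \<Rightarrow> (real \<Rightarrow> real ^ 'n \<Rightarrow> real) \<Rightarrow> real \<Rightarrow> (real \<Rightarrow> real ^ 'n) \<Rightarrow> bool" where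
  "nonzero_solution \<tau> V l x \<longleftrightarrow> solution \<tau> V l x \<and> (\<exists>t. x t \<noteq> 0)"

text \<open>The \<open>C\<^sup>1\<close> norm of the restriction of \<open>x\<close> to \<open>[a, b]\<close>; it is meaningful only if \<open>a < b\<close> and
  the restriction is of class \<open>C\<^sup>1\<close>, which holds for the solutions considered here.\<close>

definition C1_norm :: "real \<Rightarrow> real \<Rightarrow> (real \<Rightarrow> 'a::real_normed_vector) \<Rightarrow> real" where
  "C1_norm a b x =
     (SUP t\<in>{a..b}. norm (x t)) + (SUP t\<in>{a..b}. norm (vector_derivative x (at t within {a..b})))"

definition tends_to_0_C1_loc ::
  "('i \<Rightarrow> real \<Rightarrow> 'a::real_normed_vector) \<Rightarrow> 'i filter \<Rightarrow> bool" where
  "tends_to_0_C1_loc x F \<longleftrightarrow>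
     (\<forall>K. compact K \<longrightarrow>
        uniform_limit K x (\<lambda>_. 0) F \<and>
        uniform_limit K (\<lambda>i t. vector_derivative (x i) (at t)) (\<lambda>_. 0) F)"

definition bifurcation_point ::
  "real set \<Rightarrow> real \<Rightarrow> (real \<Rightarrow> real ^ 'n \<Rightarrow> real) \<Rightarrow> real \<Rightarrow> bool" where
  "bifurcation_point \<Lambda> \<tau> V \<mu> \<longleftrightarrow>
     (\<exists>l x. (\<forall>k::nat. l k \<in> \<Lambda>) \<and> l \<longlonglongrightarrow> \<mu> \<and>
            (\<forall>k. nonzero_solution \<tau> V (l k) (x k)) \<and>
            (\<lambda>k. C1_norm 0 (3 * \<tau>) (x k)) \<longlonglongrightarrow> 0)"

definition resonant_values :: "real set" where
  "resonant_values = {2 * pi / 3 + (2 * of_int j + 1) * pi |j::int. True}"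

definition resonant_indices :: "nat \<Rightarrow> real \<Rightarrow> (nat \<Rightarrow> real) \<Rightarrow> nat set" where
  "resonant_indices n \<tau> e = {j \<in> {1..n}. sqrt 3 * e j * \<tau> \<in> resonant_values}"

definition left_neighborhood :: "real set \<Rightarrow> real \<Rightarrow> real set \<Rightarrow> bool" where
  "left_neighborhood \<Lambda> \<mu> S \<longleftrightarrow> S \<subseteq> \<Lambda> \<inter> {..\<mu>} \<and> (\<exists>\<delta>>0. \<Lambda> \<inter> {\<mu> - \<delta><..\<mu>} \<subseteq> S)"

definition right_neighborhood :: "real set \<Rightarrow> real \<Rightarrow> real set \<Rightarrow> bool" where
  "right_neighborhood \<Lambda> \<mu> S \<longleftrightarrow> S \<subseteq> \<Lambda> \<inter> {\<mu>..} \<and> (\<exists>\<delta>>0. \<Lambda> \<inter> {\<mu>..<\<mu> + \<delta>} \<subseteq> S)"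

text \<open>For every \<open>l \<in> S - {\<mu>}\<close> there are \<open>k\<close> distinct pairs \<open>{x i l, - x i l}\<close> of nontrivial
  solutions, and each of them tends to zero in \<open>C\<^sup>1\<^sub>l\<^sub>o\<^sub>c\<close> as \<open>l\<close> tends to \<open>\<mu>\<close> in \<open>S\<close>.\<close>

definition has_solution_pairs ::
  "real \<Rightarrow> (real \<Rightarrow> real ^ 'n \<Rightarrow> real) \<Rightarrow> real \<Rightarrow> real set \<Rightarrow> nat \<Rightarrow> bool" where
  "has_solution_pairs \<tau> V \<mu> S k \<longleftrightarrow>
     (\<exists>x :: nat \<Rightarrow> real \<Rightarrow> real \<Rightarrow> real ^ 'n.
        (\<forall>l \<in> S - {\<mu>}.
           (\<forall>i\<in>{1..k}. nonzero_solution \<tau> V l (x i l)) \<and>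
           inj_on (\<lambda>i. {x i l, (\<lambda>t. - x i l t)}) {1..k}) \<and>
        (\<forall>i\<in>{1..k}. tends_to_0_C1_loc (x i) (at \<mu> within S)))"

end

theory Submission
  imports Defs "HOL-Combinatorics.Permutations"
begin

text \<open>
Let \<open>om = exp (i pi / 3)\<close>. Along a solution the combination \<open>x(t) - x(t - \<tau>) + x(t - 2 \<tau>)\<close> is constant,
and antiperiodicity makes it zero. Therefore \<open>z(t) = x(t) - i (x(t - \<tau>) + x(t - 2 \<tau>)) / sqrt 3\<close>, a curve in
complex \<open>n\<close>-space, satisfies the twist condition \<open>z(t + \<tau>) = cnj om z(t)\<close>: delays have become rotations. The
delay equation turns into the autonomous Hamiltonian system \<open>z' = (2 / sqrt 3) i F(z)\<close>, where \<open>F\<close> is the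
gradient of \<open>H(z) = V(Re z) + V(Re (om z)) + V(Re (cnj om z))\<close>. Its linearization at zero is
\<open>z' = sqrt 3 i B z\<close> with \<open>B\<close> the Hessian of \<open>V\<close> at zero, and the mode with frequency \<open>sqrt 3 e\<^sub>j\<close> obeys the twist
condition exactly if \<open>sqrt 3 e\<^sub>j \<tau>\<close> is a resonant value.

Fix \<open>\<mu>\<close> and coordinates in which the Hessian at \<open>\<mu>\<close> is diagonal, and let \<open>K\<close> be the space of amplitudes of the
resonant modes. A Green operator inverts the linear problem off the resonant modes, and a contraction
(\<open>reduced_exists\<close>) yields for each small \<open>v\<close> in \<open>K\<close> a curve \<open>Z v\<close> with resonant part \<open>v\<close> that solves the system
up to a resonant error \<open>c v\<close>. The zeros of \<open>c\<close> give small solutions. If there is no resonance then \<open>K = 0\<close>, and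
the contraction leaves only the zero solution, so bifurcation requires a resonance. In general \<open>c\<close> is the
gradient of the action \<open>\<phi>\<close> of \<open>Z v\<close> (\<open>action_increment\<close>).

When the parameter moves so that all resonant eigenvalues decrease, \<open>c v \<bullet> v\<close> becomes positive for small
nonzero \<open>v\<close>, and when they increase it becomes negative (\<open>c_definite\<close>); this is a count of dimensions of
subspaces on which the quadratic form of the linearization has a sign (\<open>form_positive_of_dimension_count\<close>,
\<open>eigenvalue_order_definite\<close>). So zero is a local minimum of \<open>\<phi>\<close> for parameters of the first kind and a local
maximum for those of the second kind. A local minimum that is the only critical point in a ball of radius \<open>r\<close>
is a minimum on a smaller ball, whose radius depends only on \<open>r\<close>, on a lower bound for the gradient in an annulus
and on a bound for the curvature (\<open>local_minimum_spreads\<close>). Consequently, if parameters of both kinds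
accumulate at \<open>\<mu>\<close> and neither they nor \<open>\<mu>\<close> have small nonzero solutions, then \<open>\<phi>\<close> at \<open>\<mu>\<close> has at zero both a
minimum and a maximum on a common ball. It is constant there, and zero is not an isolated critical point
(\<open>no_passage_from_minima_to_maxima\<close>, \<open>small_solution_exists\<close>).

Sequences of parameters of both kinds therefore force bifurcation. If the eigenvalues cross strictly at \<open>\<mu>\<close> and
zero is isolated among the solutions at \<open>\<mu>\<close>, then on at least one side of \<open>\<mu>\<close> every parameter near \<open>\<mu>\<close> has
small nonzero solutions, since otherwise both sides would supply sequences without them. One such solution
provides any number of pairs, because its time shifts are solutions: a component which is antiperiodic and not
identically zero takes infinitely many absolute values (\<open>time_shifts_distinct\<close>).
\<close>

section \<open>Gradient fields with an isolated zero\<close>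

text \<open>A gradient relation on a ball of the subspace \<open>K\<close> with a uniform quadratic
  remainder. This is all that discrete gradient descent requires, and the constant \<open>L\<close> can be
  common to a family of functions.\<close>

definition quadratic_gradient ::
  "'a::real_inner set \<Rightarrow> real \<Rightarrow> real \<Rightarrow> ('a \<Rightarrow> real) \<Rightarrow> ('a \<Rightarrow> 'a) \<Rightarrow> bool" where
  "quadratic_gradient K r L \<phi> c \<longleftrightarrow>
     (\<forall>v\<in>K \<inter> cball 0 r. c v \<in> K \<and>
        (\<forall>w\<in>K \<inter> cball 0 r. \<bar>\<phi> w - \<phi> v - c v \<bullet> (w - v)\<bar> \<le> L * (norm (w - v))\<^sup>2))"

lemma quadratic_gradientD:
  assumes "quadratic_gradient K r L \<phi> c" "v \<in> K" "norm v \<le> r"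
  shows "c v \<in> K"
    and "w \<in> K \<Longrightarrow> norm w \<le> r \<Longrightarrow> \<bar>\<phi> w - \<phi> v - c v \<bullet> (w - v)\<bar> \<le> L * (norm (w - v))\<^sup>2"
  using assms by (auto simp: quadratic_gradient_def)

lemma quadratic_gradient_uminus:
  assumes "quadratic_gradient K r L \<phi> c" "subspace K"
  shows "quadratic_gradient K r L (\<lambda>v. - \<phi> v) (\<lambda>v. - c v)"
proof -
  have "\<bar>- \<phi> w - - \<phi> v - - c v \<bullet> (w - v)\<bar> = \<bar>\<phi> w - \<phi> v - c v \<bullet> (w - v)\<bar>" for v w
    by (simp add: algebra_simps)
  then show ?thesis
    using assms unfolding quadratic_gradient_def by (auto intro: subspace_neg)
qed

lemma quadratic_gradient_subset:
  "quadratic_gradient K r L \<phi> c \<Longrightarrow> r' \<le> r \<Longrightarrow> quadratic_gradient K r' L \<phi> c"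
  by (auto simp: quadratic_gradient_def)

text \<open>For steps \<open>t \<le> 1 / (2 L)\<close> the quadratic remainder consumes at most half of the
  linear gain.\<close>

lemma gradient_step_decreases:
  assumes g: "quadratic_gradient K r L \<phi> c" and v: "v \<in> K" "norm v \<le> r"
    and w: "v - t *\<^sub>R c v \<in> K" "norm (v - t *\<^sub>R c v) \<le> r" and t: "0 \<le> t" "2 * L * t \<le> 1"
  shows "\<phi> (v - t *\<^sub>R c v) \<le> \<phi> v - t / 2 * (norm (c v))\<^sup>2"
proof -
  have "\<phi> (v - t *\<^sub>R c v) \<le> \<phi> v - t * (norm (c v))\<^sup>2 + L * (t * norm (c v))\<^sup>2"
    using quadratic_gradientD(2)[OF g v w] t
    by (simp add: power2_norm_eq_inner abs_le_iff)
  also have "L * (t * norm (c v))\<^sup>2 = (2 * L * t) * (t / 2 * (norm (c v))\<^sup>2)"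
    by (simp add: power2_eq_square)
  also have "\<dots> \<le> 1 * (t / 2 * (norm (c v))\<^sup>2)"
    by (rule mult_right_mono) (use t in auto)
  finally show ?thesis by simp
qed

lemma quadratic_gradient_local_min_eq_0:
  assumes g: "quadratic_gradient K r L \<phi> c" and K: "subspace K" and v: "v \<in> K" "norm v < r"
    and \<rho>: "\<rho> > 0" "\<And>w. w \<in> K \<Longrightarrow> norm (w - v) < \<rho> \<Longrightarrow> \<phi> v \<le> \<phi> w"
  shows "c v = 0"
proof (rule ccontr)
  assume c: "c v \<noteq> 0"
  have cK: "c v \<in> K" using quadratic_gradientD(1)[OF g] v by simp
  define t where "t = min (1 / (2 * (\<bar>L\<bar> + 1))) (min (\<rho> / 2) (r - norm v) / norm (c v))"
  have t0: "t > 0" using c v \<rho> by (simp add: t_def)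
  have "t \<le> min (\<rho> / 2) (r - norm v) / norm (c v)" by (simp add: t_def)
  then have tc: "t * norm (c v) \<le> min (\<rho> / 2) (r - norm v)"
    using c by (simp add: pos_le_divide_eq)
  have "t \<le> 1 / (2 * (\<bar>L\<bar> + 1))" by (simp add: t_def)
  then have "2 * (\<bar>L\<bar> + 1) * t \<le> 1" by (simp add: field_simps)
  moreover have "2 * L * t \<le> 2 * (\<bar>L\<bar> + 1) * t" using t0 by (intro mult_right_mono) auto
  ultimately have tL: "2 * L * t \<le> 1" by simp
  have w: "v - t *\<^sub>R c v \<in> K" using K v cK by (simp add: subspace_diff subspace_scale)
  have n: "norm (v - t *\<^sub>R c v) \<le> r"
    using norm_triangle_ineq4[of v "t *\<^sub>R c v"] tc t0 by simp
  have "\<phi> (v - t *\<^sub>R c v) \<le> \<phi> v - t / 2 * (norm (c v))\<^sup>2"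
    using gradient_step_decreases[OF g _ _ w n] v t0 tL by simp
  moreover have "\<phi> v \<le> \<phi> (v - t *\<^sub>R c v)"
    using \<rho> w tc t0 by (intro \<rho>(2)) auto
  moreover have "t / 2 * (norm (c v))\<^sup>2 > 0" using t0 c by simp
  ultimately show False by linarith
qed

lemma quadratic_gradient_continuous:
  assumes g: "quadratic_gradient K r L \<phi> c" and L: "L \<ge> 0"
    and M: "\<And>v. v \<in> K \<Longrightarrow> norm v \<le> r \<Longrightarrow> norm (c v) \<le> M"
  shows "continuous_on (K \<inter> cball 0 r) \<phi>"
proof (cases "r \<ge> 0 \<and> M \<ge> 0")
  case False
  then have "K \<inter> cball 0 r = {}"
    using M norm_ge_zero[THEN order_trans] by fastforce
  then show ?thesis by simp
next
  case True
  have "(M + 2 * r * L)-lipschitz_on (K \<inter> cball 0 r) \<phi>"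
  proof (rule lipschitz_onI)
    fix w v assume wv: "w \<in> K \<inter> cball 0 r" "v \<in> K \<inter> cball 0 r"
    then have "\<bar>\<phi> w - \<phi> v - c v \<bullet> (w - v)\<bar> \<le> L * (norm (w - v))\<^sup>2"
      using quadratic_gradientD(2)[OF g] by auto
    moreover have "\<bar>c v \<bullet> (w - v)\<bar> \<le> M * norm (w - v)"
      using M[of v] wv by (intro order_trans[OF Cauchy_Schwarz_ineq2 mult_right_mono]) auto
    moreover have "norm (w - v) \<le> 2 * r"
      using wv norm_triangle_ineq4[of w v] by simp
    then have "L * (norm (w - v))\<^sup>2 \<le> L * (2 * r * norm (w - v))"
      using L by (intro mult_left_mono) (auto simp: power2_eq_square mult_right_mono)
    ultimately show "dist (\<phi> w) (\<phi> v) \<le> (M + 2 * r * L) * dist w v"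
      by (simp add: dist_norm dist_real_def algebra_simps)
  qed (use True L in auto)
  then show ?thesis by (rule lipschitz_on_continuous_on)
qed

text \<open>Follow discrete gradient descent from the points \<open>s *\<^sub>R x\<close>, where
  \<open>s\<close> runs from 0 to 1. An orbit that never drops below \<open>\<phi> 0\<close> cannot cross
  the annulus \<open>r / 2 \<le> norm v\<close>, since crossing it costs more than the at most \<open>L *
  (norm x)\<^sup>2\<close> available; so it stays inside and approaches zero, the only critical point, where
  it is caught by a neighborhood on which \<open>\<phi> 0\<close> is the minimum. Being caught and dropping
  below \<open>\<phi> 0\<close> are therefore complementary conditions on \<open>s\<close>. Both are open,
  the first holds for \<open>s = 0\<close>, and the second would hold for \<open>s = 1\<close> if the claim
  failed, contrary to the connectedness of \<open>[0, 1]\<close>.\<close>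

lemma local_minimum_spreads:
  fixes \<phi> :: "'a::euclidean_space \<Rightarrow> real"
  assumes K: "subspace K" and r: "r > 0" and L: "L > 0" and \<beta>: "\<beta> > 0"
    and g: "quadratic_gradient K r L \<phi> c" and cont: "continuous_on (K \<inter> cball 0 r) c"
    and nz: "\<And>v. v \<in> K \<Longrightarrow> 0 < norm v \<Longrightarrow> norm v \<le> r \<Longrightarrow> c v \<noteq> 0"
    and ann: "\<And>v. v \<in> K \<Longrightarrow> r / 2 \<le> norm v \<Longrightarrow> norm v \<le> r \<Longrightarrow> \<beta> \<le> norm (c v)"
    and min: "\<rho> > 0" "\<And>v. v \<in> K \<Longrightarrow> norm v < \<rho> \<Longrightarrow> \<phi> 0 \<le> \<phi> v"
    and x: "x \<in> K" "norm x \<le> r / 2" "16 * L * (norm x)\<^sup>2 < \<beta> * r"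
  shows "\<phi> 0 \<le> \<phi> x"
proof (rule ccontr)
  assume neg: "\<not> \<phi> 0 \<le> \<phi> x"
  define D where "D = K \<inter> cball 0 r"
  have D: "v \<in> D \<longleftrightarrow> v \<in> K \<and> norm v \<le> r" for v by (auto simp: D_def)
  have cD: "compact D" unfolding D_def
    using closed_subspace[OF K] by (simp add: closed_Int_compact)
  have "bounded (c ` D)" using compact_continuous_image[OF cont[folded D_def] cD] compact_imp_bounded by blast
  then obtain M where M: "M > 0" "\<And>v. v \<in> D \<Longrightarrow> norm (c v) \<le> M"
    by (auto simp: bounded_pos)
  have phc: "continuous_on D \<phi>" unfolding D_def
    by (rule quadratic_gradient_continuous[OF g, of M]) (use L M in \<open>auto simp: D\<close>)
  have K0: "0 \<in> K" using K by (rule subspace_0)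
  have c0: "c 0 = 0"
    by (rule quadratic_gradient_local_min_eq_0[OF g K K0 _ min(1)]) (use r min in auto)
  have ub: "\<phi> v \<le> \<phi> 0 + L * (norm v)\<^sup>2" if "v \<in> D" for v
    using quadratic_gradientD(2)[OF g K0, of v] that r c0 by (auto simp: D abs_le_iff)
  define \<epsilon> where "\<epsilon> = min (\<rho> / 2) (r / 2)"
  have \<epsilon>: "\<epsilon> > 0" "\<epsilon> < \<rho>" "\<epsilon> \<le> r / 2" using min r by (auto simp: \<epsilon>_def)
  define A where "A = {v \<in> D. \<epsilon> / 2 \<le> norm v \<and> norm v \<le> \<epsilon>}"
  have cA: "compact A"
  proof -
    have "A = D \<inter> ((norm -` {\<epsilon> / 2..}) \<inter> cball 0 \<epsilon>)" by (auto simp: A_def)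
    moreover have "closed (((norm :: 'a \<Rightarrow> real) -` {\<epsilon> / 2..}) \<inter> cball 0 \<epsilon>)"
      by (intro closed_Int closed_vimage) (auto intro: continuous_intros)
    ultimately show ?thesis using cD by (simp add: compact_Int_closed)
  qed
  have Apos: "\<phi> 0 < \<phi> v" if "v \<in> A" for v
  proof (rule ccontr)
    assume "\<not> \<phi> 0 < \<phi> v"
    moreover have vv: "v \<in> K" "norm v \<le> \<epsilon>" "\<epsilon> / 2 \<le> norm v" using that by (auto simp: A_def D)
    ultimately have e: "\<phi> v = \<phi> 0" using min(2)[of v] \<epsilon> by auto
    have "c v = 0"
    proof (rule quadratic_gradient_local_min_eq_0[OF g K vv(1)])
      show "norm v < r" "\<rho> - \<epsilon> > 0" using vv \<epsilon> r by auto
      fix w assume w: "w \<in> K" "norm (w - v) < \<rho> - \<epsilon>"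
      then have "norm w < \<rho>" using norm_triangle_ineq[of "w - v" v] vv by simp
      then show "\<phi> v \<le> \<phi> w" using min(2)[OF w(1)] e by simp
    qed
    moreover have "0 < norm v" "norm v \<le> r" using vv \<epsilon> r by linarith+
    ultimately show False using nz[of v] vv(1) by blast
  qed
  obtain m where m: "m > 0" "\<And>v. v \<in> A \<Longrightarrow> \<phi> 0 + m \<le> \<phi> v"
  proof (cases "A = {}")
    case True then show thesis using that[of 1] by auto
  next
    case False
    have "continuous_on A \<phi>" using phc by (rule continuous_on_subset) (auto simp: A_def)
    from continuous_attains_inf[OF cA False this] obtain a
      where "a \<in> A" "\<And>v. v \<in> A \<Longrightarrow> \<phi> a \<le> \<phi> v" by blast
    with Apos[of a] show thesis by (intro that[of "\<phi> a - \<phi> 0"]) auto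
  qed
  \<comment> \<open>The bound \<open>\<epsilon> / 2\<close> prevents a step from jumping over the set \<open>A\<close>.\<close>
  define \<eta> where "\<eta> = min (1 / (2 * L)) (min (r / 8) (\<epsilon> / 2) / M)"
  have \<eta>: "\<eta> > 0" "2 * L * \<eta> \<le> 1" "\<eta> * M \<le> r / 8" "\<eta> * M \<le> \<epsilon> / 2"
  proof -
    show "\<eta> > 0" using L r \<epsilon> M by (simp add: \<eta>_def)
    have "\<eta> \<le> 1 / (2 * L)" by (simp add: \<eta>_def)
    then show "2 * L * \<eta> \<le> 1" using L by (simp add: field_simps)
    have "\<eta> \<le> min (r / 8) (\<epsilon> / 2) / M" by (simp add: \<eta>_def)
    then have "\<eta> * M \<le> min (r / 8) (\<epsilon> / 2)" using M by (simp add: pos_le_divide_eq)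
    then show "\<eta> * M \<le> r / 8" "\<eta> * M \<le> \<epsilon> / 2" by auto
  qed
  \<comment> \<open>The cutoff keeps the steps inside the ball of radius \<open>r\<close>; it equals 1 up to \<open>7 * r / 8\<close>.\<close>
  define \<theta> where "\<theta> v = max 0 (min 1 ((r - norm v) * (8 / r)))" for v :: 'a
  define \<Phi> where "\<Phi> v = v - (\<eta> * \<theta> v) *\<^sub>R c v" for v
  have \<theta>: "0 \<le> \<theta> v" "\<theta> v \<le> 1" for v by (auto simp: \<theta>_def)
  have step: "norm (\<Phi> v - v) \<le> \<theta> v * (\<eta> * M)" if "v \<in> D" for v
  proof -
    have "norm (\<Phi> v - v) = \<theta> v * (\<eta> * norm (c v))"
      using \<eta>(1) \<theta>(1)[of v] by (simp add: \<Phi>_def)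
    also have "\<dots> \<le> \<theta> v * (\<eta> * M)"
      using M(2)[OF that] \<eta>(1) \<theta>(1)[of v] by (intro mult_left_mono) auto
    finally show ?thesis .
  qed
  have step8: "norm (\<Phi> v - v) \<le> \<eta> * M" if "v \<in> D" for v
    using \<theta>[of v] \<eta>(1) M(1)
    by (intro order_trans[OF step[OF that] mult_left_le_one_le]) auto
  have \<Phi>D: "\<Phi> v \<in> D" if v: "v \<in> D" for v
  proof -
    have "\<Phi> v \<in> K" using v K quadratic_gradientD(1)[OF g]
      by (auto simp: \<Phi>_def D intro!: subspace_diff subspace_scale)
    moreover have "\<theta> v * (\<eta> * M) \<le> r - norm v"
    proof -
      have "\<theta> v \<le> (r - norm v) * (8 / r)" using v r by (auto simp: \<theta>_def D)
      then have "\<theta> v * (\<eta> * M) \<le> ((r - norm v) * (8 / r)) * (r / 8)"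
        using \<eta> M(1) v r \<theta>[of v] by (intro mult_mono) (auto simp: D)
      then show ?thesis using r by simp
    qed
    then have "norm (\<Phi> v) \<le> r"
      using step[OF v] norm_triangle_sub[of "\<Phi> v" v] by linarith
    ultimately show ?thesis by (simp add: D)
  qed
  have dec: "\<phi> (\<Phi> v) \<le> \<phi> v - \<eta> * \<theta> v / 2 * (norm (c v))\<^sup>2" if v: "v \<in> D" for v
  proof -
    have "2 * L * (\<eta> * \<theta> v) \<le> 1"
      using \<eta>(2) \<theta>[of v] \<eta>(1) L mult_mono[of "2 * L * \<eta>" 1 "\<theta> v" 1] by (simp add: mult.assoc)
    with gradient_step_decreases[OF g, of v "\<eta> * \<theta> v"] v \<Phi>D[OF v] \<eta>(1) \<theta>[of v]
    show ?thesis by (simp add: D \<Phi>_def)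
  qed
  have dec0: "\<phi> (\<Phi> v) \<le> \<phi> v" if v: "v \<in> D" for v
    using \<eta>(1) \<theta>[of v]
    by (intro order_trans[OF dec[OF v]]) simp
  \<comment> \<open>Steps have length at most \<open>r / 8\<close>, so one starting below \<open>r / 2\<close> ends below \<open>5 * r / 8\<close>.\<close>
  define \<psi> where "\<psi> v = \<phi> v + \<beta> / 2 * max 0 (norm v - 5 * r / 8)" for v
  \<comment> \<open>Crossing the annulus costs at least \<open>\<beta> / 2\<close> per unit of length.\<close>
  have dec\<psi>: "\<psi> (\<Phi> v) \<le> \<psi> v" if v: "v \<in> D" for v
  proof (cases "r / 2 \<le> norm v")
    case True
    have b: "\<beta> \<le> norm (c v)" using ann[of v] v True by (auto simp: D)
    have e: "norm (\<Phi> v - v) = \<eta> * \<theta> v * norm (c v)"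
      using \<eta>(1) \<theta>[of v] by (simp add: \<Phi>_def)
    have "\<beta> / 2 * norm (\<Phi> v - v) \<le> norm (c v) / 2 * norm (\<Phi> v - v)"
      using b by (intro mult_right_mono) auto
    also have "\<dots> = \<eta> * \<theta> v / 2 * (norm (c v))\<^sup>2" by (simp add: e power2_eq_square)
    finally have "\<phi> (\<Phi> v) + \<beta> / 2 * norm (\<Phi> v - v) \<le> \<phi> v" using dec[OF v] by simp
    moreover have "max 0 (norm (\<Phi> v) - 5 * r / 8) \<le> max 0 (norm v - 5 * r / 8) + norm (\<Phi> v - v)"
      using norm_triangle_sub[of "\<Phi> v" v] by auto
    then have "\<beta> / 2 * max 0 (norm (\<Phi> v) - 5 * r / 8)
        \<le> \<beta> / 2 * (max 0 (norm v - 5 * r / 8) + norm (\<Phi> v - v))"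
      using \<beta> by (intro mult_left_mono) auto
    ultimately show ?thesis by (simp add: \<psi>_def distrib_left)
  next
    case False
    then have "norm (\<Phi> v) \<le> 5 * r / 8"
      using norm_triangle_sub[of "\<Phi> v" v] step8[OF v] \<eta>(3) by simp
    then show ?thesis using dec0[OF v] False \<beta> r by (simp add: \<psi>_def)
  qed
  have \<Phi>c: "continuous_on D \<Phi>"
    unfolding \<Phi>_def \<theta>_def by (intro continuous_intros cont[folded D_def])
  define X where "X k s = (\<Phi> ^^ k) (s *\<^sub>R x)" for k s
  have X0: "X 0 s = s *\<^sub>R x" and XS: "X (Suc k) s = \<Phi> (X k s)" for k s
    by (simp_all add: X_def)
  have x0: "s *\<^sub>R x \<in> D" if "s \<in> {0..1}" for s
    using that x r K mult_left_le_one_le[of "norm x" s] by (auto simp: D subspace_scale)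
  have XD: "X k s \<in> D" if "s \<in> {0..1}" for k s
    by (induction k) (use x0[OF that] \<Phi>D in \<open>auto simp: X0 XS\<close>)
  have Xc: "continuous_on {0..1} (X k)" for k
  proof (induction k)
    case 0
    then show ?case by (simp add: X0[abs_def] continuous_intros)
  next
    case (Suc k)
    then show ?case unfolding XS[abs_def]
      using continuous_on_compose2[OF \<Phi>c Suc] XD by (auto simp: image_subset_iff)
  qed
  have phX: "continuous_on {0..1} (\<lambda>s. \<phi> (X k s))" for k
    using continuous_on_compose2[OF phc Xc] XD by (auto simp: image_subset_iff)
  have mono: "\<phi> (X k s) \<le> \<phi> (X j s)" if "s \<in> {0..1}" "j \<le> k" for j k s
    using that(2) by (induction k rule: dec_induct)
      (use dec0[OF XD[OF that(1)]] in \<open>auto simp: XS intro: order_trans\<close>)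
  define T where "T = (\<Union>k. {0..1} \<inter> (\<lambda>s. \<phi> (X k s)) -` {..<\<phi> 0})"
  define U where "U = (\<Union>k. ({0..1} \<inter> X k -` ball 0 (\<epsilon> / 2)) \<inter> ({0..1} \<inter> (\<lambda>s. \<phi> (X k s)) -` {..<\<phi> 0 + m}))"
  have oT: "openin (top_of_set {0..1}) T" unfolding T_def
    by (intro openin_Union ballI) (auto intro!: continuous_openin_preimage_gen phX)
  have oU: "openin (top_of_set {0..1}) U" unfolding U_def
    by (intro openin_Union ballI) (auto intro!: openin_Int continuous_openin_preimage_gen phX Xc)
  have TU: "T \<inter> U = {}"
  proof (rule ccontr)
    assume "T \<inter> U \<noteq> {}"
    then obtain s j k where s: "s \<in> {0..1}" and j: "\<phi> (X j s) < \<phi> 0"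
      and k: "norm (X k s) < \<epsilon> / 2" "\<phi> (X k s) < \<phi> 0 + m"
      by (fastforce simp: T_def U_def)
    have "norm (X i s) < \<epsilon> / 2 \<and> \<phi> (X i s) < \<phi> 0 + m" if "k \<le> i" for i
      using that
    proof (induction i rule: dec_induct)
      case base show ?case using k by simp
    next
      case (step i)
      have d: "X i s \<in> D" "X (Suc i) s \<in> D" using XD[OF s] by auto
      have l: "\<phi> (X (Suc i) s) < \<phi> 0 + m" using mono[OF s, of i "Suc i"] step.IH by simp
      have "norm (X (Suc i) s) < \<epsilon>"
        using step8[OF d(1)] \<eta>(4) step.IH norm_triangle_sub[of "X (Suc i) s" "X i s"]
        by (simp add: XS)
      then have "norm (X (Suc i) s) < \<epsilon> / 2"
        using m(2)[of "X (Suc i) s"] d l by (force simp: A_def)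
      with l show ?case by simp
    qed
    from this[of "max j k"] have "norm (X (max j k) s) < \<rho>" using \<epsilon> by simp
    then have "\<phi> 0 \<le> \<phi> (X (max j k) s)" using min(2) XD[OF s] by (auto simp: D)
    then show False using mono[OF s max.cobounded1, of j k] j by linarith
  qed
  have cover: "{0..1} \<subseteq> T \<union> U"
  proof (rule ccontr)
    assume "\<not> {0..1} \<subseteq> T \<union> U"
    then obtain s where s: "s \<in> {0..1}" "s \<notin> T" "s \<notin> U" by blast
    have ge: "\<phi> 0 \<le> \<phi> (X k s)" for k using s by (auto simp: T_def not_less)
    have notU: "\<epsilon> / 2 \<le> norm (X k s) \<or> \<phi> 0 + m \<le> \<phi> (X k s)" for k
      using s by (auto simp: U_def not_less)
    define \<epsilon>' where "\<epsilon>' = min (\<epsilon> / 2) (sqrt (m / L))"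
    have e': "\<epsilon>' > 0" using \<epsilon> m L by (simp add: \<epsilon>'_def)
    have away: "\<epsilon>' \<le> norm (X k s)" for k
    proof (rule ccontr)
      assume "\<not> \<epsilon>' \<le> norm (X k s)"
      then have l: "norm (X k s) < \<epsilon> / 2" "norm (X k s) < sqrt (m / L)" by (auto simp: \<epsilon>'_def)
      from l(2) have "(norm (X k s))\<^sup>2 < m / L"
        using power_strict_mono[OF l(2) norm_ge_zero, of 2] m L by simp
      then have "L * (norm (X k s))\<^sup>2 < m" using L by (simp add: field_simps)
      then show False using notU[of k] l(1) ub[OF XD[OF s(1), of k]] by linarith
    qed
    have "\<psi> (X k s) \<le> \<phi> 0 + L * (norm x)\<^sup>2" for k
    proof (induction k)
      case 0
      have n: "norm (s *\<^sub>R x) \<le> norm x" using s by (auto intro: mult_left_le_one_le)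
      then have "L * (norm (s *\<^sub>R x))\<^sup>2 \<le> L * (norm x)\<^sup>2"
        using L by (intro mult_left_mono power_mono) auto
      moreover have "max 0 (norm (s *\<^sub>R x) - 5 * r / 8) = 0" using n x(2) r by linarith
      ultimately show ?case using ub[OF x0[OF s(1)]] by (simp only: X0 \<psi>_def)
    next
      case (Suc k)
      then show ?case using dec\<psi>[OF XD[OF s(1), of k]] by (simp add: XS)
    qed
    then have "\<phi> (X k s) + \<beta> / 2 * max 0 (norm (X k s) - 5 * r / 8) \<le> \<phi> 0 + L * (norm x)\<^sup>2" for k
      by (simp only: \<psi>_def)
    then have "\<beta> / 2 * max 0 (norm (X k s) - 5 * r / 8) \<le> L * (norm x)\<^sup>2" for k
      using ge[of k] by (meson add_le_cancel_left add_right_mono order_trans)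
    moreover have "L * (norm x)\<^sup>2 < \<beta> / 2 * (r / 8)" using x(3) by simp
    ultimately have "\<beta> / 2 * max 0 (norm (X k s) - 5 * r / 8) < \<beta> / 2 * (r / 8)" for k
      by (rule order_le_less_trans)
    then have lt: "max 0 (norm (X k s) - 5 * r / 8) < r / 8" for k
      using \<beta> by (simp only: mult_less_cancel_left_pos half_gt_zero)
    have X34: "norm (X k s) < 3 * r / 4" for k
      using order_le_less_trans[OF max.cobounded2 lt[of k]] by linarith
    have th: "\<theta> (X k s) = 1" for k
    proof -
      have "1 \<le> (r - norm (X k s)) * (8 / r)" using r X34[of k] by (simp add: field_simps)
      then show ?thesis by (simp add: \<theta>_def)
    qed
    define Q where "Q = {v \<in> D. \<epsilon>' \<le> norm v}"
    have cQ: "compact Q"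
    proof -
      have "Q = D \<inter> (norm -` {\<epsilon>'..})" by (auto simp: Q_def)
      moreover have "closed ((norm :: 'a \<Rightarrow> real) -` {\<epsilon>'..})"
        by (intro closed_vimage) (auto intro: continuous_intros)
      ultimately show ?thesis using cD by (simp add: compact_Int_closed)
    qed
    have XQ: "X k s \<in> Q" for k using XD[OF s(1)] away by (simp add: Q_def)
    have "continuous_on Q (\<lambda>v. norm (c v))"
      by (intro continuous_intros continuous_on_subset[OF cont]) (auto simp: Q_def D)
    from continuous_attains_inf[OF cQ _ this] XQ obtain q
      where q: "q \<in> Q" "\<And>v. v \<in> Q \<Longrightarrow> norm (c q) \<le> norm (c v)" by (metis empty_iff)
    define \<gamma> where "\<gamma> = \<eta> / 2 * (norm (c q))\<^sup>2"
    have "q \<in> K" "0 < norm q" "norm q \<le> r" using q(1) e' by (auto simp: Q_def D)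
    then have "c q \<noteq> 0" by (rule nz)
    then have \<gamma>: "\<gamma> > 0" using \<eta>(1) by (simp add: \<gamma>_def)
    have lin: "\<phi> (X k s) \<le> \<phi> (X 0 s) - real k * \<gamma>" for k
    proof (induction k)
      case (Suc k)
      have "(norm (c q))\<^sup>2 \<le> (norm (c (X k s)))\<^sup>2" using q(2)[OF XQ] by (intro power_mono) auto
      then have "\<gamma> \<le> \<eta> / 2 * (norm (c (X k s)))\<^sup>2" using \<eta>(1) by (simp add: \<gamma>_def)
      then show ?case using Suc dec[OF XD[OF s(1), of k]] th[of k] by (simp add: XS algebra_simps)
    qed simp
    obtain k where "\<phi> (X 0 s) - \<phi> 0 < real k * \<gamma>"
      using \<gamma> reals_Archimedean3 by blast
    with lin[of k] ge[of k] show False by linarith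
  qed
  have "1 \<in> T" using neg unfolding T_def by (intro UN_I[of 0]) (auto simp: X0)
  moreover have "0 \<in> U" unfolding U_def using \<epsilon> m by (intro UN_I[of 0]) (auto simp: X0)
  ultimately show False
    using connected_Icc[of "0::real" 1] oT oU TU cover unfolding connected_openin by blast
qed


text \<open>Restricted to a ray, the quadratic remainder yields an honest derivative, so that the mean value
  theorem applies.\<close>

lemma quadratic_gradient_ray:
  assumes g: "quadratic_gradient K r L \<phi> c" and K: "subspace K" and v: "v \<in> K" "norm v \<le> r"
    and s: "s \<in> {0..1}" and L: "L \<ge> 0"
  shows "((\<lambda>s. \<phi> (s *\<^sub>R v)) has_derivative (\<lambda>h. h * (c (s *\<^sub>R v) \<bullet> v))) (at s within {0..1})"
  unfolding has_derivative_within_alt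
proof (intro conjI allI impI)
  show "bounded_linear (\<lambda>h. h * (c (s *\<^sub>R v) \<bullet> v))" by (rule bounded_linear_mult_left)
  fix e :: real assume e: "e > 0"
  define B where "B = L * (norm v)\<^sup>2 + 1"
  have B: "B > 0" using L by (simp add: B_def add_nonneg_pos)
  have D: "t *\<^sub>R v \<in> K" "norm (t *\<^sub>R v) \<le> r" if "t \<in> {0..1}" for t
    using that v K by (auto simp: subspace_scale intro: order_trans[OF mult_left_le_one_le])
  show "\<exists>d>0. \<forall>y\<in>{0..1}. norm (y - s) < d \<longrightarrow>
      norm (\<phi> (y *\<^sub>R v) - \<phi> (s *\<^sub>R v) - (y - s) * (c (s *\<^sub>R v) \<bullet> v)) \<le> e * norm (y - s)"
  proof (intro exI[of _ "e / B"] conjI ballI impI)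
    show "e / B > 0" using e B by simp
    fix y :: real assume y: "y \<in> {0..1}" "norm (y - s) < e / B"
    have "\<bar>\<phi> (y *\<^sub>R v) - \<phi> (s *\<^sub>R v) - c (s *\<^sub>R v) \<bullet> (y *\<^sub>R v - s *\<^sub>R v)\<bar>
        \<le> L * (norm (y *\<^sub>R v - s *\<^sub>R v))\<^sup>2"
      by (rule quadratic_gradientD(2)[OF g D[OF s] D[OF y(1)]])
    also have "\<dots> = L * (norm v)\<^sup>2 * \<bar>y - s\<bar> * \<bar>y - s\<bar>"
      by (simp flip: scaleR_diff_left add: power2_eq_square)
    also have "\<dots> \<le> B * \<bar>y - s\<bar> * \<bar>y - s\<bar>"
      by (intro mult_right_mono) (auto simp: B_def)
    also have "\<dots> \<le> e * \<bar>y - s\<bar>"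
      using y(2) B by (intro mult_right_mono) (auto simp: field_simps)
    finally show "norm (\<phi> (y *\<^sub>R v) - \<phi> (s *\<^sub>R v) - (y - s) * (c (s *\<^sub>R v) \<bullet> v)) \<le> e * norm (y - s)"
      by (simp flip: scaleR_diff_left)
  qed
qed

lemma radial_gradient_imp_minimum:
  assumes g: "quadratic_gradient K r L \<phi> c" and K: "subspace K" and L: "L \<ge> 0"
    and v: "v \<in> K" "norm v \<le> r" "norm v < \<rho>"
    and pos: "\<And>v. v \<in> K \<Longrightarrow> 0 < norm v \<Longrightarrow> norm v < \<rho> \<Longrightarrow> 0 < c v \<bullet> v"
  shows "\<phi> 0 \<le> \<phi> v"
proof -
  obtain s where s: "s \<in> {0<..<1::real}"
    and "\<phi> (1 *\<^sub>R v) - \<phi> (0 *\<^sub>R v) = (1 - 0) * (c (s *\<^sub>R v) \<bullet> v)"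
    using mvt_simple[OF zero_less_one quadratic_gradient_ray[OF g K v(1,2) _ L]] by auto
  then have e: "\<phi> v - \<phi> 0 = c (s *\<^sub>R v) \<bullet> v" by simp
  have "0 \<le> c (s *\<^sub>R v) \<bullet> v"
  proof (cases "v = 0")
    case False
    have "norm (s *\<^sub>R v) < \<rho>" using s v by (auto intro: order_le_less_trans[OF mult_left_le_one_le])
    then have "0 < c (s *\<^sub>R v) \<bullet> (s *\<^sub>R v)"
      using s False v K by (intro pos) (auto simp: subspace_scale)
    then show ?thesis using s by (simp add: zero_less_mult_iff)
  qed simp
  with e show ?thesis by simp
qed

text \<open>Integrating along rays, convergence of the gradients alone controls the increments of the
  functions.\<close>

lemma close_gradients_close_functions:
  assumes g: "quadratic_gradient K r L \<phi> c" "quadratic_gradient K r L \<phi>' c'"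
    and K: "subspace K" and L: "L \<ge> 0" and v: "v \<in> K" "norm v \<le> r"
    and d: "\<And>w. w \<in> K \<Longrightarrow> norm w \<le> r \<Longrightarrow> norm (c w - c' w) \<le> \<delta>"
  shows "\<bar>(\<phi> v - \<phi> 0) - (\<phi>' v - \<phi>' 0)\<bar> \<le> \<delta> * norm v"
proof -
  let ?f = "\<lambda>s. \<phi> (s *\<^sub>R v) - \<phi>' (s *\<^sub>R v)"
  obtain s where s: "s \<in> {0<..<1::real}"
    and "?f 1 - ?f 0 = (1 - 0) * (c (s *\<^sub>R v) \<bullet> v) - (1 - 0) * (c' (s *\<^sub>R v) \<bullet> v)"
    using mvt_simple[OF zero_less_one
        has_derivative_diff[OF quadratic_gradient_ray[OF g(1) K v _ L]
          quadratic_gradient_ray[OF g(2) K v _ L]]] by auto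
  then have "(\<phi> v - \<phi> 0) - (\<phi>' v - \<phi>' 0) = (c (s *\<^sub>R v) - c' (s *\<^sub>R v)) \<bullet> v"
    by (simp add: inner_diff_left)
  also have "\<bar>\<dots>\<bar> \<le> norm (c (s *\<^sub>R v) - c' (s *\<^sub>R v)) * norm v" by (rule Cauchy_Schwarz_ineq2)
  also have "\<dots> \<le> \<delta> * norm v"
    using s v K by (intro mult_right_mono d)
      (auto simp: subspace_scale intro: order_trans[OF mult_left_le_one_le])
  finally show ?thesis .
qed

text \<open>A lower bound for the limit gradient on the annulus is inherited, up to a factor 2, by all late
  members of the sequence. They thus have a common radius on which zero is their minimum, and this
  inequality survives the limit.\<close>

lemma limit_of_minima_is_minimum:
  fixes \<phi> :: "'a::euclidean_space \<Rightarrow> real"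
  assumes K: "subspace K" and r: "r > 0" and L: "L > 0"
    and g: "quadratic_gradient K r L \<phi> c" "\<And>k::nat. quadratic_gradient K r L (\<phi>' k) (c' k)"
    and cont: "continuous_on (K \<inter> cball 0 r) c" "\<And>k. continuous_on (K \<inter> cball 0 r) (c' k)"
    and lim: "uniform_limit (K \<inter> cball 0 r) c' c sequentially"
    and nz: "\<And>v. v \<in> K \<Longrightarrow> 0 < norm v \<Longrightarrow> norm v \<le> r \<Longrightarrow> c v \<noteq> 0"
      "\<And>k v. v \<in> K \<Longrightarrow> 0 < norm v \<Longrightarrow> norm v \<le> r \<Longrightarrow> c' k v \<noteq> 0"
    and pos: "\<And>k. \<exists>\<rho>>0. \<forall>v\<in>K. 0 < norm v \<longrightarrow> norm v < \<rho> \<longrightarrow> 0 < c' k v \<bullet> v"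
  shows "\<exists>\<rho>>0. \<forall>v\<in>K. norm v \<le> \<rho> \<longrightarrow> \<phi> 0 \<le> \<phi> v"
proof -
  define A where "A = (K \<inter> cball 0 r) \<inter> {v. r / 2 \<le> norm v}"
  have cA: "compact A" unfolding A_def
    using closed_subspace[OF K] by (intro compact_Int_closed closed_Int_compact) 
      (auto intro!: closed_Collect_le continuous_intros)
  obtain \<beta> where \<beta>: "\<beta> > 0" "\<And>v. v \<in> A \<Longrightarrow> 2 * \<beta> \<le> norm (c v)"
  proof (cases "A = {}")
    case True then show thesis using that[of 1] by auto
  next
    case False
    have "continuous_on A (\<lambda>v. norm (c v))"
      by (intro continuous_intros continuous_on_subset[OF cont(1)]) (auto simp: A_def)
    from continuous_attains_inf[OF cA False this] obtain q
      where q: "q \<in> A" "\<And>v. v \<in> A \<Longrightarrow> norm (c q) \<le> norm (c v)" by blast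
    moreover have "q \<in> K" "0 < norm q" "norm q \<le> r" using q(1) r by (auto simp: A_def)
    then have "c q \<noteq> 0" by (rule nz(1))
    ultimately show thesis by (intro that[of "norm (c q) / 2"]) auto
  qed
  define \<rho> where "\<rho> = min (r / 2) (sqrt (\<beta> * r / (32 * L)))"
  have \<rho>: "\<rho> > 0" using r \<beta> L by (simp add: \<rho>_def)
  have \<rho>2: "16 * L * (norm v)\<^sup>2 < \<beta> * r" if "norm v \<le> \<rho>" for v :: 'a
  proof -
    have "norm v \<le> sqrt (\<beta> * r / (32 * L))" using that by (simp add: \<rho>_def)
    then have "(norm v)\<^sup>2 \<le> \<beta> * r / (32 * L)"
      using power_mono[of "norm v" "sqrt (\<beta> * r / (32 * L))" 2] \<beta>(1) r L by simp
    then have "32 * L * (norm v)\<^sup>2 \<le> \<beta> * r" using L by (simp add: field_simps)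
    moreover have "\<beta> * r > 0" using \<beta> r by simp
    ultimately show ?thesis by simp
  qed
  have "\<phi> 0 \<le> \<phi> v" if v: "v \<in> K" "norm v \<le> \<rho>" for v
  proof (rule ccontr)
    assume neg: "\<not> \<phi> 0 \<le> \<phi> v"
    have vr: "norm v \<le> r / 2" "norm v \<le> r" using v r by (auto simp: \<rho>_def)
    define \<delta> where "\<delta> = min \<beta> ((\<phi> 0 - \<phi> v) / (2 * (norm v + 1)))"
    have n1: "0 < norm v + 1" using norm_ge_zero[of v] by linarith
    have \<delta>: "\<delta> > 0" unfolding \<delta>_def
    proof (subst min_less_iff_conj, intro conjI \<beta>(1) divide_pos_pos)
      show "0 < \<phi> 0 - \<phi> v" "0 < 2 * (norm v + 1)" using neg n1 by simp_all
    qed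
    have dv: "\<delta> * norm v < \<phi> 0 - \<phi> v"
    proof -
      have "\<delta> * norm v \<le> (\<phi> 0 - \<phi> v) / (2 * (norm v + 1)) * (norm v + 1)"
        using \<delta> by (intro mult_mono) (auto simp: \<delta>_def)
      also have "\<dots> = (\<phi> 0 - \<phi> v) / 2" 
        using n1 by (simp add: field_simps)
      finally show ?thesis using neg by simp
    qed
    obtain k where k: "\<And>w. w \<in> K \<Longrightarrow> norm w \<le> r \<Longrightarrow> norm (c' k w - c w) < \<delta>"
    proof -
      obtain N where "\<forall>n\<ge>N. \<forall>x\<in>K \<inter> cball 0 r. dist (c' n x) (c x) < \<delta>"
        using uniform_limitD[OF lim \<delta>] by (auto simp: eventually_sequentially)
      then show thesis by (intro that[of N]) (auto simp: dist_norm)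
    qed
    have ann: "\<beta> \<le> norm (c' k w)" if "w \<in> K" "r / 2 \<le> norm w" "norm w \<le> r" for w
    proof -
      have "2 * \<beta> \<le> norm (c w)" using \<beta>(2) that by (simp add: A_def)
      then show ?thesis
        using k[of w] that norm_triangle_sub[of "c w" "c' k w"] by (simp add: \<delta>_def norm_minus_commute)
    qed
    obtain \<rho>' where \<rho>': "\<rho>' > 0"
      "\<And>v. v \<in> K \<Longrightarrow> 0 < norm v \<Longrightarrow> norm v < \<rho>' \<Longrightarrow> 0 < c' k v \<bullet> v" using pos[of k] by blast
    have "\<phi>' k 0 \<le> \<phi>' k v"
    proof (rule local_minimum_spreads[OF K r L \<beta>(1) g(2) cont(2) nz(2) ann])
      show "min \<rho>' r > 0" using \<rho>' r by simp
      fix v assume "v \<in> K" "norm v < min \<rho>' r"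
      then show "\<phi>' k 0 \<le> \<phi>' k v"
        by (intro radial_gradient_imp_minimum[OF g(2) K _ _ _ _ \<rho>'(2)]) (use L in auto)
    qed (use v vr \<rho>2 in auto)
    moreover have "\<bar>(\<phi>' k v - \<phi>' k 0) - (\<phi> v - \<phi> 0)\<bar> \<le> \<delta> * norm v"
      by (rule close_gradients_close_functions[OF g(2) g(1) K _ v(1) vr(2)])
        (use L k in \<open>auto intro: less_imp_le\<close>)
    ultimately show False using dv by linarith
  qed
  with \<rho> show ?thesis by blast
qed

text \<open>By \<open>limit_of_minima_is_minimum\<close>, applied to both signs, the limit function would be
  constant near zero and its gradient would vanish there.\<close>

theorem no_passage_from_minima_to_maxima:
  fixes \<phi> :: "'a::euclidean_space \<Rightarrow> real"
  assumes K: "subspace K" "K \<noteq> {0}" and r: "r > 0" and L: "L > 0"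
    and g: "quadratic_gradient K r L \<phi> c" "\<And>k::nat. quadratic_gradient K r L (\<phi>\<^sub>1 k) (c\<^sub>1 k)"
      "\<And>k::nat. quadratic_gradient K r L (\<phi>\<^sub>2 k) (c\<^sub>2 k)"
    and cont: "continuous_on (K \<inter> cball 0 r) c" "\<And>k. continuous_on (K \<inter> cball 0 r) (c\<^sub>1 k)"
      "\<And>k. continuous_on (K \<inter> cball 0 r) (c\<^sub>2 k)"
    and lim: "uniform_limit (K \<inter> cball 0 r) c\<^sub>1 c sequentially"
      "uniform_limit (K \<inter> cball 0 r) c\<^sub>2 c sequentially"
    and nz: "\<And>v. v \<in> K \<Longrightarrow> 0 < norm v \<Longrightarrow> norm v \<le> r \<Longrightarrow> c v \<noteq> 0"
      "\<And>k v. v \<in> K \<Longrightarrow> 0 < norm v \<Longrightarrow> norm v \<le> r \<Longrightarrow> c\<^sub>1 k v \<noteq> 0"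
      "\<And>k v. v \<in> K \<Longrightarrow> 0 < norm v \<Longrightarrow> norm v \<le> r \<Longrightarrow> c\<^sub>2 k v \<noteq> 0"
    and pos: "\<And>k. \<exists>\<rho>>0. \<forall>v\<in>K. 0 < norm v \<longrightarrow> norm v < \<rho> \<longrightarrow> 0 < c\<^sub>1 k v \<bullet> v"
    and neg: "\<And>k. \<exists>\<rho>>0. \<forall>v\<in>K. 0 < norm v \<longrightarrow> norm v < \<rho> \<longrightarrow> c\<^sub>2 k v \<bullet> v < 0"
  shows False
proof -
  obtain \<rho>\<^sub>1 where \<rho>1: "\<rho>\<^sub>1 > 0" "\<And>v. v \<in> K \<Longrightarrow> norm v \<le> \<rho>\<^sub>1 \<Longrightarrow> \<phi> 0 \<le> \<phi> v"
    using limit_of_minima_is_minimum[OF K(1) r L g(1) g(2) cont(1) cont(2) lim(1) nz(1) nz(2) pos] by blast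
  have "\<exists>\<rho>>0. \<forall>v\<in>K. norm v \<le> \<rho> \<longrightarrow> - \<phi> 0 \<le> - \<phi> v"
  proof (rule limit_of_minima_is_minimum[OF K(1) r L])
    show "quadratic_gradient K r L (\<lambda>v. - \<phi> v) (\<lambda>v. - c v)"
      "\<And>k. quadratic_gradient K r L (\<lambda>v. - \<phi>\<^sub>2 k v) (\<lambda>v. - c\<^sub>2 k v)"
      by (rule quadratic_gradient_uminus[OF g(1) K(1)], rule quadratic_gradient_uminus[OF g(3) K(1)])
    show "\<exists>\<rho>>0. \<forall>v\<in>K. 0 < norm v \<longrightarrow> norm v < \<rho> \<longrightarrow> 0 < - c\<^sub>2 k v \<bullet> v" for k
      using neg[of k] by simp
    show "uniform_limit (K \<inter> cball 0 r) (\<lambda>k v. - c\<^sub>2 k v) (\<lambda>v. - c v) sequentially"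
      by (rule uniform_limit_uminus[OF lim(2)])
  qed (use cont nz in \<open>auto intro: continuous_intros\<close>)
  then obtain \<rho>\<^sub>2 where \<rho>2: "\<rho>\<^sub>2 > 0" "\<And>v. v \<in> K \<Longrightarrow> norm v \<le> \<rho>\<^sub>2 \<Longrightarrow> \<phi> v \<le> \<phi> 0" by auto
  define \<rho> where "\<rho> = min (r / 2) (min \<rho>\<^sub>1 \<rho>\<^sub>2) / 2"
  have \<rho>: "\<rho> > 0" "\<rho> < r" "2 * \<rho> \<le> \<rho>\<^sub>1" "2 * \<rho> \<le> \<rho>\<^sub>2" using r \<rho>1 \<rho>2 by (auto simp: \<rho>_def)
  obtain w where "w \<in> K" "w \<noteq> 0" using K subspace_0 by blast
  define v where "v = (\<rho> / norm w) *\<^sub>R w"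
  have v: "v \<in> K" "norm v = \<rho>" using \<open>w \<in> K\<close> \<open>w \<noteq> 0\<close> K \<rho> by (auto simp: v_def subspace_scale)
  have "c v = 0"
  proof (rule quadratic_gradient_local_min_eq_0[OF g(1) K(1) v(1) _ \<rho>(1)])
    fix u assume u: "u \<in> K" "norm (u - v) < \<rho>"
    then have "norm u \<le> 2 * \<rho>" using norm_triangle_sub[of u v] v by simp
    then show "\<phi> v \<le> \<phi> u" using \<rho>1(2)[of u] \<rho>2(2)[of v] u v \<rho> by force
  qed (use v \<rho> in auto)
  then show False using nz(1)[of v] v \<rho> by simp
qed

section \<open>Symmetric matrices and their ordered eigenvalues\<close>

text \<open>Take \<open>x\<close> maximizing the quadratic form on the unit sphere of \<open>S\<close>, with
  maximum \<open>l\<close>. Moving \<open>x\<close> in the direction \<open>y = A x - l x\<close> gains a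
  first order multiple of \<open>y \<bullet> y\<close>, so \<open>y\<close> must vanish.\<close>

lemma symmetric_linear_eigenvector:
  fixes A :: "'a::euclidean_space \<Rightarrow> 'a"
  assumes lin: "linear A" and sym: "\<And>x y. A x \<bullet> y = x \<bullet> A y"
    and S: "subspace S" "S \<noteq> {0}" "A ` S \<subseteq> S"
  obtains x l where "x \<in> S" "norm x = 1" "A x = l *\<^sub>R x"
proof -
  interpret linear A by (rule lin)
  define C where "C = S \<inter> {x. norm x = 1}"
  have "compact C"
  proof -
    have "C = S \<inter> sphere 0 1" by (auto simp: C_def)
    then show ?thesis using closed_subspace[OF S(1)] by (simp add: closed_Int_compact)
  qed
  obtain y where "y \<in> S" "y \<noteq> 0" using S subspace_0 by blast
  then have "(1 / norm y) *\<^sub>R y \<in> C" using S by (simp add: C_def subspace_scale)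
  then have ne: "C \<noteq> {}" by blast
  have "continuous_on C (\<lambda>x. A x \<bullet> x)"
    by (intro continuous_intros linear_continuous_on linear_conv_bounded_linear[THEN iffD1] lin)
  from continuous_attains_sup[OF \<open>compact C\<close> ne this]
  obtain x where x: "x \<in> C" and max: "\<And>z. z \<in> C \<Longrightarrow> A z \<bullet> z \<le> A x \<bullet> x" by blast
  have xS: "x \<in> S" "x \<bullet> x = 1" using x by (auto simp: C_def norm_eq_1)
  define l where "l = A x \<bullet> x"
  have quad: "A z \<bullet> z \<le> l * (z \<bullet> z)" if z: "z \<in> S" for z
  proof (cases "z = 0")
    case False
    have "A ((1 / norm z) *\<^sub>R z) \<bullet> ((1 / norm z) *\<^sub>R z) \<le> l"
      unfolding l_def by (rule max) (use z False S in \<open>simp add: C_def subspace_scale\<close>)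
    then have "A z \<bullet> z / (norm z * norm z) \<le> l" by (simp add: scale)
    then show ?thesis using False
      by (simp add: pos_divide_le_eq dot_square_norm power2_eq_square)
  qed (simp add: zero)
  define y where "y = A x - l *\<^sub>R x"
  have yS: "y \<in> S" using S xS by (auto simp: y_def intro!: subspace_diff subspace_scale)
  have xy: "x \<bullet> y = 0" using xS by (simp add: y_def l_def inner_diff_right inner_commute)
  have a: "A x \<bullet> y = y \<bullet> y"
    using xy by (simp add: y_def inner_diff_left inner_diff_right inner_commute)
  have "y = 0"
  proof (rule ccontr)
    assume "y \<noteq> 0"
    then have yy: "y \<bullet> y > 0" by simp
    define D where "D = l * (y \<bullet> y) - A y \<bullet> y"
    have D0: "D \<ge> 0" using quad[OF yS] by (simp add: D_def)
    define t where "t = (y \<bullet> y) / (D + 1)"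
    have t: "t > 0" using yy D0 by (simp add: t_def)
    have "A (x + t *\<^sub>R y) \<bullet> (x + t *\<^sub>R y) \<le> l * ((x + t *\<^sub>R y) \<bullet> (x + t *\<^sub>R y))"
      by (rule quad) (use S xS yS in \<open>auto intro: subspace_add subspace_scale\<close>)
    then have "2 * t * (y \<bullet> y) \<le> t * t * D"
    proof -
      have e: "x \<bullet> A x = l" "x \<bullet> A y = y \<bullet> y" "y \<bullet> A x = y \<bullet> y"
        using a sym[of x y] by (simp_all add: l_def inner_commute)
      assume "A (x + t *\<^sub>R y) \<bullet> (x + t *\<^sub>R y) \<le> l * ((x + t *\<^sub>R y) \<bullet> (x + t *\<^sub>R y))"
      then show ?thesis
        using xy xS(2)
        by (simp add: add scale inner_add_left inner_add_right D_def algebra_simps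
            inner_commute e)
    qed
    then have "2 * (y \<bullet> y) \<le> t * D" using t by (simp add: mult.assoc mult.left_commute)
    also have "\<dots> \<le> t * (D + 1)" using t by simp
    also have "\<dots> = y \<bullet> y" using D0 by (simp add: t_def)
    finally show False using yy by simp
  qed
  then show thesis using that[of x l] x xS by (simp add: y_def C_def)
qed

text \<open>Split off an eigenvector; by symmetry its orthogonal complement in \<open>S\<close> is again
  invariant.\<close>

lemma symmetric_linear_eigenbasis_subspace:
  fixes A :: "'a::euclidean_space \<Rightarrow> 'a"
  assumes lin: "linear A" and sym: "\<And>x y. A x \<bullet> y = x \<bullet> A y"
    and "subspace S" "A ` S \<subseteq> S"
  shows "\<exists>B. finite B \<and> pairwise orthogonal B \<and> span B = S \<and> (\<forall>x\<in>B. norm x = 1 \<and> (\<exists>l. A x = l *\<^sub>R x))"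
  using assms(3,4)
proof (induction "dim S" arbitrary: S rule: less_induct)
  case less
  show ?case
  proof (cases "S = {0}")
    case True
    then show ?thesis by (intro exI[of _ "{}"]) auto
  next
    case False
    obtain x l where x: "x \<in> S" "norm x = 1" "A x = l *\<^sub>R x"
      using symmetric_linear_eigenvector[OF lin sym less.prems(1) False less.prems(2)] by blast
    define S' where "S' = {y \<in> S. x \<bullet> y = 0}"
    have S': "subspace S'"
      using less.prems(1) by (auto simp: S'_def subspace_def inner_add_right)
    have inv: "A ` S' \<subseteq> S'"
      using less.prems(2) x(3) by (auto simp: S'_def sym[symmetric])
    have "S' \<subseteq> S" "x \<notin> S'" using x(2) by (auto simp: S'_def norm_eq_1)
    then have "dim S' < dim S"
      using dim_psubset[of S' S] less.prems(1) S' x(1) by (metis psubsetI span_eq_iff)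
    from less.hyps[OF this S' inv] obtain B
      where B: "finite B" "pairwise orthogonal B" "span B = S'"
        "\<forall>x\<in>B. norm x = 1 \<and> (\<exists>l. A x = l *\<^sub>R x)" by blast
    have BS': "b \<in> S'" if "b \<in> B" for b using that B(3) span_base by blast
    have "span (insert x B) = S"
    proof
      show "span (insert x B) \<subseteq> S"
        using x(1) BS' less.prems(1) by (intro span_minimal) (auto simp: S'_def)
      show "S \<subseteq> span (insert x B)"
      proof
        fix y assume y: "y \<in> S"
        have "y - (x \<bullet> y) *\<^sub>R x \<in> S'"
          using y x less.prems(1) norm_eq_1[of x]
          by (auto simp: S'_def inner_diff_right intro: subspace_diff subspace_scale)
        then show "y \<in> span (insert x B)" unfolding span_breakdown_eq B(3) by blast
      qed
    qed
    moreover have "pairwise orthogonal (insert x B)"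
      using B(2) BS' by (auto simp: pairwise_insert S'_def orthogonal_def inner_commute)
    ultimately show ?thesis using B x by (intro exI[of _ "insert x B"]) auto
  qed
qed

lemma symmetric_matrix_inner:
  fixes A :: "real^'n^'n"
  assumes "transpose A = A"
  shows "(A *v x) \<bullet> y = x \<bullet> (A *v y)"
  using assms by (metis dot_lmul_matrix vector_transpose_matrix)

lemma symmetric_matrix_eigenbasis:
  fixes A :: "real^'n^'n"
  assumes "transpose A = A"
  obtains Q d where "orthogonal_matrix Q" "\<And>i. A *v column i Q = d i *\<^sub>R column i Q"
proof -
  obtain B where B: "finite B" "pairwise orthogonal B" "span B = (UNIV :: (real^'n) set)"
    "\<forall>x\<in>B. norm x = 1 \<and> (\<exists>l. A *v x = l *\<^sub>R x)"
    using symmetric_linear_eigenbasis_subspace[of "(*v) A" UNIV]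
      symmetric_matrix_inner[OF assms] by auto
  have "independent B" using B by (intro pairwise_orthogonal_independent) auto
  then have "card B = CARD('n)"
    using B(3) by (metis dim_eq_card dim_span dim_UNIV DIM_cart DIM_real mult.right_neutral)
  then obtain b where b: "bij_betw b (UNIV :: 'n set) B"
    using finite_same_card_bij[of "UNIV :: 'n set" B] B(1) by auto
  then have bB: "b i \<in> B" and inj: "b i = b j \<longleftrightarrow> i = j" for i j
    by (auto simp: bij_betw_def inj_def)
  define Q where "Q = (\<chi> i j. b j $ i)"
  have col: "column i Q = b i" for i by (simp add: Q_def column_def vec_eq_iff)
  have "\<forall>i. \<exists>l. A *v b i = l *\<^sub>R b i" using B(4) bB by blast
  then obtain d where d: "\<And>i. A *v b i = d i *\<^sub>R b i" by metis
  show thesis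
  proof
    show "orthogonal_matrix Q" unfolding orthogonal_matrix_orthonormal_columns
      using B(2,4) bB inj by (auto simp: col pairwise_def)
    show "A *v column i Q = d i *\<^sub>R column i Q" for i by (simp add: col d)
  qed
qed

text \<open>With respect to the eigenbasis the matrix \<open>mat x - A\<close> is diagonal.\<close>

lemma eigenbasis_charpoly:
  fixes A :: "real^'n^'n"
  assumes Q: "orthogonal_matrix Q" and d: "\<And>i. A *v column i Q = d i *\<^sub>R column i Q"
  shows "charpoly A = (\<Prod>i\<in>UNIV. [:- d i, 1:])"
proof -
  have "poly (charpoly A) x = poly (\<Prod>i\<in>UNIV. [:- d i, 1:]) x" for x
  proof -
    define \<Delta> where "\<Delta> = (\<chi> i j. if i = j then x - d i else 0)"
    have "poly (charpoly A) x = det (mat x - A)"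
      by (simp add: charpoly_def det_def poly_sum poly_prod mat_def of_int_poly
          if_distrib[where f = "\<lambda>p. poly p x"] cong: if_cong)
    moreover have "(mat x - A) ** Q = Q ** \<Delta>"
    proof -
      have "(\<Sum>k\<in>UNIV. A $ i $ k * Q $ k $ j) = d j * Q $ i $ j" for i j
        using arg_cong[OF d[of j], of "\<lambda>v. v $ i"] by (simp add: matrix_vector_mult_def column_def)
      then show ?thesis
        by (simp add: vec_eq_iff matrix_matrix_mult_def \<Delta>_def mat_def left_diff_distrib
            sum_subtractf if_distrib[where f = "\<lambda>a. a * _"] if_distrib[where f = "\<lambda>a. _ * a"]
            right_diff_distrib mult.commute cong: if_cong)
    qed
    then have "det (mat x - A) * det Q = det \<Delta> * det Q"
      by (metis det_mul mult.commute)
    moreover have "det Q \<noteq> 0" using det_orthogonal_matrix[OF Q] by auto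
    moreover have "det \<Delta> = (\<Prod>i\<in>UNIV. x - d i)" by (subst det_diagonal) (auto simp: \<Delta>_def)
    ultimately show ?thesis by (simp add: poly_prod)
  qed
  then show ?thesis by (simp flip: poly_eq_poly_eq_iff add: fun_eq_iff)
qed

text \<open>Two listings of the roots of one polynomial with multiplicities differ by a permutation. The
  indexing \<open>h\<close> is prescribed so that eigenvectors of different matrices carry the same
  labels.\<close>

lemma ordered_eigenbasis:
  fixes A :: "real^'n^'n"
  assumes A: "transpose A = A" and e: "ordered_eigenvalues A e"
    and h: "bij_betw h (UNIV :: 'n set) {1..CARD('n)}"
  obtains Q where "orthogonal_matrix Q" "\<And>i. A *v column i Q = e (h i) *\<^sub>R column i Q"
proof -
  obtain Q d where Q: "orthogonal_matrix Q" and d: "\<And>i. A *v column i Q = d i *\<^sub>R column i Q"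
    using symmetric_matrix_eigenbasis[OF A] by blast
  have "(\<Prod>i\<in>UNIV. [:- d i, 1:]) = (\<Prod>j = 1..CARD('n). [:- e j, 1:])"
    using e eigenbasis_charpoly[OF Q d] by (simp add: ordered_eigenvalues_def)
  also have "\<dots> = (\<Prod>i\<in>UNIV. [:- e (h i), 1:])"
    by (rule prod.reindex_bij_betw[OF h, symmetric])
  finally have "proots (\<Prod>i\<in>UNIV. [:- d i, 1:]) = proots (\<Prod>i\<in>UNIV. [:- e (h i), 1:])" by simp
  then have "(\<Sum>i\<in>UNIV. {#d i#}) = (\<Sum>i\<in>UNIV. {#e (h i)#})" by (simp add: proots_prod)
  then have "image_mset (\<lambda>i. e (h i)) (mset_set UNIV) = image_mset d (mset_set (UNIV :: 'n set))"
    by (simp add: sum_unfold_sum_mset)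
  then obtain p where p: "p permutes (UNIV :: 'n set)" "\<forall>i\<in>UNIV. e (h i) = d (p i)"
    by (rule image_mset_eq_implies_permutes[OF finite])
  define Q' where "Q' = (\<chi> i j. Q $ i $ p j)"
  have col: "column i Q' = column (p i) Q" for i by (simp add: Q'_def column_def)
  have "p i = p j \<longleftrightarrow> i = j" for i j using permutes_inj[OF p(1)] by (auto dest: injD)
  then have "orthogonal_matrix Q'"
    using Q by (auto simp: orthogonal_matrix_orthonormal_columns col)
  with that[of Q'] d p(2) show thesis by (simp add: col)
qed

text \<open>Suppose \<open>A a \<bullet> a \<le> 0\<close>. Mixed terms with \<open>E\<close> vanish, so the
  form is nonpositive on the span of \<open>a\<close> and \<open>E\<close>. That span has dimension
  \<open>dim E + 1\<close> and must meet \<open>U\<close> nontrivially, where the form is positive.\<close>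

lemma form_positive_of_dimension_count:
  fixes A :: "'a::euclidean_space \<Rightarrow> 'a"
  assumes lin: "linear A" and sym: "\<And>x y. A x \<bullet> y = x \<bullet> A y"
    and E: "subspace E" "\<And>p. p \<in> E \<Longrightarrow> A p \<bullet> p \<le> 0"
    and U: "subspace U" "\<And>u. u \<in> U \<Longrightarrow> u \<noteq> 0 \<Longrightarrow> 0 < A u \<bullet> u"
    and dim: "DIM('a) \<le> dim E + dim U"
    and a: "a \<notin> E" "\<And>p. p \<in> E \<Longrightarrow> A a \<bullet> p = 0"
  shows "0 < A a \<bullet> a"
proof (rule ccontr)
  assume np: "\<not> 0 < A a \<bullet> a"
  interpret linear A by (rule lin)
  define W where "W = span (insert a E)"
  have sE: "span E = E" using E(1) by (simp add: span_eq_iff)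
  have dW: "dim W = Suc (dim E)"
    using a(1) by (simp add: W_def dim_insert sE)
  have "dim {x + y |x y. x \<in> W \<and> y \<in> U} \<le> DIM('a)" by (rule dim_subset_UNIV)
  moreover have "dim {x + y |x y. x \<in> W \<and> y \<in> U} + dim (W \<inter> U) = dim W + dim U"
    by (rule dim_sums_Int) (auto simp: W_def U(1))
  ultimately have "0 < dim (W \<inter> U)" using dim dW by linarith
  then have "\<not> W \<inter> U \<subseteq> {0}" using dim_eq_0[of "W \<inter> U"] by linarith
  then obtain w where w: "w \<in> W" "w \<in> U" "w \<noteq> 0" by blast
  obtain k where "w - k *\<^sub>R a \<in> E" using w(1) unfolding W_def span_breakdown_eq sE by blast
  then obtain p where p: "p \<in> E" "w = k *\<^sub>R a + p" by (metis add.commute diff_add_cancel)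
  have "A w \<bullet> w = k * k * (A a \<bullet> a) + A p \<bullet> p"
    using a(2)[OF p(1)] sym[of p a]
    by (simp add: p(2) add scale inner_add_left inner_add_right inner_commute algebra_simps)
  also have "\<dots> \<le> 0"
    by (intro add_nonpos_nonpos mult_nonneg_nonpos E(2)[OF p(1)] zero_le_square) (use np in simp)
  finally show False using U(2)[OF w(2,3)] by simp
qed

text \<open>The mean value theorem for \<open>V\<close> minus its second order model on the segment from
  \<open>x\<close> to \<open>x + y\<close>.\<close>

lemma second_order_increment:
  fixes V :: "'a::real_inner \<Rightarrow> real"
  assumes V: "\<And>x. GDERIV V x :> f x" and B: "linear B"
    and b: "\<And>x. norm x \<le> \<delta> \<Longrightarrow> norm (f x - B x) \<le> \<epsilon> * norm x"
    and x: "norm x + norm y \<le> \<delta>" and e: "\<epsilon> \<ge> 0"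
  shows "\<bar>V (x + y) - V x - B x \<bullet> y - B y \<bullet> y / 2\<bar> \<le> \<epsilon> * (norm x + norm y)\<^sup>2"
proof -
  interpret linear B by (rule B)
  let ?g = "\<lambda>s. V (x + s *\<^sub>R y) - s * (B x \<bullet> y) - s\<^sup>2 * (B y \<bullet> y) / 2"
  have der: "(?g has_derivative (\<lambda>h. h * ((f (x + s *\<^sub>R y) - B (x + s *\<^sub>R y)) \<bullet> y))) (at s within {0..1})" for s
  proof -
    have 1: "((\<lambda>s. x + s *\<^sub>R y) has_derivative (\<lambda>h. h *\<^sub>R y)) (at s within {0..1})"
      by (auto intro!: derivative_eq_intros)
    have 2: "(V has_derivative (\<lambda>h. h \<bullet> f (x + s *\<^sub>R y))) (at (x + s *\<^sub>R y))"
      using V by (simp add: gderiv_def)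
    show ?thesis
      by (rule derivative_eq_intros has_derivative_compose[OF 1 2] refl | simp)+
        (simp add: fun_eq_iff add scale inner_add_left inner_diff_left algebra_simps inner_commute)
  qed
  obtain s where s: "s \<in> {0<..<1::real}"
    and "?g 1 - ?g 0 = (1 - 0) * ((f (x + s *\<^sub>R y) - B (x + s *\<^sub>R y)) \<bullet> y)"
    using mvt_simple[OF zero_less_one der] by blast
  then have "\<bar>V (x + y) - V x - B x \<bullet> y - B y \<bullet> y / 2\<bar>
      = \<bar>(f (x + s *\<^sub>R y) - B (x + s *\<^sub>R y)) \<bullet> y\<bar>" by simp
  also have "\<dots> \<le> norm (f (x + s *\<^sub>R y) - B (x + s *\<^sub>R y)) * norm y" by (rule Cauchy_Schwarz_ineq2)
  also have "\<dots> \<le> (\<epsilon> * (norm x + norm y)) * (norm x + norm y)"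
  proof (rule mult_mono)
    have n: "norm (x + s *\<^sub>R y) \<le> norm x + norm y"
      using s by (intro order_trans[OF norm_triangle_ineq]) (simp add: mult_left_le_one_le)
    then have "norm (f (x + s *\<^sub>R y) - B (x + s *\<^sub>R y)) \<le> \<epsilon> * norm (x + s *\<^sub>R y)"
      using x by (intro b) simp
    also have "\<dots> \<le> \<epsilon> * (norm x + norm y)" using n e by (rule mult_left_mono)
    finally show "norm (f (x + s *\<^sub>R y) - B (x + s *\<^sub>R y)) \<le> \<epsilon> * (norm x + norm y)" .
  qed (use e in auto)
  finally show ?thesis by (simp add: power2_eq_square mult.assoc)
qed

text \<open>Expand \<open>V (s x + s y)\<close> to second order in \<open>s\<close> by going first along
  \<open>x\<close> and then along \<open>y\<close>, and in the reverse order: the mixed terms are \<open>B x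
  \<bullet> y\<close> and \<open>B y \<bullet> x\<close>.\<close>

lemma derivative_of_gradient_symmetric:
  fixes V :: "'a::real_inner \<Rightarrow> real"
  assumes V: "\<And>x. GDERIV V x :> f x" and f0: "f 0 = 0" and B: "(f has_derivative B) (at 0)"
  shows "B x \<bullet> y = x \<bullet> B y"
proof -
  have lin: "linear B" by (rule has_derivative_linear[OF B])
  interpret linear B by (rule lin)
  define N where "N = 4 * (norm x + norm y)\<^sup>2"
  have bound: "\<bar>B x \<bullet> y - B y \<bullet> x\<bar> \<le> \<epsilon> * N" if e: "\<epsilon> > 0" for \<epsilon>
  proof -
    obtain \<delta> where \<delta>: "\<delta> > 0" "\<And>z. norm z < \<delta> \<Longrightarrow> norm (f z - B z) \<le> \<epsilon> * norm z"
      using B e unfolding has_derivative_at_alt by (auto simp: f0)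
    define m where "m = norm x + norm y + 1"
    define s where "s = \<delta> / (2 * m)"
    have np: "0 < m" using norm_ge_zero[of x] norm_ge_zero[of y] unfolding m_def by linarith
    have s: "s > 0" using \<delta> np by (simp add: s_def)
    have "s * m = \<delta> / 2" using np by (simp add: s_def)
    then have sxy: "norm (s *\<^sub>R x) + norm (s *\<^sub>R y) \<le> \<delta> / 2"
      using s by (simp add: m_def distrib_left)
    have b: "norm (f z - B z) \<le> \<epsilon> * norm z" if "norm z \<le> \<delta> / 2" for z
      using that \<delta> by (intro \<delta>(2)) simp
    have mono: "\<epsilon> * (t)\<^sup>2 \<le> \<epsilon> * (s * (norm x + norm y))\<^sup>2"
      if "0 \<le> t" "t \<le> s * (norm x + norm y)" for t
      using that e by (intro mult_left_mono power_mono) auto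
    have sn: "norm (s *\<^sub>R x) + norm (s *\<^sub>R y) = s * (norm x + norm y)"
      using s by (simp add: distrib_left)
    have "norm (s *\<^sub>R x) \<le> \<delta> / 2" "norm (s *\<^sub>R y) \<le> \<delta> / 2"
      using sxy norm_ge_zero[of "s *\<^sub>R x"] norm_ge_zero[of "s *\<^sub>R y"] by linarith+
    have i: "\<bar>V (x + y) - V x - B x \<bullet> y - B y \<bullet> y / 2\<bar> \<le> \<epsilon> * (norm x + norm y)\<^sup>2"
      if "norm x + norm y \<le> \<delta> / 2" for x y
      by (rule second_order_increment[OF V lin b that]) (use e in auto)
    have "\<bar>V (s *\<^sub>R x + s *\<^sub>R y) - V (s *\<^sub>R x) - B (s *\<^sub>R x) \<bullet> (s *\<^sub>R y) - B (s *\<^sub>R y) \<bullet> (s *\<^sub>R y) / 2\<bar>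
        \<le> \<epsilon> * (s * (norm x + norm y))\<^sup>2"
      using i[OF sxy] e sn by simp
    moreover have "\<bar>V (s *\<^sub>R y + s *\<^sub>R x) - V (s *\<^sub>R y) - B (s *\<^sub>R y) \<bullet> (s *\<^sub>R x) - B (s *\<^sub>R x) \<bullet> (s *\<^sub>R x) / 2\<bar>
        \<le> \<epsilon> * (s * (norm x + norm y))\<^sup>2"
      using i[of "s *\<^sub>R y" "s *\<^sub>R x"] sxy e sn by (simp add: add.commute)
    moreover have "\<bar>V (0 + s *\<^sub>R x) - V 0 - B 0 \<bullet> (s *\<^sub>R x) - B (s *\<^sub>R x) \<bullet> (s *\<^sub>R x) / 2\<bar>
        \<le> \<epsilon> * (s * (norm x + norm y))\<^sup>2"
      using i[of 0 "s *\<^sub>R x"] \<open>norm (s *\<^sub>R x) \<le> \<delta> / 2\<close> e s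
      by (intro order_trans[OF _ mono[of "norm (s *\<^sub>R x)"]]) (auto intro: mult_left_mono)
    moreover have "\<bar>V (0 + s *\<^sub>R y) - V 0 - B 0 \<bullet> (s *\<^sub>R y) - B (s *\<^sub>R y) \<bullet> (s *\<^sub>R y) / 2\<bar>
        \<le> \<epsilon> * (s * (norm x + norm y))\<^sup>2"
      using i[of 0 "s *\<^sub>R y"] \<open>norm (s *\<^sub>R y) \<le> \<delta> / 2\<close> e s
      by (intro order_trans[OF _ mono[of "norm (s *\<^sub>R y)"]]) (auto intro: mult_left_mono)
    ultimately have "\<bar>B (s *\<^sub>R x) \<bullet> (s *\<^sub>R y) - B (s *\<^sub>R y) \<bullet> (s *\<^sub>R x)\<bar> \<le> 4 * (\<epsilon> * (s * (norm x + norm y))\<^sup>2)"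
      by (simp add: zero add.commute abs_le_iff)
    moreover have "B (s *\<^sub>R x) \<bullet> (s *\<^sub>R y) - B (s *\<^sub>R y) \<bullet> (s *\<^sub>R x) = s\<^sup>2 * (B x \<bullet> y - B y \<bullet> x)"
      by (simp add: scale power2_eq_square algebra_simps)
    ultimately have "\<bar>s\<^sup>2 * (B x \<bullet> y - B y \<bullet> x)\<bar> \<le> 4 * (\<epsilon> * (s * (norm x + norm y))\<^sup>2)"
      by (simp only:)
    moreover have "4 * (\<epsilon> * (s * (norm x + norm y))\<^sup>2) = s\<^sup>2 * (\<epsilon> * N)"
      by (simp add: N_def power_mult_distrib)
    ultimately have "s\<^sup>2 * \<bar>B x \<bullet> y - B y \<bullet> x\<bar> \<le> s\<^sup>2 * (\<epsilon> * N)"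
      by (simp only: abs_mult abs_power2)
    then show ?thesis using s by simp
  qed
  have "\<bar>B x \<bullet> y - B y \<bullet> x\<bar> \<le> 0"
  proof (rule field_le_epsilon)
    fix e :: real assume "e > 0"
    have N: "N \<ge> 0" by (simp add: N_def)
    have "\<bar>B x \<bullet> y - B y \<bullet> x\<bar> \<le> e / (N + 1) * N"
      using bound[of "e / (N + 1)"] \<open>e > 0\<close> N by simp
    also have "\<dots> \<le> 0 + e" using N \<open>e > 0\<close> by (simp add: field_simps)
    finally show "\<bar>B x \<bullet> y - B y \<bullet> x\<bar> \<le> 0 + e" .
  qed
  then show ?thesis by (simp add: inner_commute)
qed

lemma matrix_inner_transpose:
  fixes A :: "real ^ 'n ^ 'm"
  shows "(A *v x) \<bullet> y = x \<bullet> (transpose A *v y)"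
  using dot_lmul_matrix[of y A x] by (simp add: inner_commute)

lemma orthogonal_matrix_facts:
  fixes Q :: "real ^ 'n ^ 'n"
  assumes Q: "orthogonal_matrix Q"
  shows "transpose Q *v (Q *v x) = x" "Q *v (transpose Q *v x) = x"
    "(Q *v x) \<bullet> (Q *v y) = x \<bullet> y" "(transpose Q *v x) \<bullet> (transpose Q *v y) = x \<bullet> y"
    "norm (Q *v x) = norm x" "norm (transpose Q *v x) = norm x"
proof -
  have QQ: "transpose Q ** Q = mat 1" "Q ** transpose Q = mat 1"
    using Q by (auto simp: orthogonal_matrix_def)
  show 1: "transpose Q *v (Q *v x) = x" "Q *v (transpose Q *v x) = x" for x
    unfolding matrix_vector_mul_assoc QQ by simp_all
  show 2: "(Q *v x) \<bullet> (Q *v y) = x \<bullet> y" "(transpose Q *v x) \<bullet> (transpose Q *v y) = x \<bullet> y" for x y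
    by (simp_all only: matrix_inner_transpose 1 transpose_transpose)
  show "norm (Q *v x) = norm x" "norm (transpose Q *v x) = norm x"
    by (simp_all only: norm_eq_sqrt_inner 2)
qed

lemma dim_coordinate_subspace: "dim {x :: real ^ 'n. \<forall>i. i \<notin> S \<longrightarrow> x $ i = 0} = card S"
  using dim_substandard_cart[of S, where ?'a = real] by (simp add: dim_vec_eq)

text \<open>Here \<open>B\<close> is a small perturbation of the diagonal matrix of \<open>d\<close>, and
  all its eigenvalues belonging to the level \<open>d j\<close> have moved to the side prescribed by
  \<open>s\<close>. Let \<open>S\<close> be the set of indices \<open>i\<close> with \<open>0 \<le> s * (d j
  - d i)\<close>. The form of \<open>s * (d j - B)\<close> is positive on the span of the eigenvectors of
  \<open>B\<close> labelled by \<open>S\<close>, because \<open>h\<close> orders the eigenvalues, and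
  nonpositive on the span of the coordinate vectors outside \<open>S\<close>, because
  \<open>\<epsilon>\<close> is below the gaps. The two dimensions add up to \<open>n\<close>, and
  \<open>form_positive_of_dimension_count\<close> applies: \<open>(d j - B) a\<close> is supported on the
  level \<open>d j\<close> and hence orthogonal to the second space.\<close>

lemma eigenvalue_order_definite:
  fixes B Q :: "real ^ 'n ^ 'n" and h :: "'n \<Rightarrow> nat" and d :: "'n \<Rightarrow> real"
  assumes B: "transpose B = B" and Q: "orthogonal_matrix Q"
    and ev: "\<And>i. B *v column i Q = \<eta> (h i) *\<^sub>R column i Q"
    and \<eta>: "mono_on (range h) \<eta>" and d: "\<And>i j. d i < d j \<Longrightarrow> h i < h j"
    and close: "\<And>x. norm (B *v x - (\<chi> i. d i * x $ i)) \<le> \<epsilon> * norm x"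
    and gap: "\<And>i j. d i \<noteq> d j \<Longrightarrow> \<epsilon> \<le> \<bar>d i - d j\<bar>"
    and s: "s = 1 \<or> s = - 1" and move: "\<And>i. d i = d j \<Longrightarrow> 0 < s * (d j - \<eta> (h i))"
    and off: "\<And>i. d i \<noteq> d j \<Longrightarrow> (d j *\<^sub>R a - B *v a) $ i = 0" and on: "d i0 = d j" "a $ i0 \<noteq> 0"
  shows "0 < s * ((d j *\<^sub>R a - B *v a) \<bullet> a)"
proof -
  define A where "A x = s *\<^sub>R (d j *\<^sub>R x - B *v x)" for x
  define S where "S = {i. 0 \<le> s * (d j - d i)}"
  define C where "C S = {x :: real ^ 'n. \<forall>i. i \<notin> S \<longrightarrow> x $ i = 0}" for S
  have subC: "subspace (C S)" for S by (auto simp: C_def subspace_def)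
  have "0 < A a \<bullet> a"
  proof (rule form_positive_of_dimension_count)
    show "linear A" unfolding A_def
      by (rule linearI) (simp_all add: algebra_simps matrix_vector_right_distrib matrix_vector_mult_scaleR)
    show "A x \<bullet> y = x \<bullet> A y" for x y
      using symmetric_matrix_inner[OF B, of x y] by (simp add: A_def inner_diff_left inner_diff_right)
    show "subspace (C (- S))" by (rule subC)
    show "A p \<bullet> p \<le> 0" if p: "p \<in> C (- S)" for p
    proof -
      have "A p \<bullet> p = s * ((d j *\<^sub>R p - (\<chi> i. d i * p $ i)) \<bullet> p) - s * ((B *v p - (\<chi> i. d i * p $ i)) \<bullet> p)"
        by (simp add: A_def inner_diff_left algebra_simps)
      moreover have "s * ((d j *\<^sub>R p - (\<chi> i. d i * p $ i)) \<bullet> p) \<le> - \<epsilon> * (p \<bullet> p)"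
      proof -
        have "s * ((d j - d i) * p $ i) * p $ i \<le> - \<epsilon> * (p $ i * p $ i)" for i
        proof (cases "p $ i = 0")
          case False
          then have "i \<notin> S" using p by (auto simp: C_def)
          then have "s * (d j - d i) < 0" by (simp add: S_def)
          moreover from this have "\<epsilon> \<le> \<bar>d j - d i\<bar>" by (intro gap) auto
          ultimately have "s * (d j - d i) \<le> - \<epsilon>" using s by auto
          from mult_right_mono[OF this, of "p $ i * p $ i"] show ?thesis by (simp add: algebra_simps)
        qed simp
        then have "(\<Sum>i\<in>UNIV. s * ((d j - d i) * p $ i) * p $ i) \<le> (\<Sum>i\<in>UNIV. - \<epsilon> * (p $ i * p $ i))"
          by (intro sum_mono)
        then show ?thesis
          by (simp add: inner_vec_def sum_distrib_left left_diff_distrib mult.assoc)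
      qed
      moreover have "\<bar>s * ((B *v p - (\<chi> i. d i * p $ i)) \<bullet> p)\<bar> \<le> \<epsilon> * (p \<bullet> p)"
      proof -
        have "\<bar>s * ((B *v p - (\<chi> i. d i * p $ i)) \<bullet> p)\<bar> = \<bar>(B *v p - (\<chi> i. d i * p $ i)) \<bullet> p\<bar>"
          using s by (auto simp: abs_mult)
        also have "\<dots> \<le> norm (B *v p - (\<chi> i. d i * p $ i)) * norm p" by (rule Cauchy_Schwarz_ineq2)
        also have "\<dots> \<le> \<epsilon> * norm p * norm p" by (intro mult_right_mono close) simp
        finally show ?thesis by (simp add: dot_square_norm power2_eq_square)
      qed
      ultimately show ?thesis by linarith
    qed
    show "subspace ((*v) Q ` C S)"
      using subC by (rule linear_subspace_image[OF matrix_vector_mul_linear])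
    show "0 < A u \<bullet> u" if u: "u \<in> (*v) Q ` C S" "u \<noteq> 0" for u
    proof -
      obtain y where y: "y \<in> C S" "u = Q *v y" using u(1) by blast
      have "B *v u = Q *v (\<chi> i. \<eta> (h i) * y $ i)"
      proof -
        have "B *v u = (\<Sum>i\<in>UNIV. y $ i *\<^sub>R (B *v column i Q))"
          unfolding y(2) matrix_mult_sum[of Q]
          by (simp add: linear_sum[OF matrix_vector_mul_linear] matrix_vector_mult_scaleR scalar_mult_eq_scaleR)
        then show ?thesis unfolding matrix_mult_sum[of Q] by (simp add: ev scalar_mult_eq_scaleR mult.commute)
      qed
      then have "A u = Q *v (\<chi> i. s * (d j - \<eta> (h i)) * y $ i)"
      proof -
        assume e: "B *v u = Q *v (\<chi> i. \<eta> (h i) * y $ i)"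
        have "(\<chi> i. s * (d j - \<eta> (h i)) * y $ i) = s *\<^sub>R (d j *\<^sub>R y - (\<chi> i. \<eta> (h i) * y $ i))"
          by (simp add: vec_eq_iff algebra_simps)
        then show ?thesis
          unfolding A_def e unfolding y(2)
          by (simp add: matrix_vector_mult_scaleR matrix_vector_mult_diff_distrib)
      qed
      then have "A u \<bullet> u = (\<chi> i. s * (d j - \<eta> (h i)) * y $ i) \<bullet> y"
        by (simp only: y(2) orthogonal_matrix_facts(3)[OF Q])
      also have "\<dots> = (\<Sum>i\<in>UNIV. s * (d j - \<eta> (h i)) * (y $ i * y $ i))"
        by (simp add: inner_vec_def mult.assoc)
      also have "\<dots> > 0"
      proof -
        have pos: "0 < s * (d j - \<eta> (h i))" if iS: "i \<in> S" for i
        proof (cases "d i = d j")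
          case True then show ?thesis by (rule move)
        next
          case False
          consider "s = 1" "d i < d j" | "s = - 1" "d j < d i"
            using iS False s unfolding S_def by fastforce
          then show ?thesis
          proof cases
            case 1
            then have "\<eta> (h i) \<le> \<eta> (h j)" using d[OF 1(2)] \<eta> by (auto simp: mono_on_def)
            then show ?thesis using move[of j] 1(1) by simp
          next
            case 2
            then have "\<eta> (h j) \<le> \<eta> (h i)" using d[OF 2(2)] \<eta> by (auto simp: mono_on_def)
            then show ?thesis using move[of j] 2(1) by simp
          qed
        qed
        have "y \<noteq> 0" using u(2) y(2) by auto
        then obtain k where k: "y $ k \<noteq> 0" by (auto simp: vec_eq_iff)
        then have kS: "k \<in> S" using y(1) by (auto simp: C_def)
        show ?thesis
        proof (rule sum_pos2[of _ k])
          show "0 < s * (d j - \<eta> (h k)) * (y $ k * y $ k)"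
            using k by (intro mult_pos_pos[OF pos[OF kS]]) (simp flip: power2_eq_square)
          show "0 \<le> s * (d j - \<eta> (h i)) * (y $ i * y $ i)" for i
          proof (cases "i \<in> S")
            case True then show ?thesis
              by (intro mult_nonneg_nonneg[OF less_imp_le[OF pos] zero_le_square])
          next
            case False then show ?thesis using y(1) by (simp add: C_def)
          qed
        qed auto
      qed
      finally show ?thesis .
    qed
    show "DIM(real ^ 'n) \<le> dim (C (- S)) + dim ((*v) Q ` C S)"
    proof -
      have inj: "inj ((*v) Q)" using orthogonal_matrix_facts(1)[OF Q] by (metis injI)
      have "dim ((*v) Q ` C S) = dim (C S)"
        by (rule dim_image_eq[OF matrix_vector_mul_linear inj_on_subset[OF inj]]) simp
      moreover have "card (- S) + card S = CARD('n)"
        by (subst card_Un_disjoint[symmetric]) (auto simp: Compl_partition2)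
      moreover have "dim (C S) = card S" for S unfolding C_def by (rule dim_coordinate_subspace)
      ultimately show ?thesis by simp
    qed
    show "a \<notin> C (- S)" using on by (auto simp: C_def S_def intro!: exI[of _ i0])
    show "A a \<bullet> p = 0" if p: "p \<in> C (- S)" for p
    proof -
      have "(A a) $ i * p $ i = 0" for i
        using off[of i] p by (cases "d i = d j") (auto simp: A_def C_def S_def)
      then show ?thesis unfolding inner_vec_def inner_real_def by (intro sum.neutral ballI)
    qed
  qed
  then show ?thesis by (simp add: A_def)
qed

section \<open>The linear problem on twisted periodic functions\<close>

lemma continuous_has_antiderivative:
  fixes q :: "real \<Rightarrow> 'a::banach"
  assumes q: "continuous_on UNIV q"
  obtains Q where "\<And>t. (Q has_vector_derivative q t) (at t)"
proof
  \<comment> \<open>Depending on the sign of \<open>t\<close>, one of the two intervals has length zero.\<close>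
  define Q where "Q t = integral {0..t} q - integral {t..0} q" for t
  have io: "q integrable_on {a..b}" for a b
    by (rule integrable_continuous_interval) (use q continuous_on_subset in blast)
  fix t :: real
  define a where "a = - \<bar>t\<bar> - 1"
  have a: "a < t" "a < 0" "t < - a" by (auto simp: a_def)
  have Q: "Q u = integral {a..u} q - integral {a..0} q" if "u > a" for u
  proof (cases "u \<ge> 0")
    case True
    then show ?thesis using Henstock_Kurzweil_Integration.integral_combine[OF _ True io, of a] a
      by (cases "u = 0") (auto simp: Q_def eq_diff_eq add.commute)
  next
    case False
    then show ?thesis using Henstock_Kurzweil_Integration.integral_combine[OF _ _ io, of a u 0] a that
      by (auto simp: Q_def algebra_simps)
  qed
  have "((\<lambda>u. integral {a..u} q) has_vector_derivative q t) (at t within {a..- a})"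
    by (rule integral_has_vector_derivative) (use a q continuous_on_subset in auto)
  then have "((\<lambda>u. integral {a..u} q) has_vector_derivative q t) (at t)"
    using a by (simp add: at_within_Icc_at)
  then have "((\<lambda>u. integral {a..u} q - integral {a..0} q) has_vector_derivative q t) (at t)"
    by (auto intro!: derivative_eq_intros)
  moreover have "\<forall>\<^sub>F u in nhds t. Q u = integral {a..u} q - integral {a..0} q"
    using eventually_nhds_in_open[of "{a<..}" t] a by (auto elim!: eventually_mono simp: Q)
  ultimately show "(Q has_vector_derivative q t) (at t)"
    by (subst has_vector_derivative_cong_ev[where g = "\<lambda>u. integral {a..u} q - integral {a..0} q"])
      (use a Q in \<open>auto elim!: eventually_mono\<close>)
qed

lemma has_vector_derivative_shift:
  assumes "(Q has_vector_derivative q) (at (t + s))"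
  shows "((\<lambda>u. Q (u + s)) has_vector_derivative q) (at t)"
    and "((\<lambda>u. Q (t + u)) has_vector_derivative q) (at s)"
proof -
  have "((\<lambda>u. u + s) has_vector_derivative 1) (at t)" "((\<lambda>u. t + u) has_vector_derivative 1) (at s)"
    by (auto intro!: derivative_eq_intros)
  from vector_diff_chain_at[OF this(1), of Q q] vector_diff_chain_at[OF this(2), of Q q] assms
  show "((\<lambda>u. Q (u + s)) has_vector_derivative q) (at t)"
    and "((\<lambda>u. Q (t + u)) has_vector_derivative q) (at s)"
    by (simp_all add: o_def)
qed

lemma integral_translate:
  fixes Q :: "real \<Rightarrow> 'a::banach"
  assumes Q: "\<And>t. (Q has_vector_derivative q t) (at t)" and "\<tau> \<ge> 0"
  shows "((\<lambda>s. q (t + s)) has_integral Q (t + \<tau>) - Q t) {0..\<tau>}"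
  using fundamental_theorem_of_calculus[of 0 \<tau> "\<lambda>s. Q (t + s)" "\<lambda>s. q (t + s)"] assms
  by (auto intro: has_vector_derivative_shift has_vector_derivative_at_within)

lemma constant_derivative_imp_affine:
  fixes f :: "real \<Rightarrow> 'a::real_normed_vector"
  assumes "\<And>t. (f has_vector_derivative m) (at t)"
  shows "f t = f 0 + t *\<^sub>R m"
proof -
  have "((\<lambda>t. f t - t *\<^sub>R m) has_vector_derivative 0) (at t within UNIV)" for t
    by (rule derivative_eq_intros assms refl | simp)+
  from has_vector_derivative_zero_constant[OF convex_UNIV this]
  obtain c where "\<And>t. f t - t *\<^sub>R m = c" by auto
  from this[of t] this[of 0] show ?thesis by (simp add: algebra_simps)
qed

text \<open>Convolution with the sawtooth of mean zero inverts differentiation on periodic functions up to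
  their mean. With a primitive \<open>Q\<close> of \<open>q\<close>, and \<open>m\<close> the mean of
  \<open>q\<close>, the convolution is \<open>Q t - t m\<close> plus the constant that makes its mean
  zero.\<close>

lemma sawtooth_convolution:
  fixes q :: "real \<Rightarrow> complex"
  assumes \<tau>: "\<tau> > 0" and q: "continuous_on UNIV q" and per: "\<And>t. q (t + \<tau>) = q t"
  defines "g \<equiv> \<lambda>t. integral {0..\<tau>} (\<lambda>s. of_real (s / \<tau> - 1 / 2) * q (t + s))"
  shows "(g has_vector_derivative q t - integral {0..\<tau>} q / of_real \<tau>) (at t)"
    and "(g has_integral 0) {0..\<tau>}"
proof -
  obtain Q where Q: "\<And>t. (Q has_vector_derivative q t) (at t)"
    using continuous_has_antiderivative[OF q] by blast
  have Qc: "continuous_on UNIV Q"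
    using Q by (meson continuous_at_imp_continuous_on has_vector_derivative_continuous)
  obtain S where S: "\<And>t. (S has_vector_derivative Q t) (at t)"
    using continuous_has_antiderivative[OF Qc] by blast
  define M where "M = integral {0..\<tau>} q"
  define D where "D = S \<tau> - S 0"
  have M: "M = Q \<tau> - Q 0"
    unfolding M_def using integral_translate[OF Q, of \<tau> 0] \<tau> by (simp add: integral_unique)
  have "((\<lambda>t. Q (t + \<tau>) - Q t) has_vector_derivative q (t + \<tau>) - q t) (at t)" for t
    by (intro has_vector_derivative_diff has_vector_derivative_shift(1) Q)
  then have "((\<lambda>t. Q (t + \<tau>) - Q t) has_vector_derivative 0) (at t)" for t
    by (simp add: per)
  note Q_affine = constant_derivative_imp_affine[OF this]
  have QM: "Q (t + \<tau>) = Q t + M" for t using Q_affine[of t] by (simp add: M algebra_simps)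
  have "((\<lambda>t. S (t + \<tau>) - S t) has_vector_derivative Q (t + \<tau>) - Q t) (at t)" for t
    by (intro has_vector_derivative_diff has_vector_derivative_shift(1) S)
  then have "((\<lambda>t. S (t + \<tau>) - S t) has_vector_derivative M) (at t)" for t
    by (simp add: QM)
  note S_affine = constant_derivative_imp_affine[OF this]
  have SD: "S (t + \<tau>) = S t + D + t *\<^sub>R M" for t
    using S_affine[of t] by (simp add: D_def algebra_simps)
  have g: "g t = Q t - (t / \<tau>) *\<^sub>R M + (M / 2 - D / of_real \<tau>)" for t
  proof -
    have "((\<lambda>s. of_real (s / \<tau> - 1 / 2) * q (t + s)) has_integral
       (of_real (\<tau> / \<tau> - 1 / 2) * Q (t + \<tau>) - S (t + \<tau>) / of_real \<tau>)
        - (of_real (0 / \<tau> - 1 / 2) * Q (t + 0) - S (t + 0) / of_real \<tau>)) {0..\<tau>}"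
    proof (rule fundamental_theorem_of_calculus)
      fix s assume "s \<in> {0..\<tau>}"
      have "((\<lambda>s. of_real (s / \<tau> - 1 / 2) * Q (t + s) - S (t + s) / of_real \<tau>) has_vector_derivative
        (of_real (s / \<tau> - 1 / 2) * q (t + s) + of_real (1 / \<tau>) * Q (t + s)) - Q (t + s) / of_real \<tau>) (at s)"
        by (intro has_vector_derivative_diff has_vector_derivative_mult has_vector_derivative_of_real
            has_vector_derivative_divide has_vector_derivative_shift(2)[OF Q] has_vector_derivative_shift(2)[OF S])
          (use \<tau> in \<open>auto intro!: derivative_eq_intros\<close>)
      then show "((\<lambda>s. of_real (s / \<tau> - 1 / 2) * Q (t + s) - S (t + s) / of_real \<tau>) has_vector_derivative
        of_real (s / \<tau> - 1 / 2) * q (t + s)) (at s within {0..\<tau>})"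
        using \<tau> by (auto intro: has_vector_derivative_at_within)
    qed (use \<tau> in simp)
    from integral_unique[OF this]
    have "g t = (of_real (\<tau> / \<tau> - 1 / 2) * (Q t + M) - (S t + D + t *\<^sub>R M) / of_real \<tau>)
        - (of_real (0 / \<tau> - 1 / 2) * Q t - S t / of_real \<tau>)"
      by (simp only: g_def QM SD add_0_right)
    also have "of_real (\<tau> / \<tau> - 1 / 2) = (1 / 2 :: complex)" using \<tau> by simp
    also have "of_real (0 / \<tau> - 1 / 2) = (- 1 / 2 :: complex)" by simp
    finally show ?thesis
      using \<tau> by (simp add: add_divide_distrib scaleR_conv_of_real algebra_simps)
  qed
  have g': "g = (\<lambda>t. Q t - (t / \<tau>) *\<^sub>R M + (M / 2 - D / of_real \<tau>))" using g by blast
  show "(g has_vector_derivative q t - integral {0..\<tau>} q / of_real \<tau>) (at t)"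
  proof -
    have "((\<lambda>t. t / \<tau>) has_field_derivative 1 / \<tau>) (at t)"
      using \<tau> by (auto intro!: derivative_eq_intros)
    then have "(g has_vector_derivative q t - ((t / \<tau>) *\<^sub>R 0 + (1 / \<tau>) *\<^sub>R M) + 0) (at t)"
      unfolding g' by (intro has_vector_derivative_add has_vector_derivative_diff Q
          has_vector_derivative_scaleR has_vector_derivative_const)
    then show ?thesis by (simp add: M_def scaleR_conv_of_real)
  qed
  have "(g has_integral
      (S \<tau> - (\<tau>\<^sup>2 / (2 * \<tau>)) *\<^sub>R M + \<tau> *\<^sub>R (M / 2 - D / of_real \<tau>))
      - (S 0 - (0\<^sup>2 / (2 * \<tau>)) *\<^sub>R M + 0 *\<^sub>R (M / 2 - D / of_real \<tau>))) {0..\<tau>}"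
  proof (rule fundamental_theorem_of_calculus)
    fix s assume "s \<in> {0..\<tau>}"
    have "((\<lambda>t. S t - (t\<^sup>2 / (2 * \<tau>)) *\<^sub>R M + t *\<^sub>R (M / 2 - D / of_real \<tau>)) has_vector_derivative g s) (at s)"
    proof -
      have "((\<lambda>t. t\<^sup>2 / (2 * \<tau>)) has_field_derivative s / \<tau>) (at s)"
        using \<tau> by (auto intro!: derivative_eq_intros)
      then have "((\<lambda>t. S t - (t\<^sup>2 / (2 * \<tau>)) *\<^sub>R M + t *\<^sub>R (M / 2 - D / of_real \<tau>)) has_vector_derivative
          Q s - ((s\<^sup>2 / (2 * \<tau>)) *\<^sub>R 0 + (s / \<tau>) *\<^sub>R M)
          + (s *\<^sub>R 0 + 1 *\<^sub>R (M / 2 - D / of_real \<tau>))) (at s)"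
        by (intro has_vector_derivative_add has_vector_derivative_diff S
          has_vector_derivative_scaleR has_vector_derivative_const DERIV_ident)
      then show ?thesis by (simp add: g)
    qed
    then show "((\<lambda>t. S t - (t\<^sup>2 / (2 * \<tau>)) *\<^sub>R M + t *\<^sub>R (M / 2 - D / of_real \<tau>)) has_vector_derivative g s)
      (at s within {0..\<tau>})" by (rule has_vector_derivative_at_within)
  qed (use \<tau> in simp)
  then show "(g has_integral 0) {0..\<tau>}"
    using \<tau> by (simp add: D_def power2_eq_square scaleR_conv_of_real field_simps)
qed

lemma window_integral_derivative:
  fixes q :: "real \<Rightarrow> complex"
  assumes "\<tau> > 0" "continuous_on UNIV q"
  shows "((\<lambda>t. integral {0..\<tau>} (\<lambda>s. q (t + s))) has_vector_derivative q (t + \<tau>) - q t) (at t)"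
proof -
  obtain Q where Q: "\<And>t. (Q has_vector_derivative q t) (at t)"
    using continuous_has_antiderivative[OF assms(2)] by blast
  have "integral {0..\<tau>} (\<lambda>s. q (t + s)) = Q (t + \<tau>) - Q t" for t
    using integral_translate[OF Q, of \<tau> t] assms(1) by (simp add: integral_unique)
  then show ?thesis
    by (simp add: has_vector_derivative_diff has_vector_derivative_shift(1) Q)
qed

lemma has_vector_derivative_vec:
  fixes f :: "real \<Rightarrow> 'a::real_normed_vector ^ 'n"
  assumes "\<And>j. ((\<lambda>t. f t $ j) has_vector_derivative f' $ j) (at t within S)"
  shows "(f has_vector_derivative f') (at t within S)"
  using assms unfolding has_vector_derivative_def has_derivative_within
  by (auto intro!: vec_tendstoI bounded_linear_scaleR_left)

lemma norm_vector_scalar_mult: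
  fixes x :: "complex ^ 'n"
  shows "norm (c *s x) = cmod c * norm x"
  by (simp add: norm_vec_def norm_mult L2_set_right_distrib)

lemma norm_le_card_mult:
  fixes x :: "complex ^ 'n"
  assumes "\<And>j. cmod (x $ j) \<le> B"
  shows "norm x \<le> real CARD('n) * B"
proof -
  have "norm x \<le> (\<Sum>j\<in>UNIV. cmod (x $ j))" unfolding norm_vec_def by (rule L2_set_le_sum) simp
  also have "\<dots> \<le> (\<Sum>j\<in>(UNIV :: 'n set). B)" by (rule sum_mono) (rule assms)
  finally show ?thesis by simp
qed

text \<open>Shifting time by \<open>- \<tau>\<close> multiplies the complex curve \<open>z\<close> by this
  sixth root of unity.\<close>

abbreviation om :: complex where "om \<equiv> cis (pi / 3)"

lemma om_cnj: "om * cnj om = 1" "cnj om * om = 1"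
  by (simp_all add: cis_cnj cis_mult)

text \<open>The \<open>d j\<close> play the part of the eigenvalues of the Hessian at the parameter under
  study, in coordinates that diagonalize it.\<close>

locale resonance =
  fixes \<tau> :: real and d :: "'n::finite \<Rightarrow> real"
  assumes \<tau>: "\<tau> > 0"
begin

definition w :: "'n \<Rightarrow> real" where "w j = sqrt 3 * d j"

text \<open>The mode with frequency \<open>w j\<close> satisfies the twist condition \<open>h (t + \<tau>) =
  cnj om *s h t\<close>.\<close>

definition resonant :: "'n \<Rightarrow> bool" where "resonant j \<longleftrightarrow> cis (w j * \<tau>) * om = 1"

text \<open>Amplitudes of resonant modes, that is, the kernel of the linear problem.\<close>

definition K :: "(complex ^ 'n) set" where "K = {v. \<forall>j. \<not> resonant j \<longrightarrow> v $ j = 0}"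

definition twisted :: "(real \<Rightarrow> complex ^ 'n) \<Rightarrow> bool" where
  "twisted h \<longleftrightarrow> continuous_on UNIV h \<and> (\<forall>t. h (t + \<tau>) = cnj om *s h t)"

text \<open>The solution of the linear equation with initial value \<open>v\<close>; on \<open>K\<close> it
  is twisted.\<close>

definition E :: "complex ^ 'n \<Rightarrow> real \<Rightarrow> complex ^ 'n" where
  "E v t = (\<chi> j. cis (w j * t) * v $ j)"

text \<open>The amplitudes of the resonant modes contained in \<open>h\<close>.\<close>

definition P :: "(real \<Rightarrow> complex ^ 'n) \<Rightarrow> complex ^ 'n" where
  "P h = (\<chi> j. if resonant j then integral {0..\<tau>} (\<lambda>s. cis (- (w j * s)) * h s $ j) / of_real \<tau> else 0)"

text \<open>The kernel of the solution operator of \<open>y' = i w y + h\<close> on twisted functions. With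
  \<open>q u = cis (- w u) * h u\<close> the problem is \<open>y = cis (w t) * Y\<close> and \<open>Y' =
  q\<close>. Without resonance \<open>q\<close> is multiplied by a constant different from 1 over a period,
  which determines \<open>Y\<close>; with resonance \<open>q\<close> is periodic and the sawtooth solves
  \<open>Y' = q\<close> minus the mean of \<open>q\<close>.\<close>

definition green :: "'n \<Rightarrow> real \<Rightarrow> complex" where
  "green j s = cis (- (w j * s)) *
     (if resonant j then of_real (s / \<tau> - 1 / 2) else 1 / (cis (- (w j * \<tau>)) * cnj om - 1))"

definition G :: "(real \<Rightarrow> complex ^ 'n) \<Rightarrow> real \<Rightarrow> complex ^ 'n" where
  "G h t = (\<chi> j. integral {0..\<tau>} (\<lambda>s. green j s * h (t + s) $ j))"

lemma subspace_K: "subspace K"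
  by (auto simp: K_def subspace_def)

lemma P_in_K: "P h \<in> K" by (simp add: P_def K_def)

lemma smult_in_K: "v \<in> K \<Longrightarrow> c *s v \<in> K" by (simp add: K_def)

lemma twistedD:
  assumes "twisted h"
  shows "continuous_on S h" "h (t + \<tau>) = cnj om *s h t" "continuous_on S (\<lambda>t. h t $ j)"
  using assms by (auto simp: twisted_def intro: continuous_on_subset continuous_intros)

lemma continuous_on_component_shift:
  assumes "twisted h" shows "continuous_on S (\<lambda>s. h (t + s) $ j)"
proof -
  have "continuous_on S (\<lambda>s. h (t + s))"
    by (rule continuous_on_compose2[OF twistedD(1)[OF assms, of UNIV]]) (auto intro!: continuous_intros)
  then show ?thesis by (rule continuous_on_component)
qed

lemma resonant_iff: "resonant j \<longleftrightarrow> cis (- (w j * \<tau>)) * cnj om = 1"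
proof -
  have "cis (- (w j * \<tau>)) * cnj om = cnj (cis (w j * \<tau>) * om)" by (simp add: cis_cnj)
  then show ?thesis unfolding resonant_def by (metis complex_cnj_cnj complex_cnj_one)
qed

lemma green_continuous: "continuous_on S (green j)"
  using \<tau> unfolding green_def
  by (cases "resonant j") (auto intro!: continuous_intros simp: resonant_iff)

lemma norm_E: "norm (E v t) = norm v"
  by (simp add: norm_vec_def E_def norm_mult)

lemma E_diff: "E (v - v') t = E v t - E v' t"
  by (simp add: vec_eq_iff E_def algebra_simps)

lemma E_has_vector_derivative:
  "(E v has_vector_derivative (\<chi> j. \<i> * of_real (w j) * E v t $ j)) (at t)"
proof (rule has_vector_derivative_vec)
  fix j
  have "((\<lambda>t. cis (w j * t)) has_vector_derivative \<i> * of_real (w j) * cis (w j * t)) (at t)"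
    unfolding has_vector_derivative_def
    by (rule derivative_eq_intros refl)+ (auto simp: fun_eq_iff scaleR_conv_of_real)
  then show "((\<lambda>t. E v t $ j) has_vector_derivative (\<chi> j. \<i> * of_real (w j) * E v t $ j) $ j) (at t)"
    unfolding E_def by (auto intro!: derivative_eq_intros)
qed

lemma twisted_E: "v \<in> K \<Longrightarrow> twisted (E v)"
  unfolding twisted_def
proof (intro conjI allI)
  show "continuous_on UNIV (E v)"
    using E_has_vector_derivative[of v]
    by (meson continuous_at_imp_continuous_on has_vector_derivative_continuous)
  fix t assume v: "v \<in> K"
  show "E v (t + \<tau>) = cnj om *s E v t"
  proof (rule vec_eq_iff[THEN iffD2], rule allI)
    fix j
    show "E v (t + \<tau>) $ j = (cnj om *s E v t) $ j"
    proof (cases "resonant j")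
      case True
      then have "cis (w j * \<tau>) = cnj om"
        unfolding resonant_def by (metis mult.assoc mult.right_neutral mult_1 om_cnj(1))
      moreover have "cis (w j * (t + \<tau>)) = cis (w j * t) * cis (w j * \<tau>)"
        by (simp add: cis_mult distrib_left)
      ultimately show ?thesis by (simp add: E_def)
    qed (use v in \<open>simp add: K_def E_def\<close>)
  qed
qed

lemma P_integrable: "twisted h \<Longrightarrow> (\<lambda>s. cis (- (w j * s)) * h s $ j) integrable_on {a..b}"
  by (intro integrable_continuous_interval continuous_intros twistedD(3)) auto

lemma G_integrable: "twisted h \<Longrightarrow> (\<lambda>s. green j s * h (t + s) $ j) integrable_on {a..b}"
  by (intro integrable_continuous_interval continuous_intros continuous_on_component_shift green_continuous) 

lemma twisted_diff: "twisted h \<Longrightarrow> twisted h' \<Longrightarrow> twisted (\<lambda>t. h t - h' t)"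
  by (auto simp: twisted_def vector_ssub_ldistrib intro: continuous_intros)

lemma twisted_add: "twisted h \<Longrightarrow> twisted h' \<Longrightarrow> twisted (\<lambda>t. h t + h' t)"
  by (auto simp: twisted_def vector_add_ldistrib intro: continuous_intros)

lemma P_diff: "twisted h \<Longrightarrow> twisted h' \<Longrightarrow> P (\<lambda>t. h t - h' t) = P h - P h'"
  by (simp add: vec_eq_iff P_def right_diff_distrib P_integrable integral_diff diff_divide_distrib)

lemma P_add: "twisted h \<Longrightarrow> twisted h' \<Longrightarrow> P (\<lambda>t. h t + h' t) = P h + P h'"
  by (simp add: vec_eq_iff P_def distrib_left P_integrable integral_add add_divide_distrib)

lemma G_diff: "twisted h \<Longrightarrow> twisted h' \<Longrightarrow> G (\<lambda>t. h t - h' t) t = G h t - G h' t"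
  by (simp add: vec_eq_iff G_def right_diff_distrib G_integrable integral_diff)

lemma P_bound:
  assumes h: "twisted h" and B: "\<And>t. norm (h t) \<le> B"
  shows "norm (P h) \<le> real CARD('n) * B"
proof (rule norm_le_card_mult)
  fix j
  have B0: "B \<ge> 0" using B[of 0] norm_ge_zero order_trans by blast
  have "cmod (integral {0..\<tau>} (\<lambda>s. cis (- (w j * s)) * h s $ j)) \<le> B * (\<tau> - 0)"
    by (rule integral_bound)
      (use \<tau> h in \<open>auto simp: norm_mult intro: order_trans[OF Finite_Cartesian_Product.norm_nth_le B]
        intro!: continuous_intros twistedD\<close>)
  then show "cmod (P h $ j) \<le> B"
    using \<tau> B0 by (simp add: P_def norm_divide pos_divide_le_eq)
qed

definition green_bound :: real where
  "green_bound = real CARD('n) * (\<tau> * (\<Sum>j\<in>UNIV. 1 + 1 / cmod (cis (- (w j * \<tau>)) * cnj om - 1)))"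

lemma green_bound_nonneg: "green_bound \<ge> 0"
  using \<tau> by (auto simp: green_bound_def intro!: mult_nonneg_nonneg sum_nonneg)

lemma G_bound:
  assumes h: "twisted h" and B: "\<And>t. norm (h t) \<le> B"
  shows "norm (G h t) \<le> green_bound * B"
proof -
  define \<kappa> where "\<kappa> = (\<Sum>j\<in>UNIV. 1 + 1 / cmod (cis (- (w j * \<tau>)) * cnj om - 1))"
  have B0: "B \<ge> 0" using B[of 0] norm_ge_zero order_trans by blast
  have gr: "cmod (green j s) \<le> \<kappa>" if "s \<in> {0..\<tau>}" for j s
  proof -
    have "\<bar>s / \<tau> - 1 / 2\<bar> \<le> 1" using that \<tau> by (auto simp: abs_le_iff field_simps)
    then have "cmod (of_real (s / \<tau> - 1 / 2)) \<le> 1" by (simp only: norm_of_real)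
    then have "cmod (green j s) \<le> 1 + 1 / cmod (cis (- (w j * \<tau>)) * cnj om - 1)"
      unfolding green_def norm_mult norm_cis
      by (cases "resonant j")
        (auto simp: norm_divide simp del: of_real_diff of_real_divide norm_of_real intro: add_increasing2)
    also have "\<dots> \<le> \<kappa>" unfolding \<kappa>_def by (rule member_le_sum) auto
    finally show ?thesis .
  qed
  have "norm (G h t) \<le> real CARD('n) * (\<kappa> * B * \<tau>)"
  proof (rule norm_le_card_mult)
    fix j
    have "cmod (integral {0..\<tau>} (\<lambda>s. green j s * h (t + s) $ j)) \<le> \<kappa> * B * (\<tau> - 0)"
    proof (rule integral_bound)
      fix s assume s: "s \<in> {0..\<tau>}"
      show "cmod (green j s * h (t + s) $ j) \<le> \<kappa> * B"
        unfolding norm_mult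
        by (intro mult_mono gr[OF s] order_trans[OF Finite_Cartesian_Product.norm_nth_le B]
            order_trans[OF norm_ge_zero gr[OF s]]) auto
    qed (use \<tau> h in \<open>auto intro!: continuous_intros continuous_on_component_shift green_continuous\<close>)
    then show "cmod (G h t $ j) \<le> \<kappa> * B * \<tau>" by (simp add: G_def)
  qed
  then show ?thesis by (simp add: green_bound_def \<kappa>_def mult_ac)
qed

lemma G_component:
  assumes h: "twisted h"
  defines "q \<equiv> \<lambda>j u. cis (- (w j * u)) * h u $ j"
  shows "continuous_on UNIV (q j)"
    and "q j (t + \<tau>) = cis (- (w j * \<tau>)) * cnj om * q j t"
    and "resonant j \<Longrightarrow> G h t $ j =
           cis (w j * t) * integral {0..\<tau>} (\<lambda>s. of_real (s / \<tau> - 1 / 2) * q j (t + s))"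
    and "\<not> resonant j \<Longrightarrow> G h t $ j = cis (w j * t) *
           (integral {0..\<tau>} (\<lambda>s. q j (t + s)) / (cis (- (w j * \<tau>)) * cnj om - 1))"
proof -
  have shift: "cis (- (w j * (t + \<tau>))) = cis (- (w j * \<tau>)) * cis (- (w j * t))"
    by (simp add: cis_mult algebra_simps)
  show "continuous_on UNIV (q j)" unfolding q_def
    by (intro continuous_intros twistedD(3)[OF h])
  show "q j (t + \<tau>) = cis (- (w j * \<tau>)) * cnj om * q j t"
    by (simp add: q_def twistedD(2)[OF h] shift)
  have c: "cis (- (w j * s)) = cis (w j * t) * cis (- (w j * (t + s)))" for s
    by (simp add: cis_mult algebra_simps)
  show "G h t $ j = cis (w j * t) * integral {0..\<tau>} (\<lambda>s. of_real (s / \<tau> - 1 / 2) * q j (t + s))"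
    if "resonant j"
    unfolding G_def green_def q_def vec_lambda_beta using that
    by (subst integral_mult_right[symmetric], subst c) (simp add: mult_ac)
  show "G h t $ j = cis (w j * t) *
           (integral {0..\<tau>} (\<lambda>s. q j (t + s)) / (cis (- (w j * \<tau>)) * cnj om - 1))"
    if "\<not> resonant j"
    unfolding G_def green_def q_def vec_lambda_beta using that
    by (subst integral_divide[symmetric], subst integral_mult_right[symmetric], subst c)
      (simp add: mult_ac)
qed

lemma cis_linear_derivative:
  "((\<lambda>t. cis (a * t)) has_vector_derivative \<i> * of_real a * cis (a * t)) (at t)"
  unfolding has_vector_derivative_def
  by (rule derivative_eq_intros refl)+ (auto simp: fun_eq_iff scaleR_conv_of_real)

text \<open>By the choice of the kernel, \<open>G h\<close> solves the inhomogeneous linear equation after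
  the resonant modes have been removed from \<open>h\<close>.\<close>

lemma G_has_vector_derivative:
  assumes h: "twisted h"
  shows "(G h has_vector_derivative
           (\<chi> j. \<i> * of_real (w j) * G h t $ j) + h t - E (P h) t) (at t)"
proof (rule has_vector_derivative_vec)
  fix j
  define q where "q u = cis (- (w j * u)) * h u $ j" for u
  note q = G_component(1,2)[OF h, of j, folded q_def]
  have h_q: "cis (w j * t) * q t = h t $ j" for t
    by (simp add: q_def cis_mult mult.assoc[symmetric])
  show "((\<lambda>t. G h t $ j) has_vector_derivative
           ((\<chi> j. \<i> * of_real (w j) * G h t $ j) + h t - E (P h) t) $ j) (at t)"
  proof (cases "resonant j")
    case True
    have per: "q (t + \<tau>) = q t" for t using q(2) True by (simp add: resonant_iff)
    note g = sawtooth_convolution(1)[OF \<tau> q(1) per, of t]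
    have G: "(\<lambda>t. G h t $ j) = (\<lambda>t. cis (w j * t) *
        integral {0..\<tau>} (\<lambda>s. of_real (s / \<tau> - 1 / 2) * q (t + s)))"
      using G_component(3)[OF h True] by (simp add: q_def)
    have "E (P h) t $ j = cis (w j * t) * (integral {0..\<tau>} q / of_real \<tau>)"
      using True by (simp add: E_def P_def q_def[abs_def])
    then have e: "((\<chi> j. \<i> * of_real (w j) * G h t $ j) + h t - E (P h) t) $ j
      = cis (w j * t) * (q t - integral {0..\<tau>} q / of_real \<tau>)
        + \<i> * of_real (w j) * cis (w j * t) * integral {0..\<tau>} (\<lambda>s. of_real (s / \<tau> - 1 / 2) * q (t + s))"
      using h_q[of t] fun_cong[OF G, of t] by (simp add: algebra_simps)
    show ?thesis unfolding G e
      by (rule has_vector_derivative_mult[OF cis_linear_derivative g])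
  next
    case False
    define c where "c = cis (- (w j * \<tau>)) * cnj om - 1"
    have c: "c \<noteq> 0" using False by (simp add: c_def resonant_iff)
    have G: "(\<lambda>t. G h t $ j) = (\<lambda>t. cis (w j * t) * (integral {0..\<tau>} (\<lambda>s. q (t + s)) / c))"
      using G_component(4)[OF h False] by (simp add: q_def c_def)
    have g: "((\<lambda>t. integral {0..\<tau>} (\<lambda>s. q (t + s)) / c) has_vector_derivative (q (t + \<tau>) - q t) / c) (at t)"
      by (rule has_vector_derivative_divide[OF window_integral_derivative[OF \<tau> q(1)]])
    have "q (t + \<tau>) - q t = c * q t" using q(2)[of t] by (simp add: c_def algebra_simps)
    then have qc: "(q (t + \<tau>) - q t) / c = q t" using c by simp
    have "E (P h) t $ j = 0" using False by (simp add: E_def P_def)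
    then have e: "((\<chi> j. \<i> * of_real (w j) * G h t $ j) + h t - E (P h) t) $ j
      = cis (w j * t) * q t
        + \<i> * of_real (w j) * cis (w j * t) * (integral {0..\<tau>} (\<lambda>s. q (t + s)) / c)"
      using h_q[of t] fun_cong[OF G, of t] by (simp add: algebra_simps)
    show ?thesis unfolding G e
      by (rule has_vector_derivative_mult[OF cis_linear_derivative g[unfolded qc]])
  qed
qed

lemma twisted_G:
  assumes h: "twisted h" shows "twisted (G h)"
  unfolding twisted_def
proof (intro conjI allI)
  show "continuous_on UNIV (G h)"
    using G_has_vector_derivative[OF h]
    by (meson continuous_at_imp_continuous_on has_vector_derivative_continuous)
  have "h (t + \<tau> + s) $ j = cnj om * h (t + s) $ j" for t s j
    using twistedD(2)[OF h, of "t + s"] by (simp add: algebra_simps)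
  then have "(\<lambda>s. green j s * h (t + \<tau> + s) $ j) = (\<lambda>s. cnj om * (green j s * h (t + s) $ j))" for t j
    by (simp add: fun_eq_iff)
  then show "G h (t + \<tau>) = cnj om *s G h t" for t
    by (simp add: vec_eq_iff G_def)
qed

lemma P_G: assumes h: "twisted h" shows "P (G h) = 0"
proof (rule vec_eq_iff[THEN iffD2], rule allI)
  fix j
  define q where "q u = cis (- (w j * u)) * h u $ j" for u
  note q = G_component(1,2)[OF h, of j, folded q_def]
  show "P (G h) $ j = 0 $ j"
  proof (cases "resonant j")
    case True
    have per: "q (t + \<tau>) = q t" for t using q(2) True by (simp add: resonant_iff)
    have "cis (- (w j * s)) * G h s $ j = integral {0..\<tau>} (\<lambda>u. of_real (u / \<tau> - 1 / 2) * q (s + u))" for s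
      using G_component(3)[OF h True, of s] by (simp add: q_def cis_mult mult.assoc[symmetric])
    then show ?thesis
      using sawtooth_convolution(2)[OF \<tau> q(1) per] True by (simp add: P_def integral_unique)
  qed (simp add: P_def)
qed

lemma P_E: assumes v: "v \<in> K" shows "P (E v) = v"
proof -
  have "cis (- (w j * s)) * E v s $ j = v $ j" for j s
    by (simp add: E_def cis_mult mult.assoc[symmetric])
  then show ?thesis using v \<tau> by (auto simp: vec_eq_iff P_def K_def scaleR_conv_of_real)
qed

text \<open>\<open>P\<close> is the adjoint of \<open>E\<close> for the inner product averaged over a
  period.\<close>

lemma inner_E_integral:
  assumes c: "c \<in> K" and h: "twisted h"
  shows "((\<lambda>s. E c s \<bullet> h s) has_integral \<tau> * (c \<bullet> P h)) {0..\<tau>}"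
proof -
  have "((\<lambda>s. Re (cnj (c $ j) * (cis (- (w j * s)) * h s $ j))) has_integral
      \<tau> * (c $ j \<bullet> P h $ j)) {0..\<tau>}" for j
  proof (cases "resonant j")
    case True
    have "((\<lambda>s. cnj (c $ j) * (cis (- (w j * s)) * h s $ j)) has_integral
        cnj (c $ j) * (of_real \<tau> * P h $ j)) {0..\<tau>}"
      using True \<tau> integrable_integral[OF P_integrable[OF h]]
      by (intro has_integral_mult_right) (simp add: P_def)
    from has_integral_linear[OF this bounded_linear_Re]
    show ?thesis by (simp add: o_def inner_complex_def algebra_simps)
  qed (use c in \<open>simp add: K_def\<close>)
  from has_integral_sum[OF finite this]
  have "((\<lambda>s. \<Sum>j\<in>UNIV. Re (cnj (c $ j) * (cis (- (w j * s)) * h s $ j))) has_integral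
      (\<Sum>j\<in>UNIV. \<tau> * (c $ j \<bullet> P h $ j))) {0..\<tau>}" .
  moreover have "E c s \<bullet> h s = (\<Sum>j\<in>UNIV. Re (cnj (c $ j) * (cis (- (w j * s)) * h s $ j)))" for s
    by (simp add: inner_vec_def E_def inner_complex_def algebra_simps)
  ultimately show ?thesis by (simp add: inner_vec_def sum_distrib_left)
qed

text \<open>Integrate the equation with the factor \<open>cis (- w j * t)\<close> over a period: the twist
  condition expresses the boundary term as a nonzero multiple of the solution itself.\<close>

lemma nonresonant_solution_eq_G:
  assumes nr: "\<And>j. \<not> resonant j" and z: "twisted z" and h: "twisted h"
    and ode: "\<And>t. (z has_vector_derivative (\<chi> j. \<i> * of_real (w j) * z t $ j) + h t) (at t)"
  shows "z t = G h t"
proof (rule vec_eq_iff[THEN iffD2], rule allI)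
  fix j
  define c where "c = cis (- (w j * \<tau>)) * cnj om - 1"
  have c: "c \<noteq> 0" using nr by (simp add: c_def resonant_iff)
  define Y where "Y u = cis (- (w j * u)) * z u $ j" for u
  have "(Y has_vector_derivative cis (- (w j * u)) * h u $ j) (at u)" for u
  proof -
    have "((\<lambda>u. cis (- w j * u) * z u $ j) has_vector_derivative
        cis (- w j * u) * (\<i> * of_real (w j) * z u $ j + h u $ j)
        + \<i> * of_real (- w j) * cis (- w j * u) * z u $ j) (at u)"
      using bounded_linear.has_vector_derivative[OF bounded_linear_vec_nth ode[of u], of j]
      by (intro has_vector_derivative_mult cis_linear_derivative) simp
    then show ?thesis by (simp add: Y_def[abs_def] algebra_simps)
  qed
  from integral_translate[OF this, of \<tau> t] \<tau>
  have "integral {0..\<tau>} (\<lambda>s. cis (- (w j * (t + s))) * h (t + s) $ j) = Y (t + \<tau>) - Y t"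
    by (simp add: integral_unique)
  also have "\<dots> = c * Y t"
  proof -
    have "cis (- (w j * (t + \<tau>))) = cis (- (w j * \<tau>)) * cis (- (w j * t))"
      by (simp add: cis_mult algebra_simps)
    then show ?thesis unfolding Y_def c_def twistedD(2)[OF z] by (simp add: algebra_simps)
  qed
  finally show "z t $ j = G h t $ j"
    using c by (simp add: G_component(4)[OF h nr] c_def[symmetric] Y_def cis_mult mult.assoc[symmetric])
qed

end

text \<open>Resonance means that \<open>w j * \<tau> + pi / 3\<close> is a multiple of \<open>2 *
  pi\<close>, and \<open>- pi / 3 = 2 * pi / 3 - pi\<close>.\<close>

lemma (in resonance) resonant_iff_value: "resonant j \<longleftrightarrow> sqrt 3 * d j * \<tau> \<in> resonant_values"
proof -
  have "resonant j \<longleftrightarrow> cis (w j * \<tau> + pi / 3) = 1" by (simp add: resonant_def cis_mult)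
  also have "\<dots> \<longleftrightarrow> cos (w j * \<tau> + pi / 3) = 1"
    by (auto simp: complex_eq_iff dest: cos_one_sin_zero)
  also have "\<dots> \<longleftrightarrow> (\<exists>n::int. w j * \<tau> + pi / 3 = of_int n * 2 * pi)" by (rule cos_one_2pi_int)
  also have "\<dots> \<longleftrightarrow> (\<exists>n::int. w j * \<tau> = 2 * pi / 3 + (2 * of_int n + 1) * pi)"
  proof
    assume "\<exists>n::int. w j * \<tau> + pi / 3 = of_int n * 2 * pi"
    then obtain n :: int where "w j * \<tau> + pi / 3 = of_int n * 2 * pi" by blast
    then show "\<exists>n::int. w j * \<tau> = 2 * pi / 3 + (2 * of_int n + 1) * pi"
      by (intro exI[of _ "n - 1"]) (simp add: field_simps)
  next
    assume "\<exists>n::int. w j * \<tau> = 2 * pi / 3 + (2 * of_int n + 1) * pi"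
    then obtain n :: int where "w j * \<tau> = 2 * pi / 3 + (2 * of_int n + 1) * pi" by blast
    then show "\<exists>n::int. w j * \<tau> + pi / 3 = of_int n * 2 * pi"
      by (intro exI[of _ "n + 1"]) (simp add: field_simps)
  qed
  finally show ?thesis by (auto simp: resonant_values_def w_def)
qed

section \<open>The Hamiltonian form of the delay equation\<close>

definition re :: "complex ^ 'n \<Rightarrow> real ^ 'n" where "re z = (\<chi> j. Re (z $ j))"

definition emb :: "real ^ 'n \<Rightarrow> complex ^ 'n" where "emb x = (\<chi> j. of_real (x $ j))"

text \<open>Along a twisted curve \<open>z\<close>, with \<open>x t = re (z t)\<close> the three arguments
  are \<open>x t\<close>, \<open>x (t - \<tau>)\<close> and \<open>- x (t - 2 * \<tau>)\<close>. If
  \<open>f\<close> is the gradient of \<open>V\<close> then \<open>F f\<close> is the gradient of \<open>H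
  V\<close> below.\<close>

definition F :: "(real ^ 'n \<Rightarrow> real ^ 'n) \<Rightarrow> complex ^ 'n \<Rightarrow> complex ^ 'n" where
  "F f z = emb (f (re z)) + cnj om *s emb (f (re (om *s z))) + om *s emb (f (re (cnj om *s z)))"

definition H :: "(real ^ 'n \<Rightarrow> real) \<Rightarrow> complex ^ 'n \<Rightarrow> real" where
  "H V z = V (re z) + V (re (om *s z)) + V (re (cnj om *s z))"

lemma om_parts: "Re om = 1 / 2" "Im om = sqrt 3 / 2"
  by (simp_all add: cos_60 sin_60)

lemma om_square: "om * om = - cnj om" "cnj om * cnj om = - om"
  using real_sqrt_mult_self[of 3] by (simp_all add: complex_eq_iff om_parts del: cis.sel)

lemma cmod_om: "cmod om = 1" "cmod (cnj om) = 1" by simp_all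

lemma re_diff: "re (x - y) = re x - re y"
  and re_uminus: "re (- x) = - re x"
  by (simp_all add: re_def vec_eq_iff)

lemma emb_add: "emb (x + y) = emb x + emb y" and emb_diff: "emb (x - y) = emb x - emb y"
  and emb_uminus: "emb (- x) = - emb x"
  by (simp_all add: emb_def vec_eq_iff)

lemma norm_re_le: "norm (re z) \<le> norm z"
  unfolding norm_vec_def re_def by (rule L2_set_mono) (auto simp: abs_Re_le_cmod)

lemma norm_emb: "norm (emb x) = norm x"
  by (simp add: norm_vec_def emb_def)

lemma inner_emb: "(c *s emb x) \<bullet> z = x \<bullet> re (cnj c *s z)"
  by (simp add: inner_vec_def emb_def re_def inner_complex_def algebra_simps)

lemma inner_unitary: 
  fixes x y :: "complex ^ 'n"
  assumes "cmod c = 1" shows "(c *s x) \<bullet> (c *s y) = x \<bullet> y"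
proof -
  have "(Re c)\<^sup>2 + (Im c)\<^sup>2 = 1" using assms by (simp add: cmod_power2[symmetric])
  then have "(c * a) \<bullet> (c * b) = a \<bullet> b" for a b :: complex
  proof -
    have "(c * a) \<bullet> (c * b) = ((Re c)\<^sup>2 + (Im c)\<^sup>2) * (a \<bullet> b)"
      by (simp add: inner_complex_def power2_eq_square algebra_simps)
    then show ?thesis using \<open>(Re c)\<^sup>2 + (Im c)\<^sup>2 = 1\<close> by simp
  qed
  then show ?thesis by (simp add: inner_vec_def)
qed

lemma smult_smult: "c *s (c' *s x) = (c * c') *s (x :: complex ^ 'n)"
  by (simp add: vec_eq_iff mult.assoc)

text \<open>Multiplication by \<open>cnj om\<close> permutes the arguments of \<open>f\<close> up to a sign,
  which oddness absorbs.\<close>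

lemma F_equivariant:
  assumes odd: "\<And>x. f (- x) = - f x"
  shows "F f (cnj om *s z) = cnj om *s F f z"
proof -
  have "re ((- om) *s z) = - re (om *s z)" by (simp add: re_def vec_eq_iff)
  then have "F f (cnj om *s z) = emb (f (re (cnj om *s z))) + cnj om *s emb (f (re z))
      - om *s emb (f (re (om *s z)))"
    unfolding F_def smult_smult om_cnj om_square by (simp add: odd emb_uminus)
  moreover have "cnj om *s F f z = cnj om *s emb (f (re z)) + (cnj om * cnj om) *s emb (f (re (om *s z)))
      + (cnj om * om) *s emb (f (re (cnj om *s z)))"
    unfolding F_def by (simp add: vector_add_ldistrib)
  ultimately show ?thesis by (simp add: om_cnj om_square vec_eq_iff)
qed

lemma F_add: "F (\<lambda>x. f x + g x) z = F f z + F g z"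
  by (simp add: F_def emb_add vector_add_ldistrib)

lemma F_bound:
  assumes "\<And>u. cmod u = 1 \<Longrightarrow> norm (f (re (u *s z))) \<le> B"
  shows "norm (F f z) \<le> 3 * B"
proof -
  have "norm (F f z) \<le> norm (emb (f (re z))) + norm (cnj om *s emb (f (re (om *s z))))
      + norm (om *s emb (f (re (cnj om *s z))))"
    unfolding F_def by (intro order_trans[OF norm_triangle_ineq] add_mono order_refl norm_triangle_ineq)
  also have "\<dots> = norm (f (re (1 *s z))) + norm (f (re (om *s z))) + norm (f (re (cnj om *s z)))"
    by (simp add: norm_vector_scalar_mult norm_emb)
  also have "\<dots> \<le> B + B + B"
    by (intro add_mono assms) simp_all
  finally show ?thesis by simp
qed

lemma F_diff_bound:
  assumes "\<And>u. cmod u = 1 \<Longrightarrow> norm (f (re (u *s z)) - g (re (u *s z'))) \<le> B"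
  shows "norm (F f z - F g z') \<le> 3 * B"
proof -
  have "F f z - F g z' = emb (f (re (1 *s z)) - g (re (1 *s z')))
      + cnj om *s emb (f (re (om *s z)) - g (re (om *s z')))
      + om *s emb (f (re (cnj om *s z)) - g (re (cnj om *s z')))"
    by (simp add: F_def emb_diff vector_ssub_ldistrib)
  also have "norm \<dots> \<le> norm (emb (f (re (1 *s z)) - g (re (1 *s z'))))
      + norm (cnj om *s emb (f (re (om *s z)) - g (re (om *s z'))))
      + norm (om *s emb (f (re (cnj om *s z)) - g (re (cnj om *s z'))))"
    by (intro order_trans[OF norm_triangle_ineq] add_mono order_refl norm_triangle_ineq)
  also have "\<dots> \<le> B + B + B"
    unfolding norm_vector_scalar_mult norm_emb cmod_om mult_1 by (intro add_mono assms) simp_all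
  finally show ?thesis by simp
qed

text \<open>The part conjugate to \<open>a\<close> cancels because \<open>1 + om\<^sup>2 + (cnj om)\<^sup>2
  = 0\<close>.\<close>

lemma om_average: "of_real (Re a) + cnj om * of_real (Re (om * a)) + om * of_real (Re (cnj om * a)) = (3 / 2) * a"
  using real_sqrt_mult_self[of 3]
  by (simp add: complex_eq_iff om_parts field_simps del: cis.sel)

context resonance
begin

definition D :: "real ^ 'n \<Rightarrow> real ^ 'n" where "D x = (\<chi> j. d j * x $ j)"

definition iW :: "complex ^ 'n \<Rightarrow> complex ^ 'n" where "iW z = (\<chi> j. \<i> * of_real (w j) * z $ j)"

text \<open>The Hamiltonian vector field minus its diagonal linear part \<open>iW\<close>, see
  \<open>N_eq\<close> below.\<close>

definition N :: "(real ^ 'n \<Rightarrow> real ^ 'n) \<Rightarrow> complex ^ 'n \<Rightarrow> complex ^ 'n" where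
  "N f z = (\<i> * of_real (2 / sqrt 3)) *s F (\<lambda>x. f x - D x) z"

text \<open>On linear maps \<open>F\<close> is complex linear, although \<open>re\<close> is not: the
  conjugate parts average out.\<close>

lemma F_D: "F D z = (3 / 2) *s (\<chi> j. of_real (d j) * z $ j)"
proof (rule vec_eq_iff[THEN iffD2], rule allI)
  fix j
  have "F D z $ j = of_real (d j) * (of_real (Re (z $ j)) + cnj om * of_real (Re (om * z $ j))
      + om * of_real (Re (cnj om * z $ j)))"
    by (simp add: F_def emb_def D_def re_def algebra_simps)
  also note om_average
  finally show "F D z $ j = ((3 / 2) *s (\<chi> j. of_real (d j) * z $ j)) $ j" by simp
qed

lemma N_eq: "N f z = (\<i> * of_real (2 / sqrt 3)) *s F f z - iW z"
proof -
  have "F f z = F (\<lambda>x. f x - D x) z + F D z" by (simp flip: F_add)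
  moreover have "(\<i> * of_real (2 / sqrt 3)) *s F D z = iW z"
  proof -
    have "2 / sqrt 3 * (3 / 2) = sqrt 3" by (simp add: real_div_sqrt)
    then have "of_real (2 / sqrt 3) * (3 / 2) = complex_of_real (sqrt 3)"
      by (metis of_real_divide of_real_mult of_real_numeral)
    then show ?thesis
      by (simp add: F_D iW_def vec_eq_iff w_def mult.assoc[symmetric] del: of_real_divide)
  qed
  ultimately show ?thesis by (simp add: N_def vector_add_ldistrib)
qed

lemma iW_diff: "iW (x - y) = iW x - iW y"
  by (simp add: iW_def vec_eq_iff algebra_simps)

lemma iW_bound: "norm (iW z) \<le> real CARD('n) * ((\<Sum>j\<in>UNIV. \<bar>w j\<bar>) * norm z)"
proof (rule norm_le_card_mult)
  fix j
  have "\<bar>w j\<bar> * cmod (z $ j) \<le> (\<Sum>j\<in>UNIV. \<bar>w j\<bar>) * norm z"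
    by (intro mult_mono member_le_sum Finite_Cartesian_Product.norm_nth_le sum_nonneg) auto
  then show "cmod (iW z $ j) \<le> (\<Sum>j\<in>UNIV. \<bar>w j\<bar>) * norm z" by (simp add: iW_def norm_mult)
qed

lemma D_bound: "norm (D x) \<le> (\<Sum>j\<in>UNIV. \<bar>d j\<bar>) * norm x"
proof -
  have "norm (D x) \<le> (\<Sum>j\<in>UNIV. norm (D x $ j))" unfolding norm_vec_def by (rule L2_set_le_sum) simp
  also have "\<dots> \<le> (\<Sum>j\<in>UNIV. \<bar>d j\<bar> * norm x)"
    by (rule sum_mono)
      (simp add: D_def abs_mult mult_left_mono component_le_norm_cart)
  finally show ?thesis by (simp add: sum_distrib_right)
qed

lemma D_diff: "D (x - y) = D x - D y"
  by (simp add: D_def vec_eq_iff algebra_simps)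

text \<open>The smallness of \<open>\<epsilon>\<close> expresses that the gradient is taken at a parameter
  near the one where the Hessian is \<open>D\<close>, and at points near zero.\<close>

definition near_diagonal :: "real \<Rightarrow> real \<Rightarrow> (real ^ 'n \<Rightarrow> real ^ 'n) \<Rightarrow> bool" where
  "near_diagonal R \<epsilon> f \<longleftrightarrow> (\<forall>x. f (- x) = - f x) \<and>
     (\<forall>x y. norm x \<le> R \<longrightarrow> norm y \<le> R \<longrightarrow> norm ((f x - D x) - (f y - D y)) \<le> \<epsilon> * norm (x - y))"

lemma two_div_sqrt3: "2 / sqrt 3 \<ge> 0" "3 * (2 / sqrt 3) \<le> 4" "2 / sqrt 3 \<le> 2"
proof -
  have "3 / 2 \<le> sqrt 3" by (rule real_le_rsqrt) (simp add: power2_eq_square)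
  then show "3 * (2 / sqrt 3) \<le> 4" by (simp add: field_simps)
  then show "2 / sqrt 3 \<le> 2" by linarith
qed simp

lemma norm_rotation_factor: "cmod (\<i> * of_real (2 / sqrt 3)) = 2 / sqrt 3"
  by (simp add: norm_mult norm_divide)

text \<open>The factor 4 is a convenient bound for \<open>3 * (2 / sqrt 3)\<close>: three arguments of
  \<open>f\<close> and the constant of the vector field.\<close>

lemma N_close:
  assumes f: "near_diagonal R \<epsilon> f" and e: "\<epsilon> \<ge> 0"
    and z: "norm z \<le> R" "norm z' \<le> R" and g: "\<And>x. norm x \<le> R \<Longrightarrow> norm (f x - g x) \<le> \<delta>"
  shows "norm (N f z - N g z') \<le> 4 * (\<epsilon> * norm (z - z') + \<delta>)"
proof -
  have d0: "\<delta> \<ge> 0" using g[of "re z"] norm_re_le[of z] z by (meson norm_ge_zero order_trans)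
  have "norm (F (\<lambda>x. f x - D x) z - F (\<lambda>x. g x - D x) z') \<le> 3 * (\<epsilon> * norm (z - z') + \<delta>)"
  proof (rule F_diff_bound)
    fix u :: complex assume u: "cmod u = 1"
    have r: "norm (re (u *s z)) \<le> R" "norm (re (u *s z')) \<le> R"
      using norm_re_le[of "u *s z"] norm_re_le[of "u *s z'"] z u by (simp_all add: norm_vector_scalar_mult)
    have "norm (re (u *s z) - re (u *s z')) \<le> norm (z - z')"
    proof -
      have "re (u *s z) - re (u *s z') = re (u *s (z - z'))" by (simp add: re_diff vector_ssub_ldistrib)
      also have "norm \<dots> \<le> norm (u *s (z - z'))" by (rule norm_re_le)
      finally show ?thesis by (simp only: norm_vector_scalar_mult u mult_1)
    qed
    then have "\<epsilon> * norm (re (u *s z) - re (u *s z')) \<le> \<epsilon> * norm (z - z')"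
      using e by (rule mult_left_mono)
    then have "norm ((f (re (u *s z)) - D (re (u *s z))) - (f (re (u *s z')) - D (re (u *s z'))))
        \<le> \<epsilon> * norm (z - z')"
      using f r unfolding near_diagonal_def by (meson order_trans)
    from norm_triangle_le[OF add_mono[OF this g[OF r(2)]]]
    show "norm (f (re (u *s z)) - D (re (u *s z)) - (g (re (u *s z')) - D (re (u *s z'))))
        \<le> \<epsilon> * norm (z - z') + \<delta>" by (simp add: algebra_simps)
  qed
  then have "(2 / sqrt 3) * norm (F (\<lambda>x. f x - D x) z - F (\<lambda>x. g x - D x) z')
      \<le> (2 / sqrt 3) * (3 * (\<epsilon> * norm (z - z') + \<delta>))"
    using two_div_sqrt3(1) by (rule mult_left_mono)
  also have "\<dots> = (3 * (2 / sqrt 3)) * (\<epsilon> * norm (z - z') + \<delta>)" by simp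
  also have "\<dots> \<le> 4 * (\<epsilon> * norm (z - z') + \<delta>)"
    using two_div_sqrt3(2) e d0 by (intro mult_right_mono) auto
  finally show ?thesis
    unfolding N_def vector_ssub_ldistrib[symmetric] norm_vector_scalar_mult norm_rotation_factor .
qed

lemma near_diagonal_0: "near_diagonal R \<epsilon> f \<Longrightarrow> f 0 = 0"
proof -
  assume "near_diagonal R \<epsilon> f"
  then have "f (- 0) = - f 0" unfolding near_diagonal_def by blast
  then show ?thesis by (simp add: vec_eq_iff)
qed

lemma N_0: "near_diagonal R \<epsilon> f \<Longrightarrow> N f 0 = 0"
  using near_diagonal_0[of R \<epsilon> f]
  by (simp add: N_def F_def re_def D_def emb_def vec_eq_iff zero_vec_def[symmetric])

lemma twisted_N:
  assumes f: "near_diagonal R \<epsilon> f" and e: "\<epsilon> \<ge> 0" and z: "twisted z" "\<And>t. norm (z t) \<le> R"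
  shows "twisted (\<lambda>t. N f (z t))"
  unfolding twisted_def
proof (intro conjI allI)
  have "(4 * \<epsilon>)-lipschitz_on (cball 0 R) (N f)"
    by (rule lipschitz_onI)
      (use N_close[OF f e, of _ _ f 0] e in \<open>auto simp: dist_norm algebra_simps\<close>)
  then have "continuous_on (cball 0 R) (N f)" by (rule lipschitz_on_continuous_on)
  then show "continuous_on UNIV (\<lambda>t. N f (z t))"
    by (rule continuous_on_compose2) (use z twistedD(1) in auto)
  fix t
  have "F (\<lambda>x. f x - D x) (cnj om *s z t) = cnj om *s F (\<lambda>x. f x - D x) (z t)"
    by (rule F_equivariant) (use f in \<open>auto simp: near_diagonal_def D_def vec_eq_iff\<close>)
  then show "N f (z (t + \<tau>)) = cnj om *s N f (z t)"
    by (simp add: twistedD(2)[OF z(1)] N_def smult_smult mult.commute)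
qed

text \<open>The equation for the part of \<open>z\<close> off the resonant modes, whose resonant amplitude
  \<open>v\<close> is prescribed.\<close>

definition reduced :: "real \<Rightarrow> (real ^ 'n \<Rightarrow> real ^ 'n) \<Rightarrow> complex ^ 'n \<Rightarrow> (real \<Rightarrow> complex ^ 'n) \<Rightarrow> bool" where
  "reduced R f v z \<longleftrightarrow> twisted z \<and> (\<forall>t. norm (z t) \<le> R) \<and> (\<forall>t. z t = E v t + G (\<lambda>s. N f (z s)) t)"

text \<open>The map \<open>G\<close> after \<open>N f\<close> contracts by the factor 1/2, so the largest
  distance \<open>B\<close> of the two curves satisfies \<open>B \<le> a + B / 2\<close>. Comparing two
  nonlinearities at once gives uniqueness, the Lipschitz dependence on \<open>v\<close> and the continuous
  dependence on the parameter.\<close>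

lemma reduced_close:
  assumes f: "near_diagonal R \<epsilon> f" and g: "near_diagonal R \<epsilon> g" and e: "\<epsilon> \<ge> 0" "8 * \<epsilon> * green_bound \<le> 1"
    and z: "reduced R f v z" and z': "reduced R g v' z'" 
    and fg: "\<And>x. norm x \<le> R \<Longrightarrow> norm (f x - g x) \<le> \<delta>"
  shows "norm (z t - z' t) \<le> 2 * (norm (v - v') + 4 * \<delta> * green_bound)"
proof -
  define B where "B = (SUP t. norm (z t - z' t))"
  have tw: "twisted z" "twisted z'" and R: "\<And>t. norm (z t) \<le> R" "\<And>t. norm (z' t) \<le> R"
    and eq: "\<And>t. z t = E v t + G (\<lambda>s. N f (z s)) t" "\<And>t. z' t = E v' t + G (\<lambda>s. N g (z' s)) t"
    using z z' unfolding reduced_def by blast+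
  have "norm (z t - z' t) \<le> 2 * R" for t
    using norm_triangle_ineq4[of "z t" "z' t"] R(1)[of t] R(2)[of t] by linarith
  then have bdd: "bdd_above (range (\<lambda>t. norm (z t - z' t)))" by (intro bdd_aboveI2)
  have le: "norm (z t - z' t) \<le> B" for t unfolding B_def by (rule cSUP_upper[OF _ bdd]) simp
  have tN: "twisted (\<lambda>t. N f (z t))" "twisted (\<lambda>t. N g (z' t))"
    by (rule twisted_N[OF f e(1) tw(1) R(1)], rule twisted_N[OF g e(1) tw(2) R(2)])
  have "norm (N f (z t) - N g (z' t)) \<le> 4 * (\<epsilon> * B + \<delta>)" for t
  proof -
    have "norm (N f (z t) - N g (z' t)) \<le> 4 * (\<epsilon> * norm (z t - z' t) + \<delta>)"
      by (rule N_close[OF f e(1) R(1) R(2) fg])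
    also have "\<dots> \<le> 4 * (\<epsilon> * B + \<delta>)" using le[of t] e(1) by (simp add: mult_left_mono)
    finally show ?thesis .
  qed
  from G_bound[OF twisted_diff[OF tN] this]
  have Gb: "norm (G (\<lambda>s. N f (z s)) t - G (\<lambda>s. N g (z' s)) t) \<le> green_bound * (4 * (\<epsilon> * B + \<delta>))" for t
    by (simp add: G_diff[OF tN])
  have B0: "0 \<le> B" using le[of 0] norm_ge_zero order_trans by blast
  have "norm (z t - z' t) \<le> norm (v - v') + 4 * \<delta> * green_bound + B / 2" for t
  proof -
    have "z t - z' t = E (v - v') t + (G (\<lambda>s. N f (z s)) t - G (\<lambda>s. N g (z' s)) t)"
      using eq(1)[of t] eq(2)[of t] by (simp add: E_diff)
    then have "norm (z t - z' t) \<le> norm (v - v') + green_bound * (4 * (\<epsilon> * B + \<delta>))"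
      using norm_triangle_le[OF add_mono[OF order_refl Gb[of t]], of "E (v - v') t"] by (simp add: norm_E)
    moreover have "(8 * \<epsilon> * green_bound) * B \<le> 1 * B" using e(2) B0 by (rule mult_right_mono)
    ultimately show ?thesis by (simp add: algebra_simps)
  qed
  then have "B \<le> norm (v - v') + 4 * \<delta> * green_bound + B / 2"
    unfolding B_def by (intro cSUP_least) auto
  then show ?thesis using le[of t] by simp
qed

lemma reduced_zero: "near_diagonal R \<epsilon> f \<Longrightarrow> R \<ge> 0 \<Longrightarrow> reduced R f 0 (\<lambda>_. 0)"
  by (auto simp: reduced_def twisted_def vec_eq_iff N_0 E_def G_def)

lemma reduced_bound:
  assumes f: "near_diagonal R \<epsilon> f" and e: "\<epsilon> \<ge> 0" "8 * \<epsilon> * green_bound \<le> 1" and R: "R \<ge> 0"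
    and z: "reduced R f v z"
  shows "norm (z t) \<le> 2 * norm v"
  using reduced_close[OF f f e z reduced_zero[OF f R], of 0 t] by simp

text \<open>Banach's fixed point theorem for bounded continuous functions, on the closed set of twisted
  functions bounded by \<open>R\<close>. The prescribed mode contributes at most \<open>R / 2\<close> and
  the contraction at most another \<open>R / 2\<close>.\<close>

lemma reduced_exists:
  assumes f: "near_diagonal R \<epsilon> f" and e: "\<epsilon> \<ge> 0" "8 * \<epsilon> * green_bound \<le> 1"
    and v: "v \<in> K" "norm v \<le> R / 2"
  shows "\<exists>z. reduced R f v z"
proof -
  have R: "R \<ge> 0" using v(2) norm_ge_zero[of v] by linarith
  define S where "S = {b :: real \<Rightarrow>\<^sub>C (complex ^ 'n). twisted (apply_bcontfun b) \<and> (\<forall>t. norm (apply_bcontfun b t) \<le> R)}"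
  have "closed S"
  proof -
    have "S = (\<Inter>t. {b. apply_bcontfun b (t + \<tau>) = cnj om *s apply_bcontfun b t})
        \<inter> (\<Inter>t. {b. norm (apply_bcontfun b t) \<le> R})"
      by (auto simp: S_def twisted_def)
    moreover have ev: "continuous_on UNIV (\<lambda>b :: real \<Rightarrow>\<^sub>C (complex ^ 'n). apply_bcontfun b t)" for t
      by (rule lipschitz_on_continuous_on[of 1]) (auto intro!: lipschitz_onI simp: dist_bounded)
    have "continuous_on UNIV (\<lambda>b :: real \<Rightarrow>\<^sub>C (complex ^ 'n). cnj om *s apply_bcontfun b t)" for t
      unfolding vector_scalar_mult_def
      by (intro continuous_intros ev)
    ultimately show ?thesis
      by (auto intro!: closed_INT closed_Int closed_Collect_eq closed_Collect_le continuous_intros ev)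
  qed
  define T where "T b = Bcontfun (\<lambda>t. E v t + G (\<lambda>s. N f (apply_bcontfun b s)) t)"
    for b :: "real \<Rightarrow>\<^sub>C (complex ^ 'n)"
  have tN: "twisted (\<lambda>s. N f (apply_bcontfun b s))" if "b \<in> S" for b
    by (rule twisted_N[OF f e(1)]) (use that in \<open>auto simp: S_def\<close>)
  have tT: "twisted (\<lambda>t. E v t + G (\<lambda>s. N f (apply_bcontfun b s)) t)" if "b \<in> S" for b
    by (intro twisted_add twisted_E v twisted_G tN that)
  have bd: "norm (E v t + G (\<lambda>s. N f (apply_bcontfun b s)) t) \<le> R" if b: "b \<in> S" for b t
  proof -
    have "norm (N f (apply_bcontfun b s)) \<le> 4 * (\<epsilon> * R)" for s
    proof -
      have bR: "norm (apply_bcontfun b s) \<le> R" using b by (auto simp: S_def)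
      then have "\<epsilon> * norm (apply_bcontfun b s) \<le> \<epsilon> * R" using e(1) by (rule mult_left_mono)
      then show ?thesis
        using N_close[OF f e(1) bR, of 0 f 0] R by (simp add: N_0[OF f])
    qed
    from G_bound[OF tN[OF b] this]
    have "norm (G (\<lambda>s. N f (apply_bcontfun b s)) t) \<le> (8 * \<epsilon> * green_bound) * (R / 2)"
      by (simp add: algebra_simps)
    also have "\<dots> \<le> 1 * (R / 2)" using e(2) R by (intro mult_right_mono) auto
    finally show ?thesis
      using v(2) by (intro norm_triangle_le) (simp add: norm_E)
  qed
  have app: "apply_bcontfun (T b) t = E v t + G (\<lambda>s. N f (apply_bcontfun b s)) t" if b: "b \<in> S" for b t
    unfolding T_def
    by (subst Bcontfun_inverse) (use tT[OF b] bd[OF b] in \<open>auto simp: twisted_def intro!: bcontfun_normI\<close>)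
  have "\<exists>!b\<in>S. T b = b"
  proof (rule Banach_fix[of _ "1 / 2"])
    show "complete S" using \<open>closed S\<close> by (simp add: complete_eq_closed)
    have "apply_bcontfun (0 :: real \<Rightarrow>\<^sub>C (complex ^ 'n)) t = 0" for t by simp
    then have "0 \<in> S" using R by (auto simp: S_def twisted_def vec_eq_iff)
    then show "S \<noteq> {}" by blast
    show "T ` S \<subseteq> S"
    proof (intro image_subsetI)
      fix b assume "b \<in> S"
      then have "apply_bcontfun (T b) = (\<lambda>t. E v t + G (\<lambda>s. N f (apply_bcontfun b s)) t)"
        using app by blast
      then show "T b \<in> S" using tT[OF \<open>b \<in> S\<close>] bd[OF \<open>b \<in> S\<close>] by (simp add: S_def)
    qed
    fix b b' assume b: "b \<in> S" "b' \<in> S"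
    have "norm (N f (apply_bcontfun b s) - N f (apply_bcontfun b' s)) \<le> 4 * (\<epsilon> * dist b b')" for s
    proof -
      have "norm (apply_bcontfun b s - apply_bcontfun b' s) \<le> dist b b'"
        using dist_bounded[of b s b'] by (simp add: dist_norm)
      then have "\<epsilon> * norm (apply_bcontfun b s - apply_bcontfun b' s) \<le> \<epsilon> * dist b b'"
        using e(1) by (rule mult_left_mono)
      moreover have "norm (apply_bcontfun b s) \<le> R" "norm (apply_bcontfun b' s) \<le> R"
        using b by (auto simp: S_def)
      ultimately show ?thesis
        using N_close[OF f e(1), of "apply_bcontfun b s" "apply_bcontfun b' s" f 0] by simp
    qed
    from G_bound[OF twisted_diff[OF tN[OF b(1)] tN[OF b(2)]] this]
    have "norm (G (\<lambda>s. N f (apply_bcontfun b s)) t - G (\<lambda>s. N f (apply_bcontfun b' s)) t)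
        \<le> (8 * \<epsilon> * green_bound) * (dist b b' / 2)" for t
      by (simp add: G_diff[OF tN[OF b(1)] tN[OF b(2)]] algebra_simps)
    also have "(8 * \<epsilon> * green_bound) * (dist b b' / 2) \<le> 1 * (dist b b' / 2)"
      using e(2) by (intro mult_right_mono) auto
    finally show "dist (T b) (T b') \<le> 1 / 2 * dist b b'"
      by (intro dist_bound) (simp add: app b dist_norm)
  qed auto
  then obtain b where b: "b \<in> S" "T b = b" by blast
  have "reduced R f v (apply_bcontfun b)"
    unfolding reduced_def using b(1) app[OF b(1), unfolded b(2)] unfolding S_def by blast
  then show ?thesis by blast
qed

end

section \<open>The reduced functional and its gradient\<close>

lemma bounded_linear_smult: "bounded_linear (\<lambda>x :: complex ^ 'n. c *s x)"
  unfolding linear_conv_bounded_linear[symmetric]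
  by (rule linearI) (simp_all add: vec_eq_iff algebra_simps)

lemma bounded_linear_re: "bounded_linear re"
  unfolding linear_conv_bounded_linear[symmetric]
  by (rule linearI) (simp_all add: re_def vec_eq_iff)

lemma continuous_on_smult: "continuous_on S z \<Longrightarrow> continuous_on S (\<lambda>t. c *s (z t :: complex ^ 'n))"
  using bounded_linear.continuous_on[OF bounded_linear_smult] .

lemma continuous_on_re: "continuous_on S z \<Longrightarrow> continuous_on S (\<lambda>t. re (z t))"
  using bounded_linear.continuous_on[OF bounded_linear_re] .

lemma mi_inner_swap: "((- \<i>) *s x) \<bullet> y = - (((- \<i>) *s y) \<bullet> (x :: complex ^ 'n))"
  by (simp add: inner_vec_def inner_complex_def sum_negf[symmetric] algebra_simps del: sum_negf)

context resonance begin

lemma E_smult: "c *s E v t = E (c *s v) t"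
  by (simp add: E_def vec_eq_iff algebra_simps)

lemma continuous_on_iW: "continuous_on S z \<Longrightarrow> continuous_on S (\<lambda>t. iW (z t))"
  unfolding iW_def by (intro continuous_intros)

definition lip :: "real \<Rightarrow> real" where "lip \<epsilon> = (\<Sum>j\<in>UNIV. \<bar>d j\<bar>) + \<epsilon>"

text \<open>A bound for the quadratic remainder of the action. It depends on the nonlinearity only through
  \<open>\<epsilon>\<close>, hence it is common to all parameters near the given one.\<close>

definition curvature_bound :: "real \<Rightarrow> real" where
  "curvature_bound \<epsilon> =
     2 * (real CARD('n) * (\<Sum>j\<in>UNIV. \<bar>w j\<bar>) + 4 * \<epsilon> + real CARD('n) * (4 * \<epsilon>)) + 24 * lip \<epsilon> + 1"

lemma lip_nonneg: "\<epsilon> \<ge> 0 \<Longrightarrow> lip \<epsilon> \<ge> 0"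
  by (simp add: lip_def sum_nonneg)

lemma curvature_bound_pos: "\<epsilon> \<ge> 0 \<Longrightarrow> curvature_bound \<epsilon> > 0"
  using lip_nonneg[of \<epsilon>] by (auto simp: curvature_bound_def intro!: add_nonneg_pos add_nonneg_nonneg mult_nonneg_nonneg sum_nonneg)

lemma near_diagonal_lipschitz:
  assumes "near_diagonal R \<epsilon> f" "norm x \<le> R" "norm y \<le> R"
  shows "norm (f x - f y) \<le> lip \<epsilon> * norm (x - y)"
proof -
  have "norm ((f x - D x) - (f y - D y)) \<le> \<epsilon> * norm (x - y)"
    using assms by (auto simp: near_diagonal_def)
  from norm_triangle_le[OF add_mono[OF this D_bound[of "x - y"]]]
  show ?thesis by (simp add: lip_def D_diff algebra_simps)
qed

lemma potential_increment:
  assumes f: "near_diagonal R \<epsilon> f" and e: "\<epsilon> \<ge> 0" and V: "\<And>x. GDERIV V x :> f x"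
    and x: "norm x \<le> R" "norm y \<le> R"
  shows "\<bar>V y - V x - f x \<bullet> (y - x)\<bar> \<le> lip \<epsilon> * (norm (y - x))\<^sup>2"
proof -
  have der: "((\<lambda>s. V (x + s *\<^sub>R (y - x))) has_derivative (\<lambda>h. (h *\<^sub>R (y - x)) \<bullet> f (x + s *\<^sub>R (y - x))))
      (at s within {0..1})" for s
  proof -
    have "((\<lambda>s. x + s *\<^sub>R (y - x)) has_derivative (\<lambda>h. h *\<^sub>R (y - x))) (at s within {0..1})"
      by (auto intro!: derivative_eq_intros)
    moreover have "(V has_derivative (\<lambda>h. h \<bullet> f (x + s *\<^sub>R (y - x)))) (at (x + s *\<^sub>R (y - x)))"
      using V by (simp add: gderiv_def)
    ultimately show ?thesis by (rule has_derivative_compose)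
  qed
  obtain s where s: "s \<in> {0<..<1::real}" and "V (x + 1 *\<^sub>R (y - x)) - V (x + 0 *\<^sub>R (y - x))
      = ((1 - 0) *\<^sub>R (y - x)) \<bullet> f (x + s *\<^sub>R (y - x))"
    using mvt_simple[OF zero_less_one der] by blast
  then have "V y - V x - f x \<bullet> (y - x) = (f (x + s *\<^sub>R (y - x)) - f x) \<bullet> (y - x)"
    by (simp add: inner_diff_left inner_diff_right inner_commute algebra_simps)
  also have "\<bar>\<dots>\<bar> \<le> norm (f (x + s *\<^sub>R (y - x)) - f x) * norm (y - x)" by (rule Cauchy_Schwarz_ineq2)
  also have "\<dots> \<le> (lip \<epsilon> * norm (y - x)) * norm (y - x)"
  proof (rule mult_right_mono)
    have "x + s *\<^sub>R (y - x) = (1 - s) *\<^sub>R x + s *\<^sub>R y" by (simp add: algebra_simps)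
    moreover have "norm ((1 - s) *\<^sub>R x + s *\<^sub>R y) \<le> (1 - s) * R + s * R"
      using s x by (intro norm_triangle_le add_mono) (auto intro: mult_left_mono)
    ultimately have "norm (x + s *\<^sub>R (y - x)) \<le> R" by (simp add: algebra_simps)
    from near_diagonal_lipschitz[OF f this x(1)]
    have "norm (f (x + s *\<^sub>R (y - x)) - f x) \<le> lip \<epsilon> * (s * norm (y - x))" using s by simp
    also have "\<dots> \<le> lip \<epsilon> * norm (y - x)"
      using s lip_nonneg[OF e] by (intro mult_left_mono mult_left_le_one_le) auto
    finally show "norm (f (x + s *\<^sub>R (y - x)) - f x) \<le> lip \<epsilon> * norm (y - x)" .
  qed simp
  finally show ?thesis by (simp add: power2_eq_square)
qed

text \<open>The remainder of \<open>V\<close> at the three arguments, using that \<open>F f\<close> is the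
  gradient of \<open>H V\<close>.\<close>

lemma H_increment:
  assumes f: "near_diagonal R \<epsilon> f" and e: "\<epsilon> \<ge> 0" and V: "\<And>x. GDERIV V x :> f x"
    and z: "norm z \<le> R" "norm z' \<le> R"
  shows "\<bar>H V z' - H V z - F f z \<bullet> (z' - z)\<bar> \<le> 3 * (lip \<epsilon> * (norm (z' - z))\<^sup>2)"
proof -
  have b: "\<bar>V (re (u *s z')) - V (re (u *s z)) - f (re (u *s z)) \<bullet> re (u *s (z' - z))\<bar>
      \<le> lip \<epsilon> * (norm (z' - z))\<^sup>2" if u: "cmod u = 1" for u
  proof -
    have le: "norm (re (u *s a)) \<le> norm a" for a :: "complex ^ 'n"
      using norm_re_le[of "u *s a"] by (simp add: norm_vector_scalar_mult u)
    have "\<bar>V (re (u *s z')) - V (re (u *s z)) - f (re (u *s z)) \<bullet> (re (u *s z') - re (u *s z))\<bar>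
      \<le> lip \<epsilon> * (norm (re (u *s z') - re (u *s z)))\<^sup>2"
      by (rule potential_increment[OF f e V order_trans[OF le z(1)] order_trans[OF le z(2)]])
    also have "\<dots> \<le> lip \<epsilon> * (norm (z' - z))\<^sup>2"
      using le[of "z' - z"] lip_nonneg[OF e]
      by (intro mult_left_mono power_mono) (simp_all add: re_diff vector_ssub_ldistrib)
    finally show ?thesis by (simp add: re_diff vector_ssub_ldistrib)
  qed
  have "F f z \<bullet> (z' - z) = f (re (1 *s z)) \<bullet> re (1 *s (z' - z)) + f (re (om *s z)) \<bullet> re (om *s (z' - z))
      + f (re (cnj om *s z)) \<bullet> re (cnj om *s (z' - z))"
    using inner_emb[of 1 "f (re z)"] by (simp add: F_def inner_add_left inner_emb del: cis_cnj)
  then have "H V z' - H V z - F f z \<bullet> (z' - z)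
     = (V (re (1 *s z')) - V (re (1 *s z)) - f (re (1 *s z)) \<bullet> re (1 *s (z' - z)))
     + (V (re (om *s z')) - V (re (om *s z)) - f (re (om *s z)) \<bullet> re (om *s (z' - z)))
     + (V (re (cnj om *s z')) - V (re (cnj om *s z)) - f (re (cnj om *s z)) \<bullet> re (cnj om *s (z' - z)))"
    by (simp add: H_def)
  then show ?thesis using b[of 1] b[of om] b[of "cnj om"] cmod_om by (simp add: abs_le_iff)
qed

lemma reduced_P_N_close:
  assumes f: "near_diagonal R \<epsilon> f" and g: "near_diagonal R \<epsilon> g" and e: "\<epsilon> \<ge> 0" "8 * \<epsilon> * green_bound \<le> 1"
    and z: "reduced R f v z" and z': "reduced R g v' z'"
    and fg: "\<And>x. norm x \<le> R \<Longrightarrow> norm (f x - g x) \<le> \<delta>"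
  shows "norm (P (\<lambda>t. N f (z t)) - P (\<lambda>t. N g (z' t)))
    \<le> real CARD('n) * (4 * (\<epsilon> * (2 * (norm (v - v') + 4 * \<delta> * green_bound)) + \<delta>))"
proof -
  have tw: "twisted z" "twisted z'" and R: "\<And>t. norm (z t) \<le> R" "\<And>t. norm (z' t) \<le> R"
    using z z' unfolding reduced_def by blast+
  have tN: "twisted (\<lambda>t. N f (z t))" "twisted (\<lambda>t. N g (z' t))"
    by (rule twisted_N[OF f e(1) tw(1) R(1)], rule twisted_N[OF g e(1) tw(2) R(2)])
  have "norm (N f (z t) - N g (z' t)) \<le> 4 * (\<epsilon> * (2 * (norm (v - v') + 4 * \<delta> * green_bound)) + \<delta>)" for t
  proof -
    have "norm (N f (z t) - N g (z' t)) \<le> 4 * (\<epsilon> * norm (z t - z' t) + \<delta>)"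
      by (rule N_close[OF f e(1) R(1) R(2) fg])
    moreover have "norm (z t - z' t) \<le> 2 * (norm (v - v') + 4 * \<delta> * green_bound)"
      by (rule reduced_close[OF f g e z z' fg])
    ultimately show ?thesis using mult_left_mono[OF _ e(1)] by fastforce
  qed
  from P_bound[OF twisted_diff[OF tN] this] show ?thesis by (simp add: P_diff[OF tN])
qed

end

text \<open>The reduction for one nonlinearity \<open>f\<close>; the bound on \<open>\<epsilon>\<close>
  makes the reduced equation a contraction.\<close>

locale nonlinearity = resonance \<tau> d for \<tau> and d :: "'n::finite \<Rightarrow> real" +
  fixes R \<epsilon> :: real and f :: "real ^ 'n \<Rightarrow> real ^ 'n" and V :: "real ^ 'n \<Rightarrow> real"
  assumes R: "R > 0" and \<epsilon>: "\<epsilon> \<ge> 0" "8 * \<epsilon> * green_bound \<le> 1"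
    and near: "near_diagonal R \<epsilon> f" and V: "\<And>x. GDERIV V x :> f x"
begin

definition Z :: "complex ^ 'n \<Rightarrow> real \<Rightarrow> complex ^ 'n" where "Z v = (SOME z. reduced R f v z)"

text \<open>The resonant part of the nonlinearity along \<open>Z v\<close>, which is the obstruction to
  \<open>Z v\<close> being a solution. The factor \<open>\<i>\<close> makes it a gradient.\<close>

definition c :: "complex ^ 'n \<Rightarrow> complex ^ 'n" where "c v = \<i> *s P (\<lambda>t. N f (Z v t))"

text \<open>The time derivative of \<open>Z v\<close>, see \<open>Z_has_vector_derivative\<close>
  below.\<close>

definition Z' :: "complex ^ 'n \<Rightarrow> real \<Rightarrow> complex ^ 'n" where
  "Z' v t = iW (Z v t) + N f (Z v t) - E (P (\<lambda>t. N f (Z v t))) t"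

text \<open>The Hamiltonian action of \<open>Z v\<close>, averaged over a period.\<close>

definition \<phi> :: "complex ^ 'n \<Rightarrow> real" where
  "\<phi> v = integral {0..\<tau>} (\<lambda>t. (((- \<i>) *s Z' v t) \<bullet> Z v t) / 2 - 2 / sqrt 3 * H V (Z v t)) / \<tau>"

lemma c_in_K: "c v \<in> K" unfolding c_def by (intro smult_in_K P_in_K)

context
  fixes v assumes v: "v \<in> K" "norm v \<le> R / 2"
begin

lemma Z_reduced: "reduced R f v (Z v)"
  using someI_ex[OF reduced_exists[OF near \<epsilon> v]] by (simp add: Z_def)

lemma Z_twisted: "twisted (Z v)" and Z_R: "norm (Z v t) \<le> R"
  and Z_eq: "Z v t = E v t + G (\<lambda>s. N f (Z v s)) t"
  using Z_reduced unfolding reduced_def by blast+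

lemma NZ_twisted: "twisted (\<lambda>t. N f (Z v t))"
  by (rule twisted_N[OF near \<epsilon>(1) Z_twisted Z_R])

lemma Z_has_vector_derivative: "(Z v has_vector_derivative Z' v t) (at t)"
proof -
  have "((\<lambda>t. E v t + G (\<lambda>s. N f (Z v s)) t) has_vector_derivative
      iW (E v t) + (iW (G (\<lambda>s. N f (Z v s)) t) + N f (Z v t) - E (P (\<lambda>s. N f (Z v s))) t)) (at t)"
    unfolding iW_def
    by (rule has_vector_derivative_add[OF E_has_vector_derivative G_has_vector_derivative[OF NZ_twisted]])
  moreover have "(\<lambda>t. E v t + G (\<lambda>s. N f (Z v s)) t) = Z v" by (rule ext) (rule Z_eq[symmetric])
  moreover have "iW (E v t) + iW g = iW (E v t + g)" for g
    by (simp add: iW_def vec_eq_iff algebra_simps)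
  note iW_add = this
  have "iW (Z v t) = iW (E v t) + iW (G (\<lambda>s. N f (Z v s)) t)"
    by (subst Z_eq) (simp only: iW_add)
  then have "iW (E v t) + (iW (G (\<lambda>s. N f (Z v s)) t) + N f (Z v t) - E (P (\<lambda>s. N f (Z v s))) t) = Z' v t"
    by (simp add: Z'_def)
  ultimately show ?thesis by (simp only:)
qed

lemma P_Z: "P (Z v) = v"
proof -
  have "Z v = (\<lambda>t. E v t + G (\<lambda>s. N f (Z v s)) t)" by (rule ext) (rule Z_eq)
  from arg_cong[OF this, of P] have "P (Z v) = P (E v) + P (G (\<lambda>s. N f (Z v s)))"
    by (simp only: P_add[OF twisted_E[OF v(1)] twisted_G[OF NZ_twisted]])
  then show ?thesis by (simp add: P_E[OF v(1)] P_G[OF NZ_twisted])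
qed

lemma Z'_continuous: "continuous_on S (Z' v)"
proof -
  have "twisted (E (P (\<lambda>t. N f (Z v t))))" by (intro twisted_E P_in_K)
  then show ?thesis
    unfolding Z'_def[abs_def]
    by (intro continuous_intros continuous_on_iW twistedD(1)[OF Z_twisted] twistedD(1)[OF NZ_twisted]
        twistedD(1))
qed

lemma Z'_reduced_ode: "(- \<i>) *s Z' v t = complex_of_real (2 / sqrt 3) *s F f (Z v t) + E (c v) t"
  unfolding Z'_def N_eq c_def E_smult[symmetric]
  by (simp add: vec_eq_iff algebra_simps)

lemma Z'_zero_ode:
  assumes "c v = 0" shows "Z' v t = (\<i> * of_real (2 / sqrt 3)) *s F f (Z v t)"
proof -
  have "E 0 t = 0" by (simp add: E_def vec_eq_iff)
  then have "(- \<i>) *s Z' v t = complex_of_real (2 / sqrt 3) *s F f (Z v t)"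
    using Z'_reduced_ode[of t] assms by simp
  from arg_cong[OF this, of "(*s) \<i>"] show ?thesis by (simp add: smult_smult)
qed

lemma Z_bound: "norm (Z v t) \<le> 2 * norm v"
  by (rule reduced_bound[OF near \<epsilon> _ Z_reduced]) (use R in simp)

lemma integrand_continuous:
  "continuous_on S (\<lambda>t. (((- \<i>) *s Z' v t) \<bullet> Z v t) / 2 - 2 / sqrt 3 * H V (Z v t))"
proof -
  have "continuous_on UNIV V"
    using V by (meson continuous_at_imp_continuous_on gderiv_def has_derivative_continuous)
  then have Vc: "continuous_on S (\<lambda>t. V (g t))" if "continuous_on S g" for g
    by (rule continuous_on_compose2) (use that in auto)
  show ?thesis unfolding H_def
    by (intro continuous_intros Vc continuous_on_re continuous_on_smult Z'_continuous twistedD(1)[OF Z_twisted]) auto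
qed

end

lemma c_lipschitz:
  assumes "v \<in> K" "norm v \<le> R / 2" "v' \<in> K" "norm v' \<le> R / 2"
  shows "norm (c v - c v') \<le> real CARD('n) * (8 * \<epsilon>) * norm (v - v')"
proof -
  have "c v - c v' = \<i> *s (P (\<lambda>t. N f (Z v t)) - P (\<lambda>t. N f (Z v' t)))"
    by (simp add: c_def vector_ssub_ldistrib)
  then have "norm (c v - c v') = norm (P (\<lambda>t. N f (Z v t)) - P (\<lambda>t. N f (Z v' t)))"
    by (simp only: norm_vector_scalar_mult norm_ii mult_1)
  then show ?thesis
    using reduced_P_N_close[OF near near \<epsilon> Z_reduced[OF assms(1,2)] Z_reduced[OF assms(3,4)], of 0]
    by (simp add: algebra_simps)
qed

lemma c_continuous: "continuous_on (K \<inter> cball 0 (R / 2)) c"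
  by (rule lipschitz_on_continuous_on[of "real CARD('n) * (8 * \<epsilon>)"])
    (use c_lipschitz \<epsilon> in \<open>auto intro!: lipschitz_onI simp: dist_norm\<close>)

text \<open>Write \<open>\<delta> = Z u - Z v\<close>. Up to a total derivative, whose integral vanishes by
  the twist condition, the first variation of the action at \<open>Z v\<close> in the direction
  \<open>\<delta>\<close> is the average of \<open>((- \<i>) *s Z' v - (2 / sqrt 3) *\<^sub>R F f (Z v))
  \<bullet> \<delta>\<close>, and by \<open>Z'_reduced_ode\<close> this is the average of \<open>E (c v)
  \<bullet> \<delta>\<close>, which equals \<open>c v \<bullet> P \<delta> = c v \<bullet> (u - v)\<close>.
  What remains is quadratic in \<open>\<delta>\<close> and its derivative, and both are bounded by a
  multiple of \<open>norm (u - v)\<close>. Thus Lipschitz dependence of \<open>Z\<close> on \<open>v\<close>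
  is enough to identify the gradient.\<close>

lemma action_increment:
  assumes v: "v \<in> K" "norm v \<le> R / 2" and u: "u \<in> K" "norm u \<le> R / 2"
  shows "\<bar>\<phi> u - \<phi> v - c v \<bullet> (u - v)\<bar> \<le> curvature_bound \<epsilon> * (norm (u - v))\<^sup>2"
proof -
  define \<delta> where "\<delta> t = Z u t - Z v t" for t
  define \<delta>' where "\<delta>' t = Z' u t - Z' v t" for t
  define I where "I v t = (((- \<i>) *s Z' v t) \<bullet> Z v t) / 2 - 2 / sqrt 3 * H V (Z v t)" for v t
  define B where "B t = ((- \<i>) *s \<delta>' t) \<bullet> Z v t - ((- \<i>) *s Z' v t) \<bullet> \<delta> t" for t
  define rem where "rem t = (((- \<i>) *s \<delta>' t) \<bullet> \<delta> t) / 2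
      - 2 / sqrt 3 * (H V (Z u t) - H V (Z v t) - F f (Z v t) \<bullet> \<delta> t)" for t
  define h where "h = norm (u - v)"
  note Zv = Z_has_vector_derivative[OF v] and Zu = Z_has_vector_derivative[OF u]
  have \<delta>_tw: "twisted \<delta>" unfolding \<delta>_def[abs_def] by (rule twisted_diff[OF Z_twisted[OF u] Z_twisted[OF v]])
  have \<delta>_h: "norm (\<delta> t) \<le> 2 * h" for t
    using reduced_close[OF near near \<epsilon> Z_reduced[OF u] Z_reduced[OF v], of 0 t]
    by (simp add: \<delta>_def h_def)
  have h0: "h \<ge> 0" by (simp add: h_def)
  have \<delta>'_h: "norm (\<delta>' t) \<le> (real CARD('n) * (\<Sum>j\<in>UNIV. \<bar>w j\<bar>) + 4 * \<epsilon> + real CARD('n) * (4 * \<epsilon>)) * (2 * h)" for t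
  proof -
    have "norm (iW (\<delta> t)) \<le> real CARD('n) * ((\<Sum>j\<in>UNIV. \<bar>w j\<bar>) * (2 * h))"
      by (rule order_trans[OF iW_bound]) (intro mult_left_mono \<delta>_h sum_nonneg, auto)
    moreover have "norm (N f (Z u t) - N f (Z v t)) \<le> 4 * (\<epsilon> * (2 * h) + 0)"
      using N_close[OF near \<epsilon>(1) Z_R[OF u] Z_R[OF v], of f 0 t t] mult_left_mono[OF \<delta>_h[of t] \<epsilon>(1)]
      by (simp add: \<delta>_def)
    moreover have "norm (E (P (\<lambda>t. N f (Z u t)) - P (\<lambda>t. N f (Z v t))) t)
        \<le> real CARD('n) * (4 * (\<epsilon> * (2 * (h + 4 * 0 * green_bound)) + 0))"
      unfolding norm_E h_def
      by (rule reduced_P_N_close[OF near near \<epsilon> Z_reduced[OF u] Z_reduced[OF v]]) simp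
    moreover have "\<delta>' t = iW (\<delta> t) + (N f (Z u t) - N f (Z v t))
        - E (P (\<lambda>t. N f (Z u t)) - P (\<lambda>t. N f (Z v t))) t"
      by (simp add: \<delta>'_def \<delta>_def Z'_def iW_diff E_diff)
    ultimately have "norm (\<delta>' t) \<le> real CARD('n) * ((\<Sum>j\<in>UNIV. \<bar>w j\<bar>) * (2 * h))
        + 4 * (\<epsilon> * (2 * h) + 0) + real CARD('n) * (4 * (\<epsilon> * (2 * (h + 4 * 0 * green_bound)) + 0))"
      by (metis (no_types, lifting) add_mono norm_triangle_le norm_triangle_le_diff)
    then show ?thesis by (simp add: algebra_simps)
  qed
  have split: "I u t - I v t = E (c v) t \<bullet> \<delta> t + B t / 2 + rem t" for t
  proof -
    have "((- \<i>) *s Z' u t) \<bullet> Z u t - ((- \<i>) *s Z' v t) \<bullet> Z v t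
        = 2 * (((- \<i>) *s Z' v t) \<bullet> \<delta> t) + B t + ((- \<i>) *s \<delta>' t) \<bullet> \<delta> t"
      by (simp add: B_def \<delta>_def \<delta>'_def vector_ssub_ldistrib inner_diff_left inner_diff_right)
    moreover have "((- \<i>) *s Z' v t) \<bullet> \<delta> t = 2 / sqrt 3 * (F f (Z v t) \<bullet> \<delta> t) + E (c v) t \<bullet> \<delta> t"
    proof -
      have "complex_of_real (2 / sqrt 3) *s F f (Z v t) = (2 / sqrt 3) *\<^sub>R F f (Z v t)"
        unfolding vec_eq_iff vector_smult_component vector_scaleR_component
        by (simp add: scaleR_conv_of_real)
      from arg_cong[OF this, of "\<lambda>a. (a + E (c v) t) \<bullet> \<delta> t"]
      show ?thesis by (simp only: Z'_reduced_ode[OF v] inner_add_left inner_scaleR_left)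
    qed
    ultimately show ?thesis by (simp add: I_def rem_def algebra_simps)
  qed
  have \<delta>d: "(\<delta> has_vector_derivative \<delta>' t) (at t)" for t
    unfolding \<delta>_def[abs_def] \<delta>'_def by (rule has_vector_derivative_diff[OF Zu Zv])
  have "(B has_integral (((- \<i>) *s \<delta> \<tau>) \<bullet> Z v \<tau> - ((- \<i>) *s \<delta> 0) \<bullet> Z v 0)) {0..\<tau>}"
  proof (rule fundamental_theorem_of_calculus)
    fix t
    have "((\<lambda>t. ((- \<i>) *s \<delta> t) \<bullet> Z v t) has_vector_derivative
        ((- \<i>) *s \<delta> t) \<bullet> Z' v t + ((- \<i>) *s \<delta>' t) \<bullet> Z v t) (at t)"
      by (rule bounded_bilinear.has_vector_derivative[OF bounded_bilinear_inner
            bounded_linear.has_vector_derivative[OF bounded_linear_smult \<delta>d] Zv])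
    moreover have "((- \<i>) *s \<delta> t) \<bullet> Z' v t = - (((- \<i>) *s Z' v t) \<bullet> \<delta> t)" by (rule mi_inner_swap)
    ultimately show "((\<lambda>t. ((- \<i>) *s \<delta> t) \<bullet> Z v t) has_vector_derivative B t) (at t within {0..\<tau>})"
      by (simp add: B_def has_vector_derivative_at_within)
  qed (use \<tau> in simp)
  moreover have "((- \<i>) *s \<delta> \<tau>) \<bullet> Z v \<tau> = ((- \<i>) *s \<delta> 0) \<bullet> Z v 0"
  proof -
    have "\<delta> \<tau> = cnj om *s \<delta> 0" "Z v \<tau> = cnj om *s Z v 0"
      using twistedD(2)[OF \<delta>_tw, of 0] twistedD(2)[OF Z_twisted[OF v], of 0] by simp_all
    then have "((- \<i>) *s \<delta> \<tau>) \<bullet> Z v \<tau> = (cnj om *s ((- \<i>) *s \<delta> 0)) \<bullet> (cnj om *s Z v 0)"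
      by (simp only: smult_smult mult.commute)
    then show ?thesis by (simp only: inner_unitary[OF cmod_om(2)])
  qed
  ultimately have "(B has_integral 0) {0..\<tau>}" by simp
  from has_integral_divide[OF this, of 2] have B0: "((\<lambda>t. B t / 2) has_integral 0) {0..\<tau>}" by simp
  have "((\<lambda>t. E (c v) t \<bullet> \<delta> t) has_integral \<tau> * (c v \<bullet> P \<delta>)) {0..\<tau>}"
    by (rule inner_E_integral[OF c_in_K \<delta>_tw])
  moreover have "P \<delta> = u - v"
    unfolding \<delta>_def[abs_def]
    by (simp add: P_diff[OF Z_twisted[OF u] Z_twisted[OF v]] P_Z[OF u] P_Z[OF v])
  ultimately have lin: "((\<lambda>t. E (c v) t \<bullet> \<delta> t) has_integral \<tau> * (c v \<bullet> (u - v))) {0..\<tau>}" by simp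
  have Ii: "(I p has_integral \<tau> * \<phi> p) {0..\<tau>}" if p: "p \<in> K" "norm p \<le> R / 2" for p
  proof -
    have "I p integrable_on {0..\<tau>}"
      unfolding I_def[abs_def] by (intro integrable_continuous_interval integrand_continuous[OF p])
    then show ?thesis using \<tau> by (simp add: has_integral_integral \<phi>_def I_def[abs_def])
  qed
  have rem: "(rem has_integral \<tau> * (\<phi> u - \<phi> v - c v \<bullet> (u - v))) {0..\<tau>}"
  proof -
    have "((\<lambda>t. (I u t - I v t) - E (c v) t \<bullet> \<delta> t - B t / 2) has_integral
        (\<tau> * \<phi> u - \<tau> * \<phi> v) - \<tau> * (c v \<bullet> (u - v)) - 0) {0..\<tau>}"
      by (intro has_integral_diff Ii u v lin B0)
    then show ?thesis by (simp add: split algebra_simps)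
  qed
  have rem_le: "\<bar>rem t\<bar> \<le> curvature_bound \<epsilon> * h\<^sup>2" for t
  proof -
    let ?C = "real CARD('n) * (\<Sum>j\<in>UNIV. \<bar>w j\<bar>) + 4 * \<epsilon> + real CARD('n) * (4 * \<epsilon>)"
    have "\<bar>((- \<i>) *s \<delta>' t) \<bullet> \<delta> t\<bar> \<le> norm (\<delta>' t) * norm (\<delta> t)"
      using Cauchy_Schwarz_ineq2[of "(- \<i>) *s \<delta>' t" "\<delta> t"] by (simp add: norm_vector_scalar_mult)
    also have "\<dots> \<le> (?C * (2 * h)) * (2 * h)"
      using \<delta>'_h[of t] \<delta>_h[of t] order_trans[OF norm_ge_zero \<delta>'_h] by (intro mult_mono) auto
    also have "\<dots> = 2 * (2 * ?C * h\<^sup>2)" by (simp add: power2_eq_square)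
    finally have 1: "\<bar>((- \<i>) *s \<delta>' t) \<bullet> \<delta> t / 2\<bar> \<le> 2 * ?C * h\<^sup>2" by linarith
    have "\<bar>H V (Z u t) - H V (Z v t) - F f (Z v t) \<bullet> \<delta> t\<bar> \<le> 3 * (lip \<epsilon> * (norm (\<delta> t))\<^sup>2)"
      unfolding \<delta>_def by (rule H_increment[OF near \<epsilon>(1) V Z_R[OF v] Z_R[OF u]])
    also have "\<dots> \<le> 3 * (lip \<epsilon> * (2 * h)\<^sup>2)"
      using lip_nonneg[OF \<epsilon>(1)] \<delta>_h[of t] by (intro mult_left_mono power_mono) auto
    finally have "\<bar>2 / sqrt 3 * (H V (Z u t) - H V (Z v t) - F f (Z v t) \<bullet> \<delta> t)\<bar>
        \<le> 2 * (3 * (lip \<epsilon> * (2 * h)\<^sup>2))"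
      unfolding abs_mult using two_div_sqrt3 by (intro mult_mono) auto
    with 1 have "\<bar>rem t\<bar> \<le> 2 * ?C * h\<^sup>2 + 2 * (3 * (lip \<epsilon> * (2 * h)\<^sup>2))"
      unfolding rem_def by linarith
    also have "\<dots> \<le> curvature_bound \<epsilon> * h\<^sup>2"
      by (simp add: curvature_bound_def power_mult_distrib algebra_simps)
    finally show ?thesis .
  qed
  have "norm (\<tau> * (\<phi> u - \<phi> v - c v \<bullet> (u - v))) \<le> (curvature_bound \<epsilon> * h\<^sup>2) * measure lborel {0..\<tau>}"
    by (rule has_integral_bound_real[OF _ _ rem, where S = "{}"])
      (use rem_le curvature_bound_pos[OF \<epsilon>(1)] in auto)
  then have "\<tau> * \<bar>\<phi> u - \<phi> v - c v \<bullet> (u - v)\<bar> \<le> \<tau> * (curvature_bound \<epsilon> * h\<^sup>2)"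
    using \<tau> by (simp add: abs_mult mult.commute)
  then show ?thesis using \<tau> by (simp add: h_def)
qed

theorem quadratic_gradient_action: "quadratic_gradient K (R / 2) (curvature_bound \<epsilon>) \<phi> c"
  unfolding quadratic_gradient_def using c_in_K action_increment by auto

end

section \<open>Solutions of the delay equation\<close>

lemma re_rotated_F:
  "re ((\<i> * of_real (2 / sqrt 3)) *s F f z) = f (re (om *s z)) - f (re (cnj om *s z))"
  by (simp add: vec_eq_iff re_def F_def emb_def om_parts field_simps del: cis.sel)

lemma re_om_eq_0_imp_eq_0: "re z = 0 \<Longrightarrow> re (om *s z) = 0 \<Longrightarrow> z = 0"
  by (auto simp: vec_eq_iff re_def complex_eq_iff om_parts simp del: cis.sel)

lemma antiperiodic_backwards:
  fixes x :: "real \<Rightarrow> 'a::real_vector"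
  assumes "\<And>t. x (t + 3 * \<tau>) = - x t" shows "x (t - 3 * \<tau>) = - x t"
  using assms[of "t - 3 * \<tau>"] by (simp add: minus_equation_iff)

context resonance begin

lemma twisted_backwards:
  assumes "twisted z" shows "z (t - \<tau>) = om *s z t" "z (t - 2 * \<tau>) = (- cnj om) *s z t"
proof -
  have *: "z (t - \<tau>) = om *s z t" for t
  proof -
    have "z t = cnj om *s z (t - \<tau>)" using twistedD(2)[OF assms, of "t - \<tau>"] by simp
    then show ?thesis by (simp add: smult_smult om_cnj)
  qed
  show "z (t - \<tau>) = om *s z t" by (rule *)
  show "z (t - 2 * \<tau>) = (- cnj om) *s z t"
    using *[of "t - \<tau>"] *[of t] by (simp add: smult_smult om_square)
qed

lemma twisted_triple: assumes "twisted z" shows "z (t + 3 * \<tau>) = - z t"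
proof -
  have "z (t + 3 * \<tau>) = cnj om *s (cnj om *s (cnj om *s z t))"
    using twistedD(2)[OF assms, of "t + \<tau> + \<tau>"] twistedD(2)[OF assms, of "t + \<tau>"]
      twistedD(2)[OF assms, of t] by (simp add: algebra_simps)
  also have "\<dots> = (cnj om * (cnj om * cnj om)) *s z t" by (simp only: smult_smult mult.assoc)
  also have "\<dots> = - z t" unfolding om_square by (simp add: om_cnj vec_eq_iff del: cis_cnj)
  finally show ?thesis .
qed

end

context nonlinearity begin

lemma odd: "f (- x) = - f x" using near by (simp add: near_diagonal_def)

text \<open>The twist condition gives \<open>z (t - \<tau>) = om *s z t\<close> and \<open>z (t - 2 *
  \<tau>) = (- cnj om) *s z t\<close>, so the real part of the Hamiltonian system is the delay
  equation.\<close>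

lemma zero_of_c_solution:
  assumes v: "v \<in> K" "norm v \<le> R / 2" and c: "c v = 0"
  defines "x \<equiv> \<lambda>t. re (Z v t)"
  shows "(x has_vector_derivative f (x (t - \<tau>)) + f (x (t - 2 * \<tau>))) (at t)"
    and "x (t + 3 * \<tau>) = - x t" and "norm (x t) \<le> 2 * norm v"
proof -
  note z = Z_twisted[OF v]
  have "re ((- cnj om) *s Z v t) = - re (cnj om *s Z v t)" by (simp add: vec_eq_iff re_def)
  then have "re (Z' v t) = f (x (t - \<tau>)) + f (x (t - 2 * \<tau>))"
    unfolding x_def twisted_backwards[OF z] Z'_zero_ode[OF v c] re_rotated_F by (simp add: odd)
  then show "(x has_vector_derivative f (x (t - \<tau>)) + f (x (t - 2 * \<tau>))) (at t)"
    using bounded_linear.has_vector_derivative[OF bounded_linear_re Z_has_vector_derivative[OF v, of t]]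
    by (simp add: x_def)
  show "x (t + 3 * \<tau>) = - x t" by (simp add: x_def twisted_triple[OF z] re_uminus)
  show "norm (x t) \<le> 2 * norm v" unfolding x_def by (rule order_trans[OF norm_re_le Z_bound[OF v]])
qed

text \<open>The combination \<open>x t - x (t - \<tau>) + x (t - 2 * \<tau>)\<close> has derivative zero and
  changes sign under \<open>t \<mapsto> t + 3 * \<tau>\<close>, so it vanishes. This makes the complex curve
  built from \<open>x\<close> twisted and a solution of the Hamiltonian system. Without resonances it solves
  the reduced equation with amplitude zero, hence is zero by the contraction.\<close>

lemma nonresonant_small_solution_zero:
  assumes nr: "\<And>j. \<not> resonant j"
    and x: "\<And>t. (x has_vector_derivative f (x (t - \<tau>)) + f (x (t - 2 * \<tau>))) (at t)"
    and anti: "\<And>t. x (t + 3 * \<tau>) = - x t" and small: "\<And>t. norm (x t) \<le> R / 4"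
  shows "x t = 0"
proof -
  note prev = antiperiodic_backwards[of x \<tau>, OF anti]
  have prev4: "x (t - 4 * \<tau>) = - x (t - \<tau>)" for t
    using prev[of "t - \<tau>"] by (simp add: algebra_simps)
  have x1: "((\<lambda>t. x (t - \<tau>)) has_vector_derivative f (x (t - 2 * \<tau>)) - f (x t)) (at t)" for t
    using has_vector_derivative_shift(1)[of x _ t "- \<tau>"] x[of "t - \<tau>"]
    by (simp add: prev prev4 odd)
  have x2: "((\<lambda>t. x (t - 2 * \<tau>)) has_vector_derivative - f (x t) - f (x (t - \<tau>))) (at t)" for t
    using has_vector_derivative_shift(1)[of x _ t "- (2 * \<tau>)"] x[of "t - 2 * \<tau>"]
    by (simp add: prev prev4 odd)
  have "((\<lambda>t. x t - x (t - \<tau>) + x (t - 2 * \<tau>)) has_vector_derivative 0) (at t)" for t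
    using has_vector_derivative_add[OF has_vector_derivative_diff[OF x x1] x2] by simp
  note aff = constant_derivative_imp_affine[OF this]
  have rel: "x (t - \<tau>) = x t + x (t - 2 * \<tau>)" for t
  proof -
    define y where "y t = x t - x (t - \<tau>) + x (t - 2 * \<tau>)" for t
    have "y (t + 3 * \<tau>) = - y t"
      using anti[of t] anti[of "t - \<tau>"] anti[of "t - 2 * \<tau>"] by (simp add: y_def algebra_simps)
    moreover have "y (t + 3 * \<tau>) = y t" using aff[of t] aff[of "t + 3 * \<tau>"] by (simp add: y_def)
    ultimately have "y t = 0" by (simp add: vec_eq_iff)
    then show ?thesis by (simp add: y_def algebra_simps)
  qed
  define z where "z t = emb (x t) - (\<i> / of_real (sqrt 3)) *s emb (x (t - \<tau>) + x (t - 2 * \<tau>))" for t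
  have s3: "sqrt 3 * sqrt 3 = 3" by simp
  have zj: "z t $ j = Complex (x t $ j) (- (x (t - \<tau>) $ j + x (t - 2 * \<tau>) $ j) / sqrt 3)" for t j
    by (simp add: z_def emb_def complex_eq_iff add_divide_distrib diff_divide_distrib)
  have relj: "x (t - \<tau>) $ j = x t $ j + x (t - 2 * \<tau>) $ j" for t j by (subst rel) simp
  have r: "re (z t) = x t" "re (om *s z t) = x (t - \<tau>)" "re (cnj om *s z t) = - x (t - 2 * \<tau>)" for t
    by (simp_all add: vec_eq_iff re_def zj om_parts relj field_simps del: cis.sel)
  have tw: "twisted z"
    unfolding twisted_def
  proof (intro conjI allI)
    have c: "continuous_on UNIV x" "continuous_on UNIV (\<lambda>t. x (t - \<tau>))" "continuous_on UNIV (\<lambda>t. x (t - 2 * \<tau>))"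
      using x x1 x2 by (meson continuous_at_imp_continuous_on has_vector_derivative_continuous)+
    show "continuous_on UNIV z"
      unfolding z_def emb_def by (intro continuous_intros continuous_on_smult c)
    fix t
    have "x (t + \<tau>) = - x (t - 2 * \<tau>)" using anti[of "t - 2 * \<tau>"] by (simp add: algebra_simps)
    then have "x (t + \<tau>) $ j = - x (t - 2 * \<tau>) $ j" for j by simp
    then show "z (t + \<tau>) = cnj om *s z t"
      using s3 by (simp add: vec_eq_iff zj complex_eq_iff om_parts relj[of t] field_simps del: cis.sel)
  qed
  have ode: "(z has_vector_derivative (\<chi> j. \<i> * of_real (w j) * z t $ j) + N f (z t)) (at t)" for t
  proof -
    have eq: "(\<chi> j. \<i> * of_real (w j) * z t $ j) + N f (z t) = (\<i> * of_real (2 / sqrt 3)) *s F f (z t)"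
      by (simp add: N_eq iW_def)
    have be: "bounded_linear (emb :: real ^ 'n \<Rightarrow> complex ^ 'n)"
      unfolding linear_conv_bounded_linear[symmetric]
      by (rule linearI) (simp_all add: emb_def vec_eq_iff complex_eq_iff)
    have "(z has_vector_derivative emb (f (x (t - \<tau>)) + f (x (t - 2 * \<tau>)))
        - (\<i> / of_real (sqrt 3)) *s emb (f (x (t - 2 * \<tau>)) - f (x t) + (- f (x t) - f (x (t - \<tau>))))) (at t)"
      unfolding z_def
      by (intro has_vector_derivative_diff bounded_linear.has_vector_derivative[OF be]
          bounded_linear.has_vector_derivative[OF bounded_linear_smult] has_vector_derivative_add x x1 x2)
    moreover have "emb (f (x (t - \<tau>)) + f (x (t - 2 * \<tau>)))
        - (\<i> / of_real (sqrt 3)) *s emb (f (x (t - 2 * \<tau>)) - f (x t) + (- f (x t) - f (x (t - \<tau>))))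
      = (\<i> * of_real (2 / sqrt 3)) *s F f (z t)"
      using s3
      by (simp add: F_def r odd vec_eq_iff emb_def complex_eq_iff om_parts field_simps del: cis.sel)
    ultimately show ?thesis by (simp add: eq)
  qed
  have zR: "norm (z t) \<le> R" for t
  proof -
    have "norm (z t) \<le> norm (x t) + 1 / sqrt 3 * norm (x (t - \<tau>) + x (t - 2 * \<tau>))"
      unfolding z_def
      by (rule order_trans[OF norm_triangle_ineq4]) (simp add: norm_vector_scalar_mult norm_emb norm_divide)
    also have "\<dots> \<le> norm (x t) + 1 * (norm (x (t - \<tau>)) + norm (x (t - 2 * \<tau>)))"
      by (intro add_left_mono mult_mono norm_triangle_ineq) auto
    also have "\<dots> \<le> R" using small[of t] small[of "t - \<tau>"] small[of "t - 2 * \<tau>"] R by simp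
    finally show ?thesis .
  qed
  have tN: "twisted (\<lambda>t. N f (z t))" by (rule twisted_N[OF near \<epsilon>(1) tw zR])
  have "E 0 t = 0" for t by (simp add: E_def vec_eq_iff)
  then have "z t = E 0 t + G (\<lambda>s. N f (z s)) t" for t
    using nonresonant_solution_eq_G[OF nr tw tN ode, of t] by (simp only: add_0)
  then have "reduced R f 0 z"
    unfolding reduced_def using tw zR by blast
  from reduced_bound[OF near \<epsilon> _ this, of t] R have "z t = 0" by simp
  then show ?thesis using r(1)[of t] by (simp add: re_def vec_eq_iff)
qed

end

section \<open>The sign of the reduced gradient near zero\<close>

definition cmat :: "real ^ 'n ^ 'n \<Rightarrow> complex ^ 'n ^ 'n" where
  "cmat B = (\<chi> i k. of_real (B $ i $ k))"

text \<open>As for \<open>D\<close>, the conjugate parts average out, see \<open>om_average\<close>.\<close>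

lemma F_matrix: "F ((*v) B) z = (3 / 2) *s (cmat B *v z)"
proof (rule vec_eq_iff[THEN iffD2], rule allI)
  fix i
  have e: "emb (B *v re y) $ i = (\<Sum>k\<in>UNIV. of_real (B $ i $ k) * of_real (Re (y $ k)))" for y
    by (simp add: emb_def matrix_vector_mult_def re_def)
  have "F ((*v) B) z $ i = (\<Sum>k\<in>UNIV. of_real (B $ i $ k) * (of_real (Re (z $ k))
      + cnj om * of_real (Re (om * z $ k)) + om * of_real (Re (cnj om * z $ k))))"
    by (simp only: F_def vector_add_component vector_smult_component e distrib_left sum.distrib
        sum_distrib_left mult.left_commute)
  also have "\<dots> = (\<Sum>k\<in>UNIV. of_real (B $ i $ k) * ((3 / 2) * z $ k))"
    by (simp only: om_average)
  also have "\<dots> = ((3 / 2) *s (cmat B *v z)) $ i"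
    by (simp add: cmat_def matrix_vector_mult_def sum_distrib_left algebra_simps)
  finally show "F ((*v) B) z $ i = ((3 / 2) *s (cmat B *v z)) $ i" .
qed

lemma inner_re_im: 
  fixes x y :: "complex ^ 'n"
  shows "x \<bullet> y = re x \<bullet> re y + re ((- \<i>) *s x) \<bullet> re ((- \<i>) *s y)"
  by (simp add: inner_vec_def re_def inner_complex_def sum.distrib)

lemma re_cmat: "re (cmat B *v x) = B *v re x"
  by (simp add: vec_eq_iff re_def cmat_def matrix_vector_mult_def)

lemma cmat_smult: "cmat B *v (c *s x) = c *s (cmat B *v x)"
  by (simp add: vec_eq_iff cmat_def matrix_vector_mult_def sum_distrib_left algebra_simps)

context resonance begin

text \<open>The Fourier coefficient of all components at the frequency of index \<open>j\<close>. Components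
  \<open>i\<close> with \<open>d i = d j\<close> reproduce \<open>P\<close>.\<close>

definition hat :: "'n \<Rightarrow> (real \<Rightarrow> complex ^ 'n) \<Rightarrow> complex ^ 'n" where
  "hat j h = (\<chi> i. integral {0..\<tau>} (\<lambda>t. cis (- (w j * t)) * h t $ i) / of_real \<tau>)"

lemma hat_integrable:
  "continuous_on UNIV h \<Longrightarrow> (\<lambda>t. cis (- (w j * t)) * h t $ i) integrable_on {0..\<tau>}"
  by (intro integrable_continuous_interval continuous_intros) (auto intro: continuous_on_subset)

lemma hat_diff: "continuous_on UNIV g \<Longrightarrow> continuous_on UNIV h \<Longrightarrow> hat j (\<lambda>t. g t - h t) = hat j g - hat j h"
  by (simp add: vec_eq_iff hat_def right_diff_distrib integral_diff hat_integrable diff_divide_distrib)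

lemma hat_smult: "hat j (\<lambda>t. c *s h t) = c *s hat j h"
proof -
  have "integral {0..\<tau>} (\<lambda>t. cis (- (w j * t)) * (c * h t $ i)) = c * integral {0..\<tau>} (\<lambda>t. cis (- (w j * t)) * h t $ i)" for i
    by (subst integral_mult_right[symmetric]) (simp add: mult.left_commute)
  then show ?thesis by (simp add: vec_eq_iff hat_def)
qed

lemma hat_matrix:
  assumes "continuous_on UNIV h" shows "hat j (\<lambda>t. M *v h t) = M *v hat j h"
proof -
  have "integral {0..\<tau>} (\<lambda>t. cis (- (w j * t)) * (\<Sum>k\<in>UNIV. M $ i $ k * h t $ k))
      = (\<Sum>k\<in>UNIV. M $ i $ k * integral {0..\<tau>} (\<lambda>t. cis (- (w j * t)) * h t $ k))" for i
  proof -
    have "(\<lambda>t. cis (- (w j * t)) * (\<Sum>k\<in>UNIV. M $ i $ k * h t $ k))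
        = (\<lambda>t. \<Sum>k\<in>UNIV. M $ i $ k * (cis (- (w j * t)) * h t $ k))"
      by (simp add: sum_distrib_left mult.left_commute)
    then show ?thesis
      by (simp add: integral_sum hat_integrable[OF assms] integrable_on_mult_right)
  qed
  then show ?thesis
    by (simp add: vec_eq_iff hat_def matrix_vector_mult_def sum_divide_distrib)
qed

lemma hat_bound:
  assumes h: "continuous_on UNIV h" and B: "\<And>t. norm (h t) \<le> B"
  shows "cmod (hat j h $ i) \<le> B"
proof -
  have "cmod (integral {0..\<tau>} (\<lambda>t. cis (- (w j * t)) * h t $ i)) \<le> B * (\<tau> - 0)"
    by (rule integral_bound)
      (use \<tau> in \<open>auto simp: norm_mult intro: order_trans[OF Finite_Cartesian_Product.norm_nth_le B]
        intro!: continuous_intros continuous_on_subset[OF h]\<close>)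
  then show ?thesis using \<tau> by (simp add: hat_def norm_divide pos_divide_le_eq)
qed

text \<open>Integration by parts; the boundary terms cancel by the twist condition and resonance.\<close>

lemma hat_derivative:
  assumes z: "twisted z" and z': "\<And>t. (z has_vector_derivative z' t) (at t)" and j: "resonant j"
  shows "hat j (\<lambda>t. z' t - (\<i> * of_real (w j)) *s z t) = 0"
proof -
  have "((\<lambda>t. cis (- (w j * t)) * (z' t - (\<i> * of_real (w j)) *s z t) $ i) has_integral
      cis (- (w j * \<tau>)) * z \<tau> $ i - cis (- (w j * 0)) * z 0 $ i) {0..\<tau>}" for i
  proof (rule fundamental_theorem_of_calculus)
    fix t
    have "((\<lambda>t. cis (- w j * t) * z t $ i) has_vector_derivative
        cis (- w j * t) * z' t $ i + \<i> * of_real (- w j) * cis (- w j * t) * z t $ i) (at t)"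
      by (rule has_vector_derivative_mult[OF cis_linear_derivative
            bounded_linear.has_vector_derivative[OF bounded_linear_vec_nth z']])
    then show "((\<lambda>t. cis (- (w j * t)) * z t $ i) has_vector_derivative
        cis (- (w j * t)) * (z' t - (\<i> * of_real (w j)) *s z t) $ i) (at t within {0..\<tau>})"
      by (simp add: has_vector_derivative_at_within algebra_simps)
  qed (use \<tau> in simp)
  moreover have "cis (- (w j * \<tau>)) * z \<tau> $ i = z 0 $ i" for i
  proof -
    have "z \<tau> = cnj om *s z 0" using twistedD(2)[OF z, of 0] by simp
    then have "cis (- (w j * \<tau>)) * z \<tau> $ i = (cis (- (w j * \<tau>)) * cnj om) * z 0 $ i" by simp
    then show ?thesis using j by (simp only: resonant_iff mult_1)
  qed
  ultimately show ?thesis by (simp add: hat_def vec_eq_iff integral_unique)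
qed

lemma resonant_cong: "d i = d j \<Longrightarrow> resonant i = resonant j"
  by (simp add: resonant_def w_def)

lemma hat_cong: "d i = d j \<Longrightarrow> hat i h = hat j h"
  by (simp add: hat_def w_def)

lemma hat_eq_P: "resonant j \<Longrightarrow> d i = d j \<Longrightarrow> hat j h $ i = P h $ i"
  using resonant_cong[of i j] by (simp add: hat_def P_def w_def)

text \<open>Different resonant frequencies do not interact: apply \<open>hat_derivative\<close> to \<open>E
  p\<close>, whose derivative is known.\<close>

lemma hat_E:
  assumes p: "p \<in> K" and j: "resonant j"
  shows "hat j (E p) $ i = (if d i = d j then p $ i else 0)"
proof (cases "d i = d j")
  case True
  then show ?thesis using hat_eq_P[OF j True, of "E p"] by (simp add: P_E[OF p])
next
  case False
  then have ne: "\<i> * of_real (w i) - \<i> * of_real (w j) \<noteq> (0 :: complex)"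
    by (simp add: w_def)
  have "hat j (\<lambda>t. (\<chi> k. \<i> * of_real (w k) * E p t $ k) - (\<i> * of_real (w j)) *s E p t) $ i = 0"
    using hat_derivative[OF twisted_E[OF p] E_has_vector_derivative j] by simp
  moreover have "hat j (\<lambda>t. (\<chi> k. \<i> * of_real (w k) * E p t $ k) - (\<i> * of_real (w j)) *s E p t) $ i
      = hat j (\<lambda>t. (\<i> * of_real (w i) - \<i> * of_real (w j)) *s E p t) $ i"
    by (simp add: hat_def left_diff_distrib)
  ultimately have "(\<i> * of_real (w i) - \<i> * of_real (w j)) * hat j (E p) $ i = 0"
    by (simp only: hat_smult vector_smult_component)
  then show ?thesis using False ne by simp
qed

text \<open>The linearization at frequency \<open>w j\<close>, divided by \<open>sqrt 3\<close>.\<close>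

definition T :: "real ^ 'n ^ 'n \<Rightarrow> 'n \<Rightarrow> complex ^ 'n \<Rightarrow> complex ^ 'n" where
  "T B j x = of_real (d j) *s x - cmat B *v x"

lemma T_nth: "T B j x $ i = of_real (d j) * x $ i - (\<Sum>k\<in>UNIV. of_real (B $ i $ k) * x $ k)"
  by (simp add: T_def cmat_def matrix_vector_mult_def)

lemma T_scaleR: "T B j (r *\<^sub>R x) = r *\<^sub>R T B j x"
  by (simp add: vec_eq_iff T_nth scaleR_right_diff_distrib scaleR_sum_right)

lemma re_T: "re (T B j y) = d j *\<^sub>R re y - B *v re y"
  by (simp add: T_def re_diff re_cmat) (simp add: re_def vec_eq_iff)

lemma T_rotate: "(- \<i>) *s T B j x = T B j ((- \<i>) *s x)"
  by (simp only: T_def vector_ssub_ldistrib cmat_smult smult_smult mult.commute)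

text \<open>The matrix is real, so the Hermitian form splits into the real forms of the real and the
  imaginary part.\<close>

lemma T_inner:
  "T B j x \<bullet> x = (d j *\<^sub>R re x - B *v re x) \<bullet> re x
     + (d j *\<^sub>R re ((- \<i>) *s x) - B *v re ((- \<i>) *s x)) \<bullet> re ((- \<i>) *s x)"
  using inner_re_im[of "T B j x" x] by (simp only: re_T T_rotate)

end

context nonlinearity begin

text \<open>The deviation of the vector field along \<open>Z v\<close> from the linearization at zero of the
  field of \<open>f\<close> itself, where \<open>B\<close> is the derivative of \<open>f\<close> at
  zero.\<close>

definition defect :: "real ^ 'n ^ 'n \<Rightarrow> complex ^ 'n \<Rightarrow> real \<Rightarrow> complex ^ 'n" where
  "defect B v t = N f (Z v t) + iW (Z v t) - (\<i> * of_real (sqrt 3)) *s (cmat B *v Z v t)"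

lemma defect_eq: "defect B v t = (\<i> * of_real (2 / sqrt 3)) *s F (\<lambda>x. f x - B *v x) (Z v t)"
proof -
  have "F f (Z v t) = F (\<lambda>x. f x - B *v x) (Z v t) + F ((*v) B) (Z v t)" by (simp flip: F_add)
  moreover have "\<i> * of_real (2 / sqrt 3) * (3 / 2) = \<i> * complex_of_real (sqrt 3)"
  proof -
    have "2 / sqrt 3 * (3 / 2) = sqrt 3" by (simp add: real_div_sqrt)
    then have "of_real (2 / sqrt 3) * (3 / 2) = complex_of_real (sqrt 3)"
      by (metis of_real_divide of_real_mult of_real_numeral)
    then show ?thesis by (simp only: mult.assoc)
  qed
  ultimately show ?thesis
    unfolding defect_def N_eq F_matrix by (simp only: vector_add_ldistrib smult_smult) simp
qed

lemma defect_continuous: "v \<in> K \<Longrightarrow> norm v \<le> R / 2 \<Longrightarrow> continuous_on UNIV (defect B v)"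
  unfolding defect_def[abs_def] matrix_vector_mult_def cmat_def
  by (intro continuous_intros continuous_on_iW continuous_on_smult twistedD(1)[OF Z_twisted]
      twistedD(1)[OF NZ_twisted]) auto

lemma defect_small:
  assumes B: "(f has_derivative (\<lambda>x. B *v x)) (at 0)" and \<eta>: "\<eta> > 0"
  shows "\<exists>\<rho>>0. \<forall>v\<in>K. norm v \<le> R / 2 \<longrightarrow> norm v < \<rho> \<longrightarrow> (\<forall>t. norm (defect B v t) \<le> \<eta> * norm v)"
proof -
  have f0: "f 0 = 0" by (rule near_diagonal_0[OF near])
  obtain \<delta> where \<delta>: "\<delta> > 0" "\<And>y. norm y < \<delta> \<Longrightarrow> norm (f y - B *v y) \<le> (\<eta> / 8) * norm y"
    using B \<eta> unfolding has_derivative_at_alt by (auto simp: f0 dest: spec[of _ "\<eta> / 8"])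
  show ?thesis
  proof (intro exI[of _ "\<delta> / 2"] conjI ballI impI allI)
    fix v t assume v: "v \<in> K" "norm v \<le> R / 2" and vd: "norm v < \<delta> / 2"
    have z: "norm (Z v t) \<le> 2 * norm v" by (rule Z_bound[OF v])
    have "norm (F (\<lambda>x. f x - B *v x) (Z v t)) \<le> 3 * ((\<eta> / 8) * (2 * norm v))"
    proof (rule F_bound)
      fix u :: complex assume "cmod u = 1"
      then have le: "norm (re (u *s Z v t)) \<le> 2 * norm v"
        using norm_re_le[of "u *s Z v t"] z by (simp add: norm_vector_scalar_mult)
      then have "norm (f (re (u *s Z v t)) - B *v re (u *s Z v t)) \<le> (\<eta> / 8) * norm (re (u *s Z v t))"
        using vd by (intro \<delta>(2)) simp
      also have "\<dots> \<le> (\<eta> / 8) * (2 * norm v)" using le \<eta> by (intro mult_left_mono) auto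
      finally show "norm (f (re (u *s Z v t)) - B *v re (u *s Z v t)) \<le> (\<eta> / 8) * (2 * norm v)" .
    qed
    then have "2 / sqrt 3 * norm (F (\<lambda>x. f x - B *v x) (Z v t)) \<le> 2 / sqrt 3 * (3 * ((\<eta> / 8) * (2 * norm v)))"
      using two_div_sqrt3(1) by (rule mult_left_mono)
    also have "\<dots> = (3 * (2 / sqrt 3)) * ((\<eta> / 8) * (2 * norm v))" by simp
    also have "\<dots> \<le> 4 * ((\<eta> / 8) * (2 * norm v))"
      using two_div_sqrt3(2) \<eta> by (intro mult_right_mono) auto
    finally show "norm (defect B v t) \<le> \<eta> * norm v"
      unfolding defect_eq norm_vector_scalar_mult norm_rotation_factor by simp
  qed (use \<delta> in simp)
qed

text \<open>The coefficient at frequency \<open>w j\<close> of the equation satisfied by \<open>Z v\<close>.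
  By \<open>hat_eq_P\<close> and \<open>P_Z\<close>, the coefficient of \<open>Z v\<close> itself extends
  \<open>v\<close> to the components off the level \<open>d j\<close>.\<close>

lemma fourier_identity:
  assumes v: "v \<in> K" "norm v \<le> R / 2" and j: "resonant j"
  shows "of_real (sqrt 3) * T B j (hat j (Z v)) $ i
    = (if d i = d j then c v $ i else 0) - \<i> * hat j (defect B v) $ i"
proof -
  define p where "p = P (\<lambda>t. N f (Z v t))"
  have pK: "p \<in> K" unfolding p_def by (rule P_in_K)
  have Zc: "continuous_on UNIV (Z v)" by (rule twistedD(1)[OF Z_twisted[OF v]])
  have cont: "continuous_on UNIV (defect B v)" "continuous_on UNIV (E p)"
    "continuous_on UNIV (\<lambda>t. T B j (Z v t))"
    unfolding T_def cmat_def matrix_vector_mult_def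
    by (rule defect_continuous[OF v], rule twistedD(1)[OF twisted_E[OF pK]],
        intro continuous_intros continuous_on_smult Zc)
  have "Z' v t - (\<i> * of_real (w j)) *s Z v t
      = defect B v t - (\<i> * of_real (sqrt 3)) *s T B j (Z v t) - E p t" for t
    by (simp add: Z'_def defect_def p_def T_def w_def vec_eq_iff algebra_simps)
  then have "hat j (\<lambda>t. defect B v t - (\<i> * of_real (sqrt 3)) *s T B j (Z v t) - E p t) = 0"
    using hat_derivative[OF Z_twisted[OF v] Z_has_vector_derivative[OF v] j] by simp
  moreover have "hat j (\<lambda>t. T B j (Z v t)) = T B j (hat j (Z v))"
  proof -
    have "continuous_on UNIV (\<lambda>t. of_real (d j) *s Z v t)" "continuous_on UNIV (\<lambda>t. cmat B *v Z v t)"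
      unfolding cmat_def matrix_vector_mult_def
      by (intro continuous_intros continuous_on_smult Zc)+
    from hat_diff[OF this] show ?thesis by (simp only: T_def hat_smult hat_matrix[OF Zc])
  qed
  ultimately have "hat j (defect B v) - (\<i> * of_real (sqrt 3)) *s T B j (hat j (Z v)) - hat j (E p) = 0"
    by (simp add: hat_diff cont hat_smult continuous_on_smult continuous_on_diff)
  then have "(hat j (defect B v) - (\<i> * of_real (sqrt 3)) *s T B j (hat j (Z v)) - hat j (E p)) $ i = 0"
    by simp
  then have "hat j (defect B v) $ i - \<i> * of_real (sqrt 3) * T B j (hat j (Z v)) $ i
      = (if d i = d j then p $ i else 0)"
    by (simp add: hat_E[OF pK j])
  then have "\<i> * (hat j (defect B v) $ i - \<i> * of_real (sqrt 3) * T B j (hat j (Z v)) $ i)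
      = \<i> * (if d i = d j then p $ i else 0)" by simp
  moreover have "\<i> * (hat j (defect B v) $ i - \<i> * of_real (sqrt 3) * T B j (hat j (Z v)) $ i)
      = \<i> * hat j (defect B v) $ i + of_real (sqrt 3) * T B j (hat j (Z v)) $ i"
    by (simp add: right_diff_distrib mult.assoc[symmetric])
  ultimately show ?thesis by (simp add: c_def p_def[symmetric] algebra_simps split: if_splits)
qed


text \<open>Either of the real and imaginary parts of \<open>x\<close> satisfies the support condition of
  \<open>pos\<close>; a part that vanishes on the level \<open>d j\<close> contributes zero.\<close>

lemma T_definite:
  assumes pos: "\<And>a. (\<And>i. d i \<noteq> d j \<Longrightarrow> (d j *\<^sub>R a - B *v a) $ i = 0) \<Longrightarrow> \<exists>i. d i = d j \<and> a $ i \<noteq> 0 \<Longrightarrow>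
      0 < s * ((d j *\<^sub>R a - B *v a) \<bullet> a)"
    and x: "\<And>i. d i \<noteq> d j \<Longrightarrow> T B j x $ i = 0"
  shows "0 \<le> s * (T B j x \<bullet> x)" and "x $ i \<noteq> 0 \<Longrightarrow> d i = d j \<Longrightarrow> 0 < s * (T B j x \<bullet> x)"
proof -
  have a0: "0 \<le> s * ((d j *\<^sub>R a - B *v a) \<bullet> a)"
    if "\<And>i. d i \<noteq> d j \<Longrightarrow> (d j *\<^sub>R a - B *v a) $ i = 0" for a
  proof (cases "\<exists>i. d i = d j \<and> a $ i \<noteq> 0")
    case True
    then show ?thesis using pos[OF that True] by simp
  next
    case False
    then have "(d j *\<^sub>R a - B *v a) $ i * a $ i = 0" for i using that[of i] by auto
    then have "(d j *\<^sub>R a - B *v a) \<bullet> a = 0"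
      unfolding inner_vec_def inner_real_def by (intro sum.neutral ballI)
    then show ?thesis by simp
  qed
  have off1: "(d j *\<^sub>R re x - B *v re x) $ i = 0" if "d i \<noteq> d j" for i
    unfolding re_T[symmetric] using x[OF that] by (simp add: re_def)
  have off2: "(d j *\<^sub>R re ((- \<i>) *s x) - B *v re ((- \<i>) *s x)) $ i = 0" if "d i \<noteq> d j" for i
    unfolding re_T[symmetric] T_rotate[symmetric] using x[OF that] by (simp add: re_def)
  note n1 = a0[OF off1] and n2 = a0[OF off2]
  show "0 \<le> s * (T B j x \<bullet> x)" unfolding T_inner distrib_left using n1 n2 by (rule add_nonneg_nonneg)
  assume i: "x $ i \<noteq> 0" "d i = d j"
  show "0 < s * (T B j x \<bullet> x)"
  proof (cases "re x $ i = 0")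
    case False
    then have "0 < s * ((d j *\<^sub>R re x - B *v re x) \<bullet> re x)" using i(2) by (intro pos off1) auto
    then show ?thesis unfolding T_inner distrib_left using n2 by (rule add_pos_nonneg)
  next
    case True
    then have "re ((- \<i>) *s x) $ i \<noteq> 0" using i(1) by (auto simp: re_def complex_eq_iff)
    then have "0 < s * ((d j *\<^sub>R re ((- \<i>) *s x) - B *v re ((- \<i>) *s x)) \<bullet> re ((- \<i>) *s x))"
      using i(2) by (intro pos off2) auto
    with n1 show ?thesis unfolding T_inner distrib_left by (rule add_nonneg_pos)
  qed
qed

text \<open>Suppose there are arbitrarily small \<open>v\<close> violating the claim. The Fourier
  coefficients of \<open>Z v\<close> divided by \<open>norm v\<close> are bounded and converge along a
  subsequence; the defect disappears in the limit. By \<open>fourier_identity\<close> the limit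
  \<open>l\<close> satisfies the support condition of \<open>T_definite\<close> at each resonant frequency,
  and the normalized values of \<open>s * (c v \<bullet> v)\<close> tend to a positive multiple of the sum
  of the corresponding forms. This sum is positive, since the diagonal entries of \<open>l\<close> form a
  unit vector.\<close>

lemma c_definite:
  assumes B: "(f has_derivative (\<lambda>x. B *v x)) (at 0)"
    and pos: "\<And>j a. resonant j \<Longrightarrow> (\<And>i. d i \<noteq> d j \<Longrightarrow> (d j *\<^sub>R a - B *v a) $ i = 0) \<Longrightarrow>
      \<exists>i. d i = d j \<and> a $ i \<noteq> 0 \<Longrightarrow> 0 < s * ((d j *\<^sub>R a - B *v a) \<bullet> a)"
  shows "\<exists>\<rho>>0. \<forall>v\<in>K. 0 < norm v \<longrightarrow> norm v < \<rho> \<longrightarrow> 0 < s * (c v \<bullet> v)"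
proof (rule ccontr)
  assume neg: "\<not> ?thesis"
  have "\<exists>v. v \<in> K \<and> 0 < norm v \<and> norm v < min (R / 2) (1 / real (Suc m)) \<and> s * (c v \<bullet> v) \<le> 0" for m
  proof -
    have "min (R / 2) (1 / real (Suc m)) > 0" using R by simp
    then show ?thesis using neg by (meson not_less)
  qed
  then obtain v where v: "\<And>m. v m \<in> K" "\<And>m. 0 < norm (v m)"
    "\<And>m. norm (v m) < min (R / 2) (1 / real (Suc m))" "\<And>m. s * (c (v m) \<bullet> v m) \<le> 0" by metis
  have vR: "norm (v m) \<le> R / 2" "norm (v m) < 1 / real (Suc m)" for m using v(3)[of m] by auto
  define X :: "nat \<Rightarrow> complex ^ 'n ^ 'n" where "X m = (\<chi> j. (1 / norm (v m)) *\<^sub>R hat j (Z (v m)))" for m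
  define r where "r m j i = hat j (defect B (v m)) $ i / of_real (norm (v m))" for m j i
  have Zc: "continuous_on UNIV (Z (v m))" for m by (rule twistedD(1)[OF Z_twisted[OF v(1) vR(1)]])
  have Xb: "norm (X m) \<le> real CARD('n) * (real CARD('n) * 2)" for m
  proof -
    have "norm (X m $ j) \<le> real CARD('n) * 2" for j
    proof (rule norm_le_card_mult)
      fix i
      have "cmod (hat j (Z (v m)) $ i) \<le> 2 * norm (v m)"
        by (rule hat_bound[OF Zc Z_bound[OF v(1) vR(1)]])
      then show "cmod (X m $ j $ i) \<le> 2" using v(2)[of m] by (simp add: X_def pos_divide_le_eq)
    qed
    then have "(\<Sum>j\<in>UNIV. norm (X m $ j)) \<le> (\<Sum>j\<in>(UNIV :: 'n set). real CARD('n) * 2)" by (intro sum_mono)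
    moreover have "norm (X m) \<le> (\<Sum>j\<in>UNIV. norm (X m $ j))"
      unfolding norm_vec_def by (rule L2_set_le_sum) simp
    ultimately show ?thesis by simp
  qed
  then have "bounded (range X)" by (auto simp: bounded_iff)
  from bounded_imp_convergent_subsequence[OF this]
  obtain l q where q: "strict_mono (q :: nat \<Rightarrow> nat)" and l: "((X \<circ> q) \<longlongrightarrow> l) sequentially" by blast
  have lj: "((\<lambda>m. X (q m) $ j) \<longlongrightarrow> l $ j) sequentially" for j
    using tendsto_vec_nth[OF l] by (simp add: o_def)
  have lji: "((\<lambda>m. X (q m) $ j $ i) \<longlongrightarrow> l $ j $ i) sequentially" for j i
    by (rule tendsto_vec_nth[OF lj])
  have Tl: "((\<lambda>m. T B j (X (q m) $ j) $ i) \<longlongrightarrow> T B j (l $ j) $ i) sequentially" for j i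
    unfolding T_nth by (intro tendsto_intros lji)
  have r0: "((\<lambda>m. r m j i) \<longlongrightarrow> 0) sequentially" for j i
  proof (rule LIMSEQ_I)
    fix \<eta> :: real assume \<eta>: "0 < \<eta>"
    then have "\<eta> / 2 > 0" by simp
    from defect_small[OF B this] obtain \<rho> where \<rho>: "\<rho> > 0"
      "\<And>u t. u \<in> K \<Longrightarrow> norm u \<le> R / 2 \<Longrightarrow> norm u < \<rho> \<Longrightarrow> norm (defect B u t) \<le> \<eta> / 2 * norm u" by blast
    obtain m0 where m0: "1 / real (Suc m0) < \<rho>" using \<rho>(1) nat_approx_posE by blast
    show "\<exists>no. \<forall>m\<ge>no. norm (r m j i - 0) < \<eta>"
    proof (intro exI allI impI)
      fix m assume "m0 \<le> m"
      then have "1 / real (Suc m) \<le> 1 / real (Suc m0)" by (intro divide_left_mono) auto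
      then have "norm (v m) < \<rho>" using vR(2)[of m] m0 by linarith
      then have "norm (defect B (v m) t) \<le> \<eta> / 2 * norm (v m)" for t by (rule \<rho>(2)[OF v(1) vR(1)])
      then have "cmod (hat j (defect B (v m)) $ i) \<le> \<eta> / 2 * norm (v m)"
        by (rule hat_bound[OF defect_continuous[OF v(1) vR(1)]])
      then have "cmod (r m j i) \<le> \<eta> / 2"
        using v(2)[of m] by (simp add: r_def norm_divide pos_divide_le_eq)
      then show "norm (r m j i - 0) < \<eta>" using \<eta> by simp
    qed
  qed
  have id: "of_real (sqrt 3) * T B j (X m $ j) $ i
      = (if d i = d j then c (v m) $ i / of_real (norm (v m)) else 0) - \<i> * r m j i"
    if "resonant j" for m j i
  proof -
    have "of_real (sqrt 3) * T B j (X m $ j) $ i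
        = (of_real (sqrt 3) * T B j (hat j (Z (v m))) $ i) / of_real (norm (v m))"
      by (simp add: X_def T_scaleR scaleR_conv_of_real[of _ "_ :: complex"] divide_inverse)
    then show ?thesis
      unfolding fourier_identity[OF v(1) vR(1) that] by (simp add: r_def diff_divide_distrib)
  qed
  have diag: "X m $ j $ j = v m $ j / of_real (norm (v m))" if "resonant j" for m j
    using hat_eq_P[OF that refl, of "Z (v m)"]
    by (simp add: X_def P_Z[OF v(1) vR(1)] scaleR_conv_of_real[of _ "_ :: complex"] divide_inverse)
  have off: "T B j (l $ j) $ i = 0" if "resonant j" "d i \<noteq> d j" for j i
  proof -
    have "((\<lambda>m. of_real (sqrt 3) * T B j (X (q m) $ j) $ i) \<longlongrightarrow> of_real (sqrt 3) * T B j (l $ j) $ i) sequentially"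
      by (intro tendsto_intros Tl)
    moreover have "((\<lambda>m. - (\<i> * r (q m) j i)) \<longlongrightarrow> - (\<i> * 0)) sequentially"
      by (intro tendsto_intros LIMSEQ_subseq_LIMSEQ[OF r0 q, unfolded o_def])
    then have "((\<lambda>m. of_real (sqrt 3) * T B j (X (q m) $ j) $ i) \<longlongrightarrow> 0) sequentially"
      using that(2) by (simp add: id[OF that(1)])
    ultimately have "of_real (sqrt 3) * T B j (l $ j) $ i = 0" by (rule LIMSEQ_unique)
    then show ?thesis by simp
  qed
  define Res where "Res = {j. resonant j}"
  have norm1: "(\<Sum>j\<in>Res. (cmod (l $ j $ j))\<^sup>2) = 1"
  proof -
    have "(\<Sum>j\<in>Res. (cmod (X m $ j $ j))\<^sup>2) = 1" for m
    proof -
      have "(\<Sum>j\<in>Res. (cmod (v m $ j))\<^sup>2) = (\<Sum>j\<in>UNIV. (cmod (v m $ j))\<^sup>2)"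
        by (rule sum.mono_neutral_left) (use v(1)[of m] in \<open>auto simp: Res_def K_def\<close>)
      also have "\<dots> = (norm (v m))\<^sup>2"
        by (simp add: norm_vec_def L2_set_def sum_nonneg)
      finally have "(\<Sum>j\<in>Res. (cmod (v m $ j))\<^sup>2) / (norm (v m))\<^sup>2 = 1" using v(2)[of m] by simp
      then show ?thesis
        by (simp add: diag Res_def norm_divide power_divide sum_divide_distrib)
    qed
    moreover have "((\<lambda>m. \<Sum>j\<in>Res. (cmod (X (q m) $ j $ j))\<^sup>2) \<longlongrightarrow> (\<Sum>j\<in>Res. (cmod (l $ j $ j))\<^sup>2)) sequentially"
      by (intro tendsto_intros lji)
    ultimately have "((\<lambda>m. 1) \<longlongrightarrow> (\<Sum>j\<in>Res. (cmod (l $ j $ j))\<^sup>2)) sequentially" by simp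
    from LIMSEQ_unique[OF this tendsto_const] show ?thesis .
  qed
  define g where "g j = s * (T B j (l $ j) $ j \<bullet> l $ j $ j)" for j
  have le0: "(\<Sum>j\<in>Res. g j) \<le> 0"
  proof (rule LIMSEQ_le_const2)
    show "((\<lambda>m. \<Sum>j\<in>Res. s * ((T B j (X (q m) $ j) $ j + \<i> * r (q m) j j / of_real (sqrt 3)) \<bullet> X (q m) $ j $ j))
        \<longlongrightarrow> (\<Sum>j\<in>Res. g j)) sequentially"
    proof -
      have "((\<lambda>m. \<Sum>j\<in>Res. s * ((T B j (X (q m) $ j) $ j + \<i> * r (q m) j j / of_real (sqrt 3)) \<bullet> X (q m) $ j $ j))
        \<longlongrightarrow> (\<Sum>j\<in>Res. s * ((T B j (l $ j) $ j + \<i> * 0 / of_real (sqrt 3)) \<bullet> l $ j $ j))) sequentially"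
        by (intro tendsto_intros Tl lji LIMSEQ_subseq_LIMSEQ[OF r0 q, unfolded o_def]) simp
      then show ?thesis by (simp add: g_def)
    qed
    show "\<exists>N. \<forall>m\<ge>N. (\<Sum>j\<in>Res. s * ((T B j (X (q m) $ j) $ j + \<i> * r (q m) j j / of_real (sqrt 3)) \<bullet> X (q m) $ j $ j)) \<le> 0"
    proof (intro exI allI impI)
      fix m
      let ?v = "v (q m)"
      have "s * ((T B j (X (q m) $ j) $ j + \<i> * r (q m) j j / of_real (sqrt 3)) \<bullet> X (q m) $ j $ j)
          = s * (c ?v $ j \<bullet> ?v $ j) / (sqrt 3 * (norm ?v)\<^sup>2)" if "j \<in> Res" for j
      proof -
        have j: "resonant j" using that by (simp add: Res_def)
        have "of_real (sqrt 3) * (T B j (X (q m) $ j) $ j + \<i> * r (q m) j j / of_real (sqrt 3))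
            = c ?v $ j / of_real (norm ?v)"
          using id[OF j, of "q m" j] by (simp add: distrib_left)
        from arg_cong[OF this, of "\<lambda>a. a / of_real (sqrt 3)"]
        have "T B j (X (q m) $ j) $ j + \<i> * r (q m) j j / of_real (sqrt 3)
            = (1 / (sqrt 3 * norm ?v)) *\<^sub>R c ?v $ j"
          by (simp only: nonzero_mult_div_cancel_left of_real_eq_0_iff real_sqrt_eq_zero_cancel_iff
              zero_neq_numeral[symmetric] not_False_eq_True)
            (simp add: scaleR_conv_of_real)
        moreover have "X (q m) $ j $ j = (1 / norm ?v) *\<^sub>R ?v $ j"
          by (simp add: diag[OF j] scaleR_conv_of_real)
        ultimately show ?thesis by (simp add: power2_eq_square)
      qed
      then have "(\<Sum>j\<in>Res. s * ((T B j (X (q m) $ j) $ j + \<i> * r (q m) j j / of_real (sqrt 3)) \<bullet> X (q m) $ j $ j))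
          = (\<Sum>j\<in>Res. s * (c ?v $ j \<bullet> ?v $ j)) / (sqrt 3 * (norm ?v)\<^sup>2)"
        by (simp add: sum_divide_distrib)
      also have "(\<Sum>j\<in>Res. s * (c ?v $ j \<bullet> ?v $ j)) = (\<Sum>j\<in>UNIV. s * (c ?v $ j \<bullet> ?v $ j))"
        by (rule sum.mono_neutral_left) (use v(1)[of "q m"] in \<open>auto simp: Res_def K_def\<close>)
      also have "\<dots> = s * (c ?v \<bullet> ?v)" by (simp add: inner_vec_def sum_distrib_left)
      also have "s * (c ?v \<bullet> ?v) / (sqrt 3 * (norm ?v)\<^sup>2) \<le> 0"
        using v(4)[of "q m"] by (intro divide_nonpos_nonneg) auto
      finally show "(\<Sum>j\<in>Res. s * ((T B j (X (q m) $ j) $ j + \<i> * r (q m) j j / of_real (sqrt 3)) \<bullet> X (q m) $ j $ j)) \<le> 0" .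
    qed
  qed
  \<comment> \<open>The indices are grouped by frequency; each group contributes a quadratic form.\<close>
  have group: "(\<Sum>i\<in>{i \<in> Res. d i = d j}. g i) = s * (T B j (l $ j) \<bullet> l $ j)" if j: "resonant j" for j
  proof -
    have same: "l $ i = l $ j" if "d i = d j" for i
    proof -
      have "X m $ i = X m $ j" for m by (simp add: X_def hat_cong[OF that])
      then have "(\<lambda>m. X (q m) $ j) = (\<lambda>m. X (q m) $ i)" by simp
      from LIMSEQ_unique[OF lj[of i] lj[of j, unfolded this]] show ?thesis .
    qed
    have Te: "T B i y = T B j y" if "d i = d j" for i y by (simp add: T_def that)
    have "{i \<in> Res. d i = d j} = {i. d i = d j}" using resonant_cong[of _ j] j by (auto simp: Res_def)
    moreover have "g i = s * (T B j (l $ j) $ i \<bullet> l $ j $ i)" if "d i = d j" for i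
      unfolding g_def same[OF that] Te[OF that] ..
    ultimately have "(\<Sum>i\<in>{i \<in> Res. d i = d j}. g i) = (\<Sum>i\<in>{i. d i = d j}. s * (T B j (l $ j) $ i \<bullet> l $ j $ i))"
      by (intro sum.cong) auto
    also have "\<dots> = (\<Sum>i\<in>UNIV. s * (T B j (l $ j) $ i \<bullet> l $ j $ i))"
      by (rule sum.mono_neutral_left) (use off[OF j] in auto)
    finally show ?thesis by (simp add: inner_vec_def sum_distrib_left)
  qed
  obtain j1 where j1: "j1 \<in> Res" "l $ j1 $ j1 \<noteq> 0"
  proof -
    have "\<not> (\<forall>j\<in>Res. (cmod (l $ j $ j))\<^sup>2 = 0)" using norm1 sum.neutral[of Res] by fastforce
    then show thesis using that by auto
  qed
  have "0 < (\<Sum>\<theta>\<in>d ` Res. \<Sum>i\<in>{i \<in> Res. d i = \<theta>}. g i)"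
  proof (rule sum_pos2)
    show "finite (d ` Res)" "d j1 \<in> d ` Res" using j1(1) by auto
    have "resonant j1" using j1 by (simp add: Res_def)
    then show "0 < (\<Sum>i\<in>{i \<in> Res. d i = d j1}. g i)"
      unfolding group[OF \<open>resonant j1\<close>]
      by (intro T_definite(2)[OF pos[OF \<open>resonant j1\<close>], where i = j1]) (auto simp: off j1)
    fix \<theta> assume "\<theta> \<in> d ` Res"
    then obtain j where j: "resonant j" "\<theta> = d j" by (auto simp: Res_def)
    show "0 \<le> (\<Sum>i\<in>{i \<in> Res. d i = \<theta>}. g i)"
      unfolding j(2) group[OF j(1)] by (rule T_definite(1)[OF pos[OF j(1)]]) (auto simp: off j(1))
  qed
  also have "\<dots> = (\<Sum>j\<in>Res. g j)" by (rule sum.image_gen[symmetric]) simp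
  finally show False using le0 by simp
qed

end

section \<open>The parameter family in eigenvector coordinates\<close>

lemma has_derivative_matrix_mult:
  fixes A :: "real ^ 'n ^ 'm"
  shows "((*v) A has_derivative (*v) A) net"
  by (rule bounded_linear_imp_has_derivative) (simp add: matrix_vector_mul_bounded_linear)

locale delay_family =
  fixes \<Lambda> :: "real set" and \<tau> :: real and V :: "real \<Rightarrow> real ^ 'n \<Rightarrow> real"
    and e :: "real \<Rightarrow> nat \<Rightarrow> real"
  assumes tau: "\<tau> > 0"
    and even: "\<And>l x. l \<in> \<Lambda> \<Longrightarrow> V l (- x) = V l x"
    and C2: "\<And>l. l \<in> \<Lambda> \<Longrightarrow> class_C2 (V l)"
    and cont_gradient: "continuous_on (\<Lambda> \<times> UNIV) (\<lambda>(l, x). gradient (V l) x)"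
    and cont_hessian: "continuous_on (\<Lambda> \<times> UNIV) (\<lambda>(l, x). hessian (V l) x)"
    and eigenvalues: "\<And>l. l \<in> \<Lambda> \<Longrightarrow> ordered_eigenvalues (hessian (V l) 0) (e l)"
begin

lemma gradient_GDERIV: "l \<in> \<Lambda> \<Longrightarrow> GDERIV (V l) x :> gradient (V l) x"
  using C2[of l] by (intro GDERIV_gradient) (auto simp: class_C2_def)

lemma gradient_odd: "l \<in> \<Lambda> \<Longrightarrow> gradient (V l) (- x) = - gradient (V l) x"
proof (rule gradient_eqI)
  assume l: "l \<in> \<Lambda>"
  have "(V l has_derivative (\<lambda>h. h \<bullet> gradient (V l) x)) (at (- (- x)))"
    using gradient_GDERIV[OF l, of x] by (simp add: gderiv_def)
  then have "((\<lambda>y. V l (- y)) has_derivative (\<lambda>h. (- h) \<bullet> gradient (V l) x)) (at (- x))"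
    by (rule has_derivative_compose[rotated]) (auto intro!: derivative_eq_intros)
  then show "GDERIV (V l) (- x) :> - gradient (V l) x"
    by (simp add: gderiv_def even[OF l])
qed

lemma gradient_has_derivative:
  "l \<in> \<Lambda> \<Longrightarrow> (gradient (V l) has_derivative (\<lambda>h. hessian (V l) x *v h)) (at x)"
  using C2[of l] unfolding hessian_def by (simp add: class_C2_def jacobian_works[symmetric])

lemma gradient_0: "l \<in> \<Lambda> \<Longrightarrow> gradient (V l) 0 = 0"
  using gradient_odd[of l 0] by (simp add: vec_eq_iff)

lemma hessian_symmetric: "l \<in> \<Lambda> \<Longrightarrow> transpose (hessian (V l) 0) = hessian (V l) 0"
proof -
  assume l: "l \<in> \<Lambda>"
  let ?B = "hessian (V l) 0"
  have sym: "(?B *v x) \<bullet> y = x \<bullet> (?B *v y)" for x y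
    by (rule derivative_of_gradient_symmetric[OF gradient_GDERIV[OF l] gradient_0[OF l]
          gradient_has_derivative[OF l]])
  have "x \<bullet> (transpose ?B *v y) = x \<bullet> (?B *v y)" for x y
    unfolding matrix_inner_transpose[symmetric] by (rule sym)
  then have "transpose ?B *v y = ?B *v y" for y by (metis vector_eq_ldot)
  then show ?thesis by (metis matrix_eq)
qed

text \<open>The problem in the coordinates \<open>y\<close> given by \<open>x = Q *v y\<close>: potential,
  gradient and Hessian at zero.\<close>

definition Vc :: "real ^ 'n ^ 'n \<Rightarrow> real \<Rightarrow> real ^ 'n \<Rightarrow> real" where
  "Vc Q l x = V l (Q *v x)"

definition fc :: "real ^ 'n ^ 'n \<Rightarrow> real \<Rightarrow> real ^ 'n \<Rightarrow> real ^ 'n" where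
  "fc Q l x = transpose Q *v gradient (V l) (Q *v x)"

definition Bc :: "real ^ 'n ^ 'n \<Rightarrow> real \<Rightarrow> real ^ 'n ^ 'n" where
  "Bc Q l = transpose Q ** hessian (V l) 0 ** Q"

lemma Vc_GDERIV: assumes "l \<in> \<Lambda>" shows "GDERIV (Vc Q l) x :> fc Q l x"
proof -
  have "((\<lambda>x. V l (Q *v x)) has_derivative (\<lambda>h. (Q *v h) \<bullet> gradient (V l) (Q *v x))) (at x)"
    by (rule has_derivative_compose[OF has_derivative_matrix_mult])
      (use gradient_GDERIV[OF assms] in \<open>simp add: gderiv_def\<close>)
  then show ?thesis
    unfolding gderiv_def Vc_def[abs_def] fc_def matrix_inner_transpose .
qed

lemma fc_has_derivative: assumes "l \<in> \<Lambda>" shows "(fc Q l has_derivative (\<lambda>x. Bc Q l *v x)) (at 0)"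
proof -
  have "((\<lambda>x. gradient (V l) (Q *v x)) has_derivative (\<lambda>h. hessian (V l) 0 *v (Q *v h))) (at 0)"
    by (rule has_derivative_compose[OF has_derivative_matrix_mult])
      (use gradient_has_derivative[OF assms, of 0] in simp)
  from has_derivative_compose[OF this has_derivative_matrix_mult]
  show ?thesis unfolding fc_def[abs_def] Bc_def matrix_vector_mul_assoc matrix_mul_assoc .
qed

lemma Bc_symmetric: "l \<in> \<Lambda> \<Longrightarrow> transpose (Bc Q l) = Bc Q l"
  by (simp add: Bc_def matrix_transpose_mul hessian_symmetric matrix_mul_assoc)

lemma Bc_eigenbasis:
  assumes l: "l \<in> \<Lambda>" and Q: "orthogonal_matrix Q" and h: "bij_betw h (UNIV :: 'n set) {1..CARD('n)}"
  obtains Q' where "orthogonal_matrix Q'" "\<And>i. Bc Q l *v column i Q' = e l (h i) *\<^sub>R column i Q'"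
proof -
  obtain U where U: "orthogonal_matrix U" "\<And>i. hessian (V l) 0 *v column i U = e l (h i) *\<^sub>R column i U"
    using ordered_eigenbasis[OF hessian_symmetric[OF l] eigenvalues[OF l] h] by blast
  have col: "column i (transpose Q ** U) = transpose Q *v column i U" for i
    by (simp add: vec_eq_iff column_def matrix_matrix_mult_def matrix_vector_mult_def)
  have "Bc Q l *v (transpose Q *v y) = transpose Q *v (hessian (V l) 0 *v y)" for y
  proof -
    have "Bc Q l *v (transpose Q *v y) = transpose Q *v (hessian (V l) 0 *v (Q *v (transpose Q *v y)))"
      by (simp only: Bc_def matrix_vector_mul_assoc matrix_mul_assoc)
    then show ?thesis by (simp only: orthogonal_matrix_facts(2)[OF Q])
  qed
  then have "Bc Q l *v column i (transpose Q ** U) = e l (h i) *\<^sub>R column i (transpose Q ** U)" for i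
    unfolding col by (simp only: U(2) matrix_vector_mult_scaleR)
  moreover have "orthogonal_matrix (transpose Q ** U)"
    by (intro orthogonal_matrix_mul U(1)) (use Q in \<open>simp add: orthogonal_matrix_transpose\<close>)
  ultimately show thesis by (rule that[rotated])
qed

lemma solution_conjugate:
  assumes l: "l \<in> \<Lambda>" and Q: "orthogonal_matrix Q"
    and x: "\<And>t. (x has_vector_derivative fc Q l (x (t - \<tau>)) + fc Q l (x (t - 2 * \<tau>))) (at t)"
    and anti: "\<And>t. x (t + 3 * \<tau>) = - x t"
  shows "solution \<tau> (V) l (\<lambda>t. Q *v x t)"
  unfolding solution_def
proof (intro conjI allI)
  fix t
  have "((\<lambda>t. Q *v x t) has_vector_derivative
      Q *v (fc Q l (x (t - \<tau>)) + fc Q l (x (t - 2 * \<tau>)))) (at t)"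
    by (rule bounded_linear.has_vector_derivative[OF matrix_vector_mul_bounded_linear x])
  then show "((\<lambda>t. Q *v x t) has_vector_derivative
      gradient (V l) (Q *v x (t - \<tau>)) + gradient (V l) (Q *v x (t - 2 * \<tau>))) (at t)"
    by (simp only: matrix_vector_right_distrib fc_def orthogonal_matrix_facts(2)[OF Q])
  show "Q *v x (t + 3 * \<tau>) = - (Q *v x t)"
    unfolding anti by (simp add: vec_eq_iff matrix_vector_mult_def sum_negf)
qed

lemma conjugate_solution:
  assumes Q: "orthogonal_matrix Q" and x: "solution \<tau> V l x"
  shows "((\<lambda>t. transpose Q *v x t) has_vector_derivative
      fc Q l (transpose Q *v x (t - \<tau>)) + fc Q l (transpose Q *v x (t - 2 * \<tau>))) (at t)"
    and "transpose Q *v x (t + 3 * \<tau>) = - (transpose Q *v x t)"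
proof -
  have "(x has_vector_derivative gradient (V l) (x (t - \<tau>)) + gradient (V l) (x (t - 2 * \<tau>))) (at t)"
    and anti: "x (t + 3 * \<tau>) = - x t"
    using x by (auto simp: solution_def)
  from bounded_linear.has_vector_derivative[OF matrix_vector_mul_bounded_linear this(1), of "transpose Q"]
  show "((\<lambda>t. transpose Q *v x t) has_vector_derivative
      fc Q l (transpose Q *v x (t - \<tau>)) + fc Q l (transpose Q *v x (t - 2 * \<tau>))) (at t)"
    by (simp only: matrix_vector_right_distrib fc_def orthogonal_matrix_facts(2)[OF Q])
  show "transpose Q *v x (t + 3 * \<tau>) = - (transpose Q *v x t)"
    unfolding anti by (simp add: vec_eq_iff matrix_vector_mult_def sum_negf)
qed

text \<open>The mean value inequality, since the Hessian is close to its value at \<open>(\<mu>, 0)\<close>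
  for nearby parameters and points.\<close>

lemma gradient_near_linear:
  assumes \<mu>: "\<mu> \<in> \<Lambda>" and \<epsilon>: "\<epsilon> > 0"
  obtains \<delta> R where "\<delta> > 0" "R > 0"
    "\<And>l x y. l \<in> \<Lambda> \<Longrightarrow> \<bar>l - \<mu>\<bar> < \<delta> \<Longrightarrow> norm x \<le> R \<Longrightarrow> norm y \<le> R \<Longrightarrow>
      norm ((gradient (V l) x - hessian (V \<mu>) 0 *v x) - (gradient (V l) y - hessian (V \<mu>) 0 *v y))
        \<le> \<epsilon> * norm (x - y)"
proof -
  define B where "B = hessian (V \<mu>) 0"
  define k where "k = real CARD('n) * real CARD('n)"
  have k: "k > 0" by (simp add: k_def)
  have "(\<mu>, 0) \<in> \<Lambda> \<times> (UNIV :: (real ^ 'n) set)" using \<mu> by simp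
  moreover have "\<epsilon> / k > 0" using \<epsilon> k by simp
  ultimately obtain \<rho> where \<rho>: "\<rho> > 0"
    "\<forall>p\<in>\<Lambda> \<times> UNIV. dist p (\<mu>, 0) < \<rho> \<longrightarrow> dist (hessian (V (fst p)) (snd p)) B < \<epsilon> / k"
    using cont_hessian unfolding continuous_on_iff B_def by (fastforce simp: case_prod_unfold)
  show thesis
  proof (rule that[of "\<rho> / 2" "\<rho> / 3"])
    fix l and x y :: "real ^ 'n"
    assume l: "l \<in> \<Lambda>" "\<bar>l - \<mu>\<bar> < \<rho> / 2" and xy: "norm x \<le> \<rho> / 3" "norm y \<le> \<rho> / 3"
    show "norm ((gradient (V l) x - hessian (V \<mu>) 0 *v x) - (gradient (V l) y - hessian (V \<mu>) 0 *v y))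
        \<le> \<epsilon> * norm (x - y)"
      unfolding B_def[symmetric]
    proof (rule differentiable_bound)
      show "convex (cball (0 :: real ^ 'n) (\<rho> / 3))" by (rule convex_cball)
      fix z :: "real ^ 'n" assume z: "z \<in> cball 0 (\<rho> / 3)"
      have "((\<lambda>x. gradient (V l) x - B *v x) has_derivative (\<lambda>h. hessian (V l) z *v h - B *v h)) (at z)"
        by (intro has_derivative_diff gradient_has_derivative l(1) has_derivative_matrix_mult)
      then show "((\<lambda>x. gradient (V l) x - B *v x) has_derivative (*v) (hessian (V l) z - B)) (at z within cball 0 (\<rho> / 3))"
      proof -
        have "(*v) (hessian (V l) z - B) = (\<lambda>h. hessian (V l) z *v h - B *v h)"
          by (simp add: fun_eq_iff matrix_vector_mult_diff_rdistrib)
        with \<open>(_ has_derivative _) (at z)\<close> show ?thesis by (simp only: has_derivative_at_withinI)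
      qed
      have "dist (l, z) (\<mu>, 0) \<le> \<bar>l - \<mu>\<bar> + norm z"
        using sqrt_sum_squares_le_sum_abs[of "dist l \<mu>" "dist z 0"]
        unfolding dist_Pair_Pair by (simp add: dist_real_def)
      also have "\<dots> < \<rho>" using l(2) z \<rho>(1) by simp
      finally have "norm (hessian (V l) z - B) < \<epsilon> / k"
        using \<rho>(2) l(1) by (force simp: dist_norm)
      then have "\<bar>(hessian (V l) z - B) $ i $ j\<bar> \<le> \<epsilon> / k" for i j
        using component_le_norm_cart[of "(hessian (V l) z - B) $ i" j]
          Finite_Cartesian_Product.norm_nth_le[of "hessian (V l) z - B" i] by linarith
      then have "onorm ((*v) (hessian (V l) z - B)) \<le> real CARD('n) * real CARD('n) * (\<epsilon> / k)"
        by (rule onorm_le_matrix_component)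
      also have "\<dots> = \<epsilon>" using k by (simp add: k_def)
      finally show "onorm ((*v) (hessian (V l) z - B)) \<le> \<epsilon>" .
    qed (use xy in auto)
  qed (use \<rho> in auto)
qed

text \<open>The number \<open>\<epsilon>\<close> is chosen below all gaps between distinct eigenvalues at
  \<open>\<mu>\<close>, for \<open>eigenvalue_order_definite\<close>, and so small that the reduced equation
  is a contraction.\<close>

lemma normal_form:
  assumes \<mu>: "\<mu> \<in> \<Lambda>" and h: "bij_betw h (UNIV :: 'n set) {1..CARD('n)}"
    and d: "\<And>i. d i = e \<mu> (h i)"
  obtains Q R \<epsilon> \<delta> where "orthogonal_matrix Q" "\<delta> > 0"
    "\<And>l. l \<in> \<Lambda> \<Longrightarrow> \<bar>l - \<mu>\<bar> < \<delta> \<Longrightarrow> nonlinearity \<tau> d R \<epsilon> (fc Q l) (Vc Q l)"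
    "\<And>l x. l \<in> \<Lambda> \<Longrightarrow> \<bar>l - \<mu>\<bar> < \<delta> \<Longrightarrow> norm (Bc Q l *v x - (\<chi> i. d i * x $ i)) \<le> \<epsilon> * norm x"
    "\<And>i j. d i \<noteq> d j \<Longrightarrow> \<epsilon> \<le> \<bar>d i - d j\<bar>"
proof -
  obtain Q where Q: "orthogonal_matrix Q" and Qd: "\<And>i. hessian (V \<mu>) 0 *v column i Q = d i *\<^sub>R column i Q"
    unfolding d using ordered_eigenbasis[OF hessian_symmetric[OF \<mu>] eigenvalues[OF \<mu>] h] by blast
  interpret resonance \<tau> d by unfold_locales (rule tau)
  \<comment> \<open>The element 1 makes the set nonempty when all eigenvalues coincide.\<close>
  define gaps where "gaps = insert 1 ((\<lambda>(i, j). \<bar>d i - d j\<bar>) ` {(i, j). d i \<noteq> d j})"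
  have gaps: "finite gaps" "gaps \<noteq> {}" "\<forall>g\<in>gaps. 0 < g" unfolding gaps_def by auto
  define \<epsilon> where "\<epsilon> = min (Min gaps) (1 / (8 * (green_bound + 1)))"
  have gp: "green_bound + 1 > 0" using green_bound_nonneg by simp
  have \<epsilon>: "\<epsilon> > 0" using gaps gp by (simp add: \<epsilon>_def)
  have small: "8 * \<epsilon> * green_bound \<le> 1"
  proof -
    have "\<epsilon> \<le> 1 / (8 * (green_bound + 1))" by (simp add: \<epsilon>_def)
    then have "8 * \<epsilon> * (green_bound + 1) \<le> 1" using gp by (simp add: field_simps)
    then show ?thesis using \<epsilon> by (simp add: algebra_simps)
  qed
  have gap: "\<epsilon> \<le> \<bar>d i - d j\<bar>" if "d i \<noteq> d j" for i j
  proof -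
    have "Min gaps \<le> \<bar>d i - d j\<bar>" using gaps(1) that by (intro Min_le) (auto simp: gaps_def)
    then show ?thesis by (simp add: \<epsilon>_def)
  qed
  obtain \<delta> R where \<delta>: "\<delta> > 0" and R: "R > 0" and near:
    "\<And>l x y. l \<in> \<Lambda> \<Longrightarrow> \<bar>l - \<mu>\<bar> < \<delta> \<Longrightarrow> norm x \<le> R \<Longrightarrow> norm y \<le> R \<Longrightarrow>
      norm ((gradient (V l) x - hessian (V \<mu>) 0 *v x) - (gradient (V l) y - hessian (V \<mu>) 0 *v y))
        \<le> \<epsilon> * norm (x - y)"
    using gradient_near_linear[OF \<mu> \<epsilon>] by metis
  have diag: "transpose Q *v (hessian (V \<mu>) 0 *v (Q *v x)) = D x" for x
  proof -
    have "hessian (V \<mu>) 0 *v (Q *v x) = (\<Sum>i\<in>UNIV. x $ i *\<^sub>R (hessian (V \<mu>) 0 *v column i Q))"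
      unfolding matrix_mult_sum[of Q]
      by (simp add: linear_sum[OF matrix_vector_mul_linear] matrix_vector_mult_scaleR scalar_mult_eq_scaleR)
    also have "\<dots> = Q *v D x"
      unfolding matrix_mult_sum[of Q] by (simp add: Qd D_def scalar_mult_eq_scaleR mult.commute)
    finally show ?thesis by (simp only: orthogonal_matrix_facts(1)[OF Q])
  qed
  have nd: "near_diagonal R \<epsilon> (fc Q l)" if l: "l \<in> \<Lambda>" "\<bar>l - \<mu>\<bar> < \<delta>" for l
    unfolding near_diagonal_def
  proof (intro conjI allI impI)
    have mm: "A *v (- x) = - (A *v x)" for A :: "real ^ 'n ^ 'n" and x
      by (simp add: vec_eq_iff matrix_vector_mult_def sum_negf)
    show "fc Q l (- x) = - fc Q l x" for x by (simp only: fc_def mm gradient_odd[OF l(1)])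
    fix x y :: "real ^ 'n" assume xy: "norm x \<le> R" "norm y \<le> R"
    have "fc Q l x - D x - (fc Q l y - D y)
        = transpose Q *v ((gradient (V l) (Q *v x) - hessian (V \<mu>) 0 *v (Q *v x))
            - (gradient (V l) (Q *v y) - hessian (V \<mu>) 0 *v (Q *v y)))"
      by (simp only: matrix_vector_mult_diff_distrib diag fc_def)
    also have "norm \<dots> \<le> \<epsilon> * norm (Q *v x - Q *v y)"
      unfolding orthogonal_matrix_facts(6)[OF Q]
      by (rule near[OF l]) (simp_all only: orthogonal_matrix_facts(5)[OF Q] xy)
    also have "norm (Q *v x - Q *v y) = norm (x - y)"
      by (simp only: matrix_vector_mult_diff_distrib[symmetric] orthogonal_matrix_facts(5)[OF Q])
    finally show "norm (fc Q l x - D x - (fc Q l y - D y)) \<le> \<epsilon> * norm (x - y)" .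
  qed
  have nl: "nonlinearity \<tau> d R \<epsilon> (fc Q l) (Vc Q l)" if "l \<in> \<Lambda>" "\<bar>l - \<mu>\<bar> < \<delta>" for l
    by unfold_locales (use R \<epsilon> small nd[OF that] Vc_GDERIV[OF that(1)] in auto)
  have close: "norm (Bc Q l *v x - (\<chi> i. d i * x $ i)) \<le> \<epsilon> * norm x"
    if l: "l \<in> \<Lambda>" "\<bar>l - \<mu>\<bar> < \<delta>" for l x
  proof (rule field_le_epsilon)
    fix \<eta> :: real assume \<eta>: "\<eta> > 0"
    define k where "k = \<eta> / (norm x + 1)"
    have nx: "0 < norm x + 1" using norm_ge_zero[of x] by linarith
    have k: "k > 0" using \<eta> nx by (simp add: k_def)
    have f0: "fc Q l 0 = 0" by (rule near_diagonal_0[OF nd[OF l]])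
    obtain r where r: "r > 0" "\<And>y. norm y < r \<Longrightarrow> norm (fc Q l y - Bc Q l *v y) \<le> k * norm y"
      using fc_has_derivative[OF l(1), of Q] k unfolding has_derivative_at_alt by (auto simp: f0)
    \<comment> \<open>Scaling by \<open>t\<close> moves \<open>x\<close> to where the derivative and the Lipschitz estimate are available.\<close>
    define t where "t = min R (r / 2) / (norm x + 1)"
    have t: "t > 0" using R r nx by (simp add: t_def)
    have tx: "norm (t *\<^sub>R x) \<le> min R (r / 2)"
    proof -
      have "norm (t *\<^sub>R x) \<le> t * (norm x + 1)" using t by simp
      also have "\<dots> = min R (r / 2)" using nx by (simp add: t_def)
      finally show ?thesis .
    qed
    have "norm ((fc Q l (t *\<^sub>R x) - D (t *\<^sub>R x)) - (fc Q l 0 - D 0)) \<le> \<epsilon> * norm (t *\<^sub>R x - 0)"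
      using nd[OF l] tx R unfolding near_diagonal_def by (metis min.boundedE norm_zero order_less_imp_le)
    moreover have "D 0 = 0" by (simp add: D_def vec_eq_iff)
    ultimately have 1: "norm (fc Q l (t *\<^sub>R x) - D (t *\<^sub>R x)) \<le> \<epsilon> * norm (t *\<^sub>R x)" by (simp add: f0)
    have 2: "norm (fc Q l (t *\<^sub>R x) - Bc Q l *v (t *\<^sub>R x)) \<le> k * norm (t *\<^sub>R x)"
      using tx r by (intro r(2)) auto
    have "Bc Q l *v (t *\<^sub>R x) - D (t *\<^sub>R x) = t *\<^sub>R (Bc Q l *v x - (\<chi> i. d i * x $ i))"
      by (simp add: matrix_vector_mult_scaleR scaleR_diff_right D_def vec_eq_iff algebra_simps)
    then have "t * norm (Bc Q l *v x - (\<chi> i. d i * x $ i)) = norm (Bc Q l *v (t *\<^sub>R x) - D (t *\<^sub>R x))"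
      using t by simp
    also have "\<dots> \<le> \<epsilon> * norm (t *\<^sub>R x) + k * norm (t *\<^sub>R x)"
      using norm_triangle_ineq4[of "fc Q l (t *\<^sub>R x) - D (t *\<^sub>R x)" "fc Q l (t *\<^sub>R x) - Bc Q l *v (t *\<^sub>R x)"] 1 2
      by simp
    also have "\<dots> = t * (\<epsilon> * norm x + k * norm x)" using t by (simp add: algebra_simps)
    finally have "norm (Bc Q l *v x - (\<chi> i. d i * x $ i)) \<le> \<epsilon> * norm x + k * norm x"
      using t by simp
    also have "k * norm x \<le> \<eta>" using \<eta> nx by (simp add: k_def field_simps)
    finally show "norm (Bc Q l *v x - (\<chi> i. d i * x $ i)) \<le> \<epsilon> * norm x + \<eta>" by simp
  qed
  show thesis by (rule that[OF Q \<delta> nl close gap])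
qed

end

section \<open>Small solutions at a crossing of resonant eigenvalues\<close>

text \<open>The reduced gradient depends on the nonlinearity uniformly in \<open>v\<close> by
  \<open>reduced_P_N_close\<close>.\<close>

lemma (in resonance) reduced_maps_converge:
  fixes f :: "nat \<Rightarrow> real ^ 'n \<Rightarrow> real ^ 'n"
  assumes nf: "\<And>k. nonlinearity \<tau> d R \<epsilon> (f k) (V k)" and ng: "nonlinearity \<tau> d R \<epsilon> g W"
    and lim: "uniform_limit (cball 0 R) f g sequentially" and r: "r \<le> R / 2"
  shows "uniform_limit (K \<inter> cball 0 r) (\<lambda>k. nonlinearity.c \<tau> d R (f k)) (nonlinearity.c \<tau> d R g) sequentially"
proof (rule uniform_limitI)
  fix \<eta> :: real assume \<eta>: "\<eta> > 0"
  interpret g: nonlinearity \<tau> d R \<epsilon> g W by (rule ng)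
  define C where "C = real CARD('n) * (4 * (\<epsilon> * (2 * (4 * green_bound)) + 1)) + 1"
  have C: "C > 0" using g.\<epsilon>(1) green_bound_nonneg by (auto simp: C_def intro!: add_nonneg_pos)
  have "\<forall>\<^sub>F k in sequentially. \<forall>x\<in>cball 0 R. dist (f k x) (g x) < \<eta> / C"
    by (rule uniform_limitD[OF lim]) (use \<eta> C in simp)
  then show "\<forall>\<^sub>F k in sequentially. \<forall>v\<in>K \<inter> cball 0 r.
      dist (nonlinearity.c \<tau> d R (f k) v) (nonlinearity.c \<tau> d R g v) < \<eta>"
  proof eventually_elim
    case (elim k)
    interpret f: nonlinearity \<tau> d R \<epsilon> "f k" "V k" by (rule nf)
    show ?case
    proof
      fix v assume "v \<in> K \<inter> cball 0 r"
      then have v: "v \<in> K" "norm v \<le> R / 2" using r by auto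
      have "f.c v - g.c v = \<i> *s (P (\<lambda>t. N (f k) (f.Z v t)) - P (\<lambda>t. N g (g.Z v t)))"
        by (simp add: f.c_def g.c_def vector_ssub_ldistrib)
      then have "norm (f.c v - g.c v) = norm (P (\<lambda>t. N (f k) (f.Z v t)) - P (\<lambda>t. N g (g.Z v t)))"
        by (simp only: norm_vector_scalar_mult norm_ii mult_1)
      also have "\<dots> \<le> real CARD('n) * (4 * (\<epsilon> * (2 * (norm (v - v) + 4 * (\<eta> / C) * green_bound)) + \<eta> / C))"
        by (rule reduced_P_N_close[OF f.near g.near f.\<epsilon> f.Z_reduced[OF v] g.Z_reduced[OF v]])
          (use elim in \<open>auto simp: dist_norm intro: less_imp_le\<close>)
      also have "\<dots> = (C - 1) * (\<eta> / C)"
      proof -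
        have "real CARD('n) * (4 * (\<epsilon> * (2 * (norm (v - v) + 4 * y * green_bound)) + y))
            = real CARD('n) * (4 * (\<epsilon> * (2 * (4 * green_bound)) + 1)) * y" for y
          by (simp add: algebra_simps)
        moreover have "C - 1 = real CARD('n) * (4 * (\<epsilon> * (2 * (4 * green_bound)) + 1))"
          by (simp add: C_def)
        ultimately show ?thesis by (simp only:)
      qed
      also have "\<dots> < C * (\<eta> / C)" using C \<eta> by (intro mult_strict_right_mono) auto
      also have "\<dots> = \<eta>" using C by simp
      finally show "dist (f.c v) (g.c v) < \<eta>" by (simp add: dist_norm)
    qed
  qed
qed

context delay_family begin

lemma gradients_converge:
  assumes \<mu>: "\<mu> \<in> \<Lambda>" and l: "\<And>k. l k \<in> \<Lambda>" "l \<longlonglongrightarrow> \<mu>" and Q: "orthogonal_matrix Q"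
  shows "uniform_limit (cball 0 R) (\<lambda>k. fc Q (l k)) (fc Q \<mu>) sequentially"
proof (rule uniform_limitI)
  fix \<eta> :: real assume \<eta>: "\<eta> > 0"
  define g where "g = (\<lambda>(l, x). gradient (V l) x)"
  have g: "continuous_on (\<Lambda> \<times> cball 0 R) g"
    unfolding g_def by (rule continuous_on_subset[OF cont_gradient]) auto
  have \<eta>2: "\<eta> / 2 > 0" using \<eta> by simp
  obtain X where X: "\<mu> \<in> X" "open X"
    "\<forall>l\<in>X \<inter> \<Lambda>. \<forall>x\<in>cball 0 R. dist (g (l, x)) (g (\<mu>, x)) \<le> \<eta> / 2"
    by (rule continuous_on_prod_compactE[OF g compact_cball \<mu> \<eta>2])
  have "\<forall>\<^sub>F k in sequentially. l k \<in> X" using l(2) X(2,1) by (rule topological_tendstoD)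
  then show "\<forall>\<^sub>F k in sequentially. \<forall>x\<in>cball 0 R. dist (fc Q (l k) x) (fc Q \<mu> x) < \<eta>"
  proof eventually_elim
    case (elim k)
    show ?case
    proof
      fix x :: "real ^ 'n" assume "x \<in> cball 0 R"
      then have "Q *v x \<in> cball 0 R" by (simp add: orthogonal_matrix_facts(5)[OF Q])
      then have "dist (gradient (V (l k)) (Q *v x)) (gradient (V \<mu>) (Q *v x)) \<le> \<eta> / 2"
        using X(3) elim l(1)[of k] by (auto simp: g_def)
      moreover have "norm (fc Q (l k) x - fc Q \<mu> x) = norm (gradient (V (l k)) (Q *v x) - gradient (V \<mu>) (Q *v x))"
        by (simp only: fc_def matrix_vector_mult_diff_distrib[symmetric] orthogonal_matrix_facts(6)[OF Q])
      ultimately show "dist (fc Q (l k) x) (fc Q \<mu> x) < \<eta>" using \<eta> by (simp add: dist_norm)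
    qed
  qed
qed

definition resonances :: "real \<Rightarrow> nat set" where
  "resonances l = resonant_indices CARD('n) \<tau> (e l)"

lemma eigenvalues_mono: "l \<in> \<Lambda> \<Longrightarrow> mono_on {1..CARD('n)} (e l)"
  using eigenvalues[of l] by (simp add: ordered_eigenvalues_def)

text \<open>If none of the parameters involved had a nonzero solution bounded by \<open>r\<close>, the
  reduced gradients would have no zeros in a common punctured ball. Along \<open>lm\<close> the action has
  local minima at zero, along \<open>lp\<close> local maxima, and
  \<open>no_passage_from_minima_to_maxima\<close> excludes this.\<close>

theorem small_solution_exists:
  assumes \<mu>: "\<mu> \<in> \<Lambda>" and ne: "resonances \<mu> \<noteq> {}" and r: "r > 0"
    and lm: "\<And>k :: nat. lm k \<in> \<Lambda>" "lm \<longlonglongrightarrow> \<mu>" and lp: "\<And>k :: nat. lp k \<in> \<Lambda>" "lp \<longlonglongrightarrow> \<mu>"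
    and em: "\<And>k j. j \<in> resonances \<mu> \<Longrightarrow> e (lm k) j < e \<mu> j"
    and ep: "\<And>k j. j \<in> resonances \<mu> \<Longrightarrow> e \<mu> j < e (lp k) j"
  shows "\<exists>l\<in>{\<mu>} \<union> range lm \<union> range lp. \<exists>x. nonzero_solution \<tau> V l x \<and> (\<forall>t. norm (x t) \<le> r)"
proof (rule ccontr)
  assume none: "\<not> ?thesis"
  obtain h where h: "bij_betw h (UNIV :: 'n set) {1..CARD('n)}"
    using finite_same_card_bij[of "UNIV :: 'n set" "{1..CARD('n)}"] by auto
  define d where "d i = e \<mu> (h i)" for i
  obtain Q R \<epsilon> \<delta> where Q: "orthogonal_matrix Q" and \<delta>: "\<delta> > 0"
    and nl: "\<And>l. l \<in> \<Lambda> \<Longrightarrow> \<bar>l - \<mu>\<bar> < \<delta> \<Longrightarrow> nonlinearity \<tau> d R \<epsilon> (fc Q l) (Vc Q l)"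
    and close: "\<And>l x. l \<in> \<Lambda> \<Longrightarrow> \<bar>l - \<mu>\<bar> < \<delta> \<Longrightarrow> norm (Bc Q l *v x - (\<chi> i. d i * x $ i)) \<le> \<epsilon> * norm x"
    and gap: "\<And>i j. d i \<noteq> d j \<Longrightarrow> \<epsilon> \<le> \<bar>d i - d j\<bar>"
    by (rule normal_form[OF \<mu> h d_def]) (rule that)
  interpret \<mu>: nonlinearity \<tau> d R \<epsilon> "fc Q \<mu>" "Vc Q \<mu>" by (rule nl) (use \<mu> \<delta> in auto)
  have hj: "h i \<in> {1..CARD('n)}" for i using h by (auto simp: bij_betw_def)
  have res: "\<mu>.resonant i \<longleftrightarrow> h i \<in> resonances \<mu>" for i
    using hj[of i] by (simp add: \<mu>.resonant_iff_value resonances_def resonant_indices_def d_def)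
  have d_less: "h i < h j" if "d i < d j" for i j
  proof (rule ccontr)
    assume "\<not> h i < h j"
    then have "d j \<le> d i" using eigenvalues_mono[OF \<mu>] hj by (auto simp: d_def mono_on_def)
    then show False using that by simp
  qed
  define K where "K = \<mu>.K"
  define c where "c l = nonlinearity.c \<tau> d R (fc Q l)" for l
  define \<phi> where "\<phi> l = nonlinearity.\<phi> \<tau> d R (fc Q l) (Vc Q l)" for l
  define L where "L = \<mu>.curvature_bound \<epsilon>"
  have definite: "\<exists>\<rho>>0. \<forall>v\<in>K. 0 < norm v \<longrightarrow> norm v < \<rho> \<longrightarrow> 0 < s * (c l v \<bullet> v)"
    if l: "l \<in> \<Lambda>" "\<bar>l - \<mu>\<bar> < \<delta>" and s: "s = 1 \<or> s = - 1"
      and move: "\<And>j. j \<in> resonances \<mu> \<Longrightarrow> 0 < s * (e \<mu> j - e l j)" for l s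
  proof -
    interpret l: nonlinearity \<tau> d R \<epsilon> "fc Q l" "Vc Q l" by (rule nl[OF l])
    obtain Q' where Q': "orthogonal_matrix Q'" "\<And>i. Bc Q l *v column i Q' = e l (h i) *\<^sub>R column i Q'"
      using Bc_eigenbasis[OF l(1) Q h] by blast
    show ?thesis unfolding K_def c_def
    proof (rule l.c_definite[OF fc_has_derivative[OF l(1)]])
      fix j a assume j: "\<mu>.resonant j" and off: "\<And>i. d i \<noteq> d j \<Longrightarrow> (d j *\<^sub>R a - Bc Q l *v a) $ i = 0"
        and on: "\<exists>i. d i = d j \<and> a $ i \<noteq> 0"
      from on obtain i0 where i0: "d i0 = d j" "a $ i0 \<noteq> 0" by blast
      show "0 < s * ((d j *\<^sub>R a - Bc Q l *v a) \<bullet> a)"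
      proof (rule eigenvalue_order_definite[OF Bc_symmetric[OF l(1)] Q' _ d_less close[OF l] gap s _ off i0])
        show "mono_on (range h) (e l)" using eigenvalues_mono[OF l(1)] h by (simp add: bij_betw_def)
        show "0 < s * (d j - e l (h i))" if "d i = d j" for i
        proof -
          have "\<mu>.resonant i" using j \<mu>.resonant_cong[OF that] by simp
          then have "0 < s * (e \<mu> (h i) - e l (h i))" by (intro move) (simp add: res)
          then show ?thesis using that by (simp add: d_def)
        qed
      qed
    qed
  qed
  define r' where "r' = min (R / 2) (r / 2)"
  have r': "r' > 0" "r' \<le> R / 2" "2 * r' \<le> r" using r \<mu>.R by (auto simp: r'_def)
  have grad: "quadratic_gradient K r' L (\<phi> l) (c l)" and cont: "continuous_on (K \<inter> cball 0 r') (c l)"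
    if l: "l \<in> \<Lambda>" "\<bar>l - \<mu>\<bar> < \<delta>" for l
  proof -
    interpret l: nonlinearity \<tau> d R \<epsilon> "fc Q l" "Vc Q l" by (rule nl[OF l])
    show "quadratic_gradient K r' L (\<phi> l) (c l)" unfolding K_def L_def \<phi>_def c_def
      by (rule quadratic_gradient_subset[OF l.quadratic_gradient_action r'(2)])
    show "continuous_on (K \<inter> cball 0 r') (c l)" unfolding K_def c_def
      by (rule continuous_on_subset[OF l.c_continuous]) (use r' in auto)
  qed
  have nz: "c l v \<noteq> 0" if l: "l \<in> {\<mu>} \<union> range lm \<union> range lp" "\<bar>l - \<mu>\<bar> < \<delta>"
    and v: "v \<in> K" "0 < norm v" "norm v \<le> r'" for l v
  proof
    assume zero: "c l v = 0"
    have l\<Lambda>: "l \<in> \<Lambda>" using l(1) \<mu> lm(1) lp(1) by auto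
    interpret l: nonlinearity \<tau> d R \<epsilon> "fc Q l" "Vc Q l" by (rule nl[OF l\<Lambda> l(2)])
    have v': "v \<in> \<mu>.K" "norm v \<le> R / 2" "l.c v = 0" using v r' zero by (auto simp: K_def c_def)
    note sol = l.zero_of_c_solution[OF v']
    define x where "x t = Q *v re (l.Z v t)" for t
    have "solution \<tau> V l x" unfolding x_def by (rule solution_conjugate[OF l\<Lambda> Q sol(1,2)])
    moreover have "\<exists>t. x t \<noteq> 0"
    proof (rule ccontr)
      assume "\<not> (\<exists>t. x t \<noteq> 0)"
      then have "norm (re (l.Z v t)) = 0" for t
        using orthogonal_matrix_facts(5)[OF Q, of "re (l.Z v t)"] by (simp add: x_def)
      then have x0: "re (l.Z v t) = 0" for t by simp
      have "l.Z v t = 0" for t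
        by (rule re_om_eq_0_imp_eq_0[OF x0]) (simp only: x0 \<mu>.twisted_backwards(1)[OF l.Z_twisted[OF v'(1,2)], symmetric])
      then have "\<mu>.P (l.Z v) = 0" by (simp add: \<mu>.P_def vec_eq_iff)
      then show False using l.P_Z[OF v'(1,2)] v(2) by simp
    qed
    moreover have "norm (x t) \<le> r" for t
      using sol(3)[of t] v(3) r'(3) by (simp add: x_def orthogonal_matrix_facts(5)[OF Q])
    ultimately show False using none l(1) unfolding nonzero_solution_def by blast
  qed
  have tail: "\<exists>m. \<forall>k. \<bar>l (k + m) - \<mu>\<bar> < \<delta>" if "l \<longlonglongrightarrow> \<mu>" for l
    using LIMSEQ_D[OF that \<delta>] by (metis le_add2 real_norm_def)
  obtain m where m: "\<And>k. \<bar>lm (k + m) - \<mu>\<bar> < \<delta>" using tail[OF lm(2)] by blast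
  obtain p where p: "\<And>k. \<bar>lp (k + p) - \<mu>\<bar> < \<delta>" using tail[OF lp(2)] by blast
  have mu: "\<mu> \<in> \<Lambda>" "\<bar>\<mu> - \<mu>\<bar> < \<delta>" using \<mu> \<delta> by auto
  show False
  proof (rule no_passage_from_minima_to_maxima)
    show "subspace K" unfolding K_def by (rule \<mu>.subspace_K)
    show "K \<noteq> {0}"
    proof -
      obtain j where "j \<in> resonances \<mu>" using ne by blast
      moreover from this have "j \<in> range h"
        using h by (simp add: resonances_def resonant_indices_def bij_betw_def)
      then obtain i where "j = h i" by blast
      ultimately have "axis i 1 \<in> K" using res by (auto simp: K_def \<mu>.K_def axis_def)
      moreover have "axis i (1 :: complex) \<noteq> 0" by (simp add: axis_eq_0_iff)
      ultimately show ?thesis by blast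
    qed
    show "r' > 0" by (rule r')
    show "L > 0" unfolding L_def by (rule \<mu>.curvature_bound_pos[OF \<mu>.\<epsilon>(1)])
    show "quadratic_gradient K r' L (\<phi> \<mu>) (c \<mu>)" "continuous_on (K \<inter> cball 0 r') (c \<mu>)"
      by (rule grad[OF mu], rule cont[OF mu])
    show "quadratic_gradient K r' L (\<phi> (lm (k + m))) (c (lm (k + m)))"
      "continuous_on (K \<inter> cball 0 r') (c (lm (k + m)))" for k
      by (rule grad[OF lm(1) m], rule cont[OF lm(1) m])
    show "quadratic_gradient K r' L (\<phi> (lp (k + p))) (c (lp (k + p)))"
      "continuous_on (K \<inter> cball 0 r') (c (lp (k + p)))" for k
      by (rule grad[OF lp(1) p], rule cont[OF lp(1) p])
    have lims: "(\<lambda>k. lm (k + m)) \<longlonglongrightarrow> \<mu>" "(\<lambda>k. lp (k + p)) \<longlonglongrightarrow> \<mu>"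
      using lm(2) lp(2) by (auto intro: LIMSEQ_ignore_initial_segment)
    show "uniform_limit (K \<inter> cball 0 r') (\<lambda>k. c (lm (k + m))) (c \<mu>) sequentially"
      unfolding K_def c_def
      by (rule \<mu>.reduced_maps_converge[OF nl[OF lm(1) m] nl[OF mu] gradients_converge[OF \<mu> lm(1) lims(1) Q] r'(2)])
    show "uniform_limit (K \<inter> cball 0 r') (\<lambda>k. c (lp (k + p))) (c \<mu>) sequentially"
      unfolding K_def c_def
      by (rule \<mu>.reduced_maps_converge[OF nl[OF lp(1) p] nl[OF mu] gradients_converge[OF \<mu> lp(1) lims(2) Q] r'(2)])
    show "c \<mu> v \<noteq> 0" if "v \<in> K" "0 < norm v" "norm v \<le> r'" for v
      by (rule nz[OF _ mu(2) that]) simp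
    show "c (lm (k + m)) v \<noteq> 0" if "v \<in> K" "0 < norm v" "norm v \<le> r'" for k v
      by (rule nz[OF _ m that]) simp
    show "c (lp (k + p)) v \<noteq> 0" if "v \<in> K" "0 < norm v" "norm v \<le> r'" for k v
      by (rule nz[OF _ p that]) simp
    show "\<exists>\<rho>>0. \<forall>v\<in>K. 0 < norm v \<longrightarrow> norm v < \<rho> \<longrightarrow> 0 < c (lm (k + m)) v \<bullet> v" for k
      using definite[OF lm(1) m, of 1] em by simp
    show "\<exists>\<rho>>0. \<forall>v\<in>K. 0 < norm v \<longrightarrow> norm v < \<rho> \<longrightarrow> c (lp (k + p)) v \<bullet> v < 0" for k
      using definite[OF lp(1) p, of "- 1"] ep by simp
  qed
qed

theorem no_small_solutions_without_resonance:
  assumes \<mu>: "\<mu> \<in> \<Lambda>" and em: "resonances \<mu> = {}"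
  shows "\<exists>\<delta>>0. \<exists>r>0. \<forall>l\<in>\<Lambda>. \<forall>x. \<bar>l - \<mu>\<bar> < \<delta> \<longrightarrow> solution \<tau> V l x \<longrightarrow>
    (\<forall>t. norm (x t) \<le> r) \<longrightarrow> (\<forall>t. x t = 0)"
proof -
  obtain h where h: "bij_betw h (UNIV :: 'n set) {1..CARD('n)}"
    using finite_same_card_bij[of "UNIV :: 'n set" "{1..CARD('n)}"] by auto
  define d where "d i = e \<mu> (h i)" for i
  obtain Q R \<epsilon> \<delta> where Q: "orthogonal_matrix Q" and \<delta>: "\<delta> > 0"
    and nl: "\<And>l. l \<in> \<Lambda> \<Longrightarrow> \<bar>l - \<mu>\<bar> < \<delta> \<Longrightarrow> nonlinearity \<tau> d R \<epsilon> (fc Q l) (Vc Q l)"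
    and "\<And>l x. l \<in> \<Lambda> \<Longrightarrow> \<bar>l - \<mu>\<bar> < \<delta> \<Longrightarrow> norm (Bc Q l *v x - (\<chi> i. d i * x $ i)) \<le> \<epsilon> * norm x"
    and "\<And>i j. d i \<noteq> d j \<Longrightarrow> \<epsilon> \<le> \<bar>d i - d j\<bar>"
    by (rule normal_form[OF \<mu> h d_def]) (rule that)
  interpret \<mu>: nonlinearity \<tau> d R \<epsilon> "fc Q \<mu>" "Vc Q \<mu>" by (rule nl) (use \<mu> \<delta> in auto)
  have nr: "\<not> \<mu>.resonant i" for i
  proof -
    have "h i \<in> {1..CARD('n)}" using h by (auto simp: bij_betw_def)
    moreover have "h i \<notin> resonances \<mu>" using em by simp
    ultimately show ?thesis
      by (simp add: \<mu>.resonant_iff_value resonances_def resonant_indices_def d_def)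
  qed
  show ?thesis
  proof (rule exI[of _ \<delta>], intro conjI \<delta>, rule exI[of _ "R / 4"], intro conjI ballI allI impI)
    show "R / 4 > 0" using \<mu>.R by simp
    fix l x t assume l: "l \<in> \<Lambda>" "\<bar>l - \<mu>\<bar> < \<delta>" and x: "solution \<tau> V l x" and "\<forall>t. norm (x t) \<le> R / 4"
    then have small: "norm (x t) \<le> R / 4" for t by blast
    interpret l: nonlinearity \<tau> d R \<epsilon> "fc Q l" "Vc Q l" by (rule nl[OF l])
    have "transpose Q *v x t = 0"
      by (rule l.nonresonant_small_solution_zero[OF nr conjugate_solution[OF Q x]])
        (simp only: orthogonal_matrix_facts(6)[OF Q] small)
    then show "x t = 0" using orthogonal_matrix_facts(6)[OF Q, of "x t"] by simp
  qed
qed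

end

section \<open>Bifurcation and the two alternatives\<close>

lemma antiperiodic_norm_bound:
  fixes x :: "real \<Rightarrow> 'a::real_normed_vector"
  assumes T: "T > 0" and anti: "\<And>t. x (t + T) = - x t" and B: "\<And>t. t \<in> {0..T} \<Longrightarrow> norm (x t) \<le> B"
  shows "norm (x t) \<le> B"
proof -
  have up: "norm (x (t + real n * T)) = norm (x t)" for t and n :: nat
  proof (induction n)
    case (Suc n)
    have "x (t + real (Suc n) * T) = - x (t + real n * T)"
      using anti[of "t + real n * T"] by (simp add: algebra_simps)
    then show ?case using Suc by simp
  qed simp
  have int: "norm (x (t + of_int n * T)) = norm (x t)" for n :: int
  proof (cases "n \<ge> 0")
    case True
    then show ?thesis using up[of t "nat n"] by simp
  next
    case False
    then show ?thesis using up[of "t + of_int n * T" "nat (- n)"] by simp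
  qed
  have "of_int \<lfloor>t / T\<rfloor> * T \<le> t" "t < (of_int \<lfloor>t / T\<rfloor> + 1) * T"
    using floor_divide_lower[OF T, of t] floor_divide_upper[OF T, of t] by simp_all
  then have "t + of_int (- \<lfloor>t / T\<rfloor>) * T \<in> {0..T}" by (simp add: algebra_simps)
  from B[OF this] show ?thesis by (simp only: int)
qed

lemma antiperiodic_intermediate_values:
  fixes g :: "real \<Rightarrow> real"
  assumes T: "T > 0" and anti: "g (t + T) = - g t" and cont: "continuous_on UNIV g" and q: "\<bar>q\<bar> \<le> 1"
  shows "\<exists>s. g s = q * g t"
proof -
  have "\<bar>q * g t\<bar> \<le> \<bar>g t\<bar>" using q by (simp add: abs_mult mult_left_le_one_le)
  then have le: "- \<bar>g t\<bar> \<le> q * g t" "q * g t \<le> \<bar>g t\<bar>" by linarith+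
  have c: "continuous_on {t..t + T} g" using cont continuous_on_subset by blast
  show ?thesis
  proof (cases "g t \<ge> 0")
    case True
    then show ?thesis using IVT2'[of g "t + T" "q * g t" t] le T c anti by auto
  next
    case False
    then show ?thesis using IVT'[of g t "q * g t" "t + T"] le T c anti by auto
  qed
qed

lemma solution_shift: "solution \<tau> V l x \<Longrightarrow> solution \<tau> V l (\<lambda>t. x (t + s))"
  unfolding solution_def
proof (intro conjI allI; elim conjE)
  fix t
  assume "\<forall>t. (x has_vector_derivative gradient (V l) (x (t - \<tau>)) + gradient (V l) (x (t - 2 * \<tau>))) (at t)"
  then have "(x has_vector_derivative gradient (V l) (x (t + s - \<tau>)) + gradient (V l) (x (t + s - 2 * \<tau>))) (at (t + s))"
    by blast
  from has_vector_derivative_shift(1)[OF this]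
  show "((\<lambda>t. x (t + s)) has_vector_derivative
      gradient (V l) (x (t - \<tau> + s)) + gradient (V l) (x (t - 2 * \<tau> + s))) (at t)"
    by (simp add: algebra_simps)
next
  fix t assume "\<forall>t. x (t + 3 * \<tau>) = - x t"
  then have "x (t + s + 3 * \<tau>) = - x (t + s)" by blast
  then show "x (t + 3 * \<tau> + s) = - x (t + s)" by (simp add: algebra_simps)
qed

context delay_family begin

lemma solutionD:
  assumes "solution \<tau> V l x"
  shows "(x has_vector_derivative gradient (V l) (x (t - \<tau>)) + gradient (V l) (x (t - 2 * \<tau>))) (at t)"
    and "x (t + 3 * \<tau>) = - x t" and "continuous_on S x"
proof -
  show d: "(x has_vector_derivative gradient (V l) (x (t - \<tau>)) + gradient (V l) (x (t - 2 * \<tau>))) (at t)" for t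
    using assms by (simp add: solution_def)
  show "x (t + 3 * \<tau>) = - x t" using assms by (simp add: solution_def)
  show "continuous_on S x"
    using d by (meson continuous_at_imp_continuous_on has_vector_derivative_continuous)
qed

lemma gradient_linear_bound:
  assumes \<mu>: "\<mu> \<in> \<Lambda>"
  obtains \<delta> R C where "\<delta> > 0" "R > 0" "C \<ge> 0"
    "\<And>l x. l \<in> \<Lambda> \<Longrightarrow> \<bar>l - \<mu>\<bar> < \<delta> \<Longrightarrow> norm x \<le> R \<Longrightarrow> norm (gradient (V l) x) \<le> C * norm x"
proof -
  obtain \<delta> R where near:
    "\<And>l x y. l \<in> \<Lambda> \<Longrightarrow> \<bar>l - \<mu>\<bar> < \<delta> \<Longrightarrow> norm x \<le> R \<Longrightarrow> norm y \<le> R \<Longrightarrow>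
      norm ((gradient (V l) x - hessian (V \<mu>) 0 *v x) - (gradient (V l) y - hessian (V \<mu>) 0 *v y))
        \<le> 1 * norm (x - y)"
    and \<delta>: "\<delta> > 0" "R > 0"
    by (rule gradient_near_linear[OF \<mu> zero_less_one]) (rule that)
  define B where "B = hessian (V \<mu>) 0"
  note near = near[folded B_def]
  have "norm (gradient (V l) x) \<le> (1 + onorm ((*v) B)) * norm x"
    if l: "l \<in> \<Lambda>" "\<bar>l - \<mu>\<bar> < \<delta>" and x: "norm x \<le> R" for l x
  proof -
    have "norm (gradient (V l) x - B *v x) \<le> norm x"
      using near[OF l x, of 0] \<delta>(2) by (simp add: gradient_0[OF l(1)])
    moreover have "norm (B *v x) \<le> onorm ((*v) B) * norm x"
      by (rule onorm[OF matrix_vector_mul_bounded_linear])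
    ultimately show ?thesis
      using norm_triangle_sub[of "gradient (V l) x" "B *v x"] by (simp add: algebra_simps)
  qed
  then show thesis
    using \<delta> onorm_pos_le[OF matrix_vector_mul_bounded_linear, of B] by (intro that[of \<delta> R "1 + onorm ((*v) B)"]) auto
qed

lemma small_solution_derivative:
  assumes bd: "\<And>x. norm x \<le> R \<Longrightarrow> norm (gradient (V l) x) \<le> C * norm x" and C: "C \<ge> 0"
    and x: "solution \<tau> V l x" and r: "\<And>t. norm (x t) \<le> r" "r \<le> R"
  shows "norm (vector_derivative x (at t)) \<le> 2 * C * r"
    and "t \<in> {0..3 * \<tau>} \<Longrightarrow> norm (vector_derivative x (at t within {0..3 * \<tau>})) \<le> 2 * C * r"
proof -
  have "norm (gradient (V l) (x s)) \<le> C * r" for s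
    using bd[of "x s"] r(1)[of s] r(2) mult_left_mono[OF r(1)[of s] C] by linarith
  then have b: "norm (gradient (V l) (x (t - \<tau>)) + gradient (V l) (x (t - 2 * \<tau>))) \<le> 2 * C * r"
    by (intro order_trans[OF norm_triangle_ineq]) (metis add_mono mult.assoc mult_2)
  show "norm (vector_derivative x (at t)) \<le> 2 * C * r"
    using b vector_derivative_at[OF solutionD(1)[OF x]] by simp
  show "norm (vector_derivative x (at t within {0..3 * \<tau>})) \<le> 2 * C * r" if "t \<in> {0..3 * \<tau>}"
    using b that tau vector_derivative_at_within_ivl[OF solutionD(1)[OF x], of 0 t "3 * \<tau>"] by simp
qed

lemma norm_le_C1_norm:
  assumes l: "l \<in> \<Lambda>" and x: "solution \<tau> V l x"
  shows "norm (x t) \<le> C1_norm 0 (3 * \<tau>) x"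
proof (rule antiperiodic_norm_bound)
  let ?I = "{0..3 * \<tau>}"
  let ?x' = "\<lambda>t. gradient (V l) (x (t - \<tau>)) + gradient (V l) (x (t - 2 * \<tau>))"
  show "3 * \<tau> > 0" using tau by simp
  show "x (t + 3 * \<tau>) = - x t" for t by (rule solutionD(2)[OF x])
  fix t assume t: "t \<in> ?I"
  have gc: "continuous_on UNIV (gradient (V l))"
    using gradient_has_derivative[OF l] by (meson continuous_at_imp_continuous_on has_derivative_continuous)
  have xc: "continuous_on ?I (\<lambda>t. x (t - a))" for a
    by (rule continuous_on_compose2[OF solutionD(3)[OF x, of UNIV]]) (auto intro!: continuous_intros)
  have xc': "continuous_on ?I ?x'"
    by (intro continuous_intros continuous_on_compose2[OF gc] xc) auto
  have bdd: "bdd_above ((\<lambda>t. norm (g t)) ` ?I)" if "continuous_on ?I g" for g :: "real \<Rightarrow> real ^ 'n"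
    by (intro bounded_imp_bdd_above compact_imp_bounded compact_continuous_image continuous_on_norm that) simp
  have "norm (x t) \<le> (SUP t\<in>?I. norm (x t))"
    by (rule cSUP_upper[OF t bdd[OF solutionD(3)[OF x]]])
  moreover have "0 \<le> (SUP t\<in>?I. norm (vector_derivative x (at t within ?I)))"
  proof -
    have e: "vector_derivative x (at t within ?I) = ?x' t" if "t \<in> ?I" for t
      using that tau by (intro vector_derivative_at_within_ivl[OF solutionD(1)[OF x]]) auto
    have "(SUP t\<in>?I. norm (vector_derivative x (at t within ?I))) = (SUP t\<in>?I. norm (?x' t))"
      by (rule SUP_cong) (simp_all add: e)
    moreover have "norm (?x' t) \<le> (SUP t\<in>?I. norm (?x' t))" by (rule cSUP_upper[OF t bdd[OF xc']])
    ultimately show ?thesis using norm_ge_zero[of "?x' t"] by linarith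
  qed
  ultimately show "norm (x t) \<le> C1_norm 0 (3 * \<tau>) x" by (simp add: C1_norm_def)
qed

lemma C1_norm_le:
  assumes bd: "\<And>x. norm x \<le> R \<Longrightarrow> norm (gradient (V l) x) \<le> C * norm x" and C: "C \<ge> 0"
    and x: "solution \<tau> V l x" and r: "\<And>t. norm (x t) \<le> r" "r \<le> R"
  shows "C1_norm 0 (3 * \<tau>) x \<le> (1 + 2 * C) * r"
proof -
  have "(SUP t\<in>{0..3 * \<tau>}. norm (x t)) \<le> r" using r tau by (intro cSUP_least) auto
  moreover have "(SUP t\<in>{0..3 * \<tau>}. norm (vector_derivative x (at t within {0..3 * \<tau>}))) \<le> 2 * C * r"
    using small_solution_derivative(2)[OF bd C x r] tau by (intro cSUP_least) auto
  ultimately show ?thesis by (simp add: C1_norm_def algebra_simps)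
qed

text \<open>The equation bounds the derivative of a small solution by a multiple of its size, so uniform
  smallness implies smallness in \<open>C\<^sup>1\<close>.\<close>

lemma small_solutions_tend_to_0:
  assumes \<mu>: "\<mu> \<in> \<Lambda>"
    and sol: "\<And>\<delta>. \<delta> > 0 \<Longrightarrow> \<forall>\<^sub>F i in net. l i \<in> \<Lambda> \<and> \<bar>l i - \<mu>\<bar> < \<delta> \<and> solution \<tau> V (l i) (x i)"
    and small: "\<And>r. r > 0 \<Longrightarrow> \<forall>\<^sub>F i in net. \<forall>t. norm (x i t) \<le> r"
  shows "tends_to_0_C1_loc x net"
proof -
  obtain \<delta> R C where bd:
    "\<And>l x. l \<in> \<Lambda> \<Longrightarrow> \<bar>l - \<mu>\<bar> < \<delta> \<Longrightarrow> norm x \<le> R \<Longrightarrow> norm (gradient (V l) x) \<le> C * norm x"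
    and \<delta>: "\<delta> > 0" and R: "R > 0" and C: "C \<ge> 0"
    by (rule gradient_linear_bound[OF \<mu>]) (rule that)
  show ?thesis unfolding tends_to_0_C1_loc_def
  proof (intro allI impI conjI uniform_limitI)
    fix S :: "real set" and \<eta> :: real assume \<eta>: "\<eta> > 0"
    have "\<eta> / 2 > 0" using \<eta> by simp
    from small[OF this] show "\<forall>\<^sub>F i in net. \<forall>t\<in>S. dist (x i t) 0 < \<eta>"
    proof eventually_elim
      case (elim i)
      show ?case
      proof
        fix t
        have "norm (x i t) \<le> \<eta> / 2" using elim by blast
        then show "dist (x i t) 0 < \<eta>" using \<eta> by simp
      qed
    qed
    define y where "y = 2 * C + 1"
    have y: "y > 0" "2 * C \<le> y" using C by (simp_all add: y_def)
    define r where "r = min R (\<eta> / (2 * y))"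
    have r: "r > 0" using R \<eta> y by (simp add: r_def)
    have "2 * C * r \<le> y * (\<eta> / (2 * y))"
      using y r by (intro mult_mono) (auto simp: r_def)
    also have "\<dots> = \<eta> / 2" using y by simp
    also have "\<dots> < \<eta>" using \<eta> by simp
    finally have Cr: "2 * C * r < \<eta>" .
    from small[OF r] sol[OF \<delta>]
    show "\<forall>\<^sub>F i in net. \<forall>t\<in>S. dist (vector_derivative (x i) (at t)) 0 < \<eta>"
    proof eventually_elim
      case (elim i)
      then have li: "l i \<in> \<Lambda>" "\<bar>l i - \<mu>\<bar> < \<delta>" "solution \<tau> V (l i) (x i)" "\<And>t. norm (x i t) \<le> r" by auto
      have rR: "r \<le> R" by (simp add: r_def)
      from small_solution_derivative(1)[OF bd[OF li(1,2)] C li(3,4) rR] Cr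
      show ?case by (auto intro: le_less_trans)
    qed
  qed
qed

definition has_small_solution :: "real \<Rightarrow> real \<Rightarrow> bool" where
  "has_small_solution l r \<longleftrightarrow> (\<exists>x. nonzero_solution \<tau> V l x \<and> (\<forall>t. norm (x t) \<le> r))"

lemma has_small_solution_mono: "has_small_solution l r \<Longrightarrow> r \<le> r' \<Longrightarrow> has_small_solution l r'"
  unfolding has_small_solution_def by (meson order_trans)

lemma has_small_solution_pos: "has_small_solution l r \<Longrightarrow> 0 < r"
  unfolding has_small_solution_def nonzero_solution_def
  by (metis norm_ge_zero zero_less_norm_iff less_le_trans)

lemma bifurcation_point_if_small_solutions:
  assumes \<mu>: "\<mu> \<in> \<Lambda>"
    and small: "\<And>\<delta> r. \<delta> > 0 \<Longrightarrow> r > 0 \<Longrightarrow> \<exists>l\<in>\<Lambda>. \<bar>l - \<mu>\<bar> < \<delta> \<and> has_small_solution l r"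
  shows "bifurcation_point \<Lambda> \<tau> V \<mu>"
proof -
  obtain \<delta> R C where bd:
    "\<And>l x. l \<in> \<Lambda> \<Longrightarrow> \<bar>l - \<mu>\<bar> < \<delta> \<Longrightarrow> norm x \<le> R \<Longrightarrow> norm (gradient (V l) x) \<le> C * norm x"
    and \<delta>: "\<delta> > 0" and R: "R > 0" and C: "C \<ge> 0"
    by (rule gradient_linear_bound[OF \<mu>]) (rule that)
  define r where "r k = min R (1 / real (Suc k))" for k
  have r: "0 < r k" "r k \<le> R" "r k \<le> 1 / real (Suc k)" for k using R by (auto simp: r_def)
  have "\<exists>l x. l \<in> \<Lambda> \<and> \<bar>l - \<mu>\<bar> < min \<delta> (1 / real (Suc k)) \<and> nonzero_solution \<tau> V l x \<and> (\<forall>t. norm (x t) \<le> r k)" for k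
  proof -
    have "min \<delta> (1 / real (Suc k)) > 0" using \<delta> by simp
    from small[OF this r(1)] show ?thesis unfolding has_small_solution_def by blast
  qed
  then obtain l x where l: "\<And>k. l k \<in> \<Lambda>" "\<And>k. \<bar>l k - \<mu>\<bar> < min \<delta> (1 / real (Suc k))"
    and x: "\<And>k. nonzero_solution \<tau> V (l k) (x k)" and xr: "\<And>k t. norm (x k t) \<le> r k"
    by metis
  have null: "(\<lambda>k. a * (1 / real (Suc k))) \<longlonglongrightarrow> 0" for a
    using tendsto_mult_left[OF LIMSEQ_inverse_real_of_nat, of a] by (simp add: inverse_eq_divide)
  have "(\<lambda>k. l k - \<mu>) \<longlonglongrightarrow> 0"
    by (rule Lim_null_comparison[OF _ null[of 1]]) (use l(2) in \<open>auto intro!: always_eventually less_imp_le\<close>)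
  then have "l \<longlonglongrightarrow> \<mu>" by (simp add: LIM_zero_iff)
  moreover have "(\<lambda>k. C1_norm 0 (3 * \<tau>) (x k)) \<longlonglongrightarrow> 0"
  proof (rule Lim_null_comparison[OF _ null[of "1 + 2 * C"]], rule always_eventually, rule allI)
    fix k
    have sol: "solution \<tau> V (l k) (x k)" using x by (simp add: nonzero_solution_def)
    have "C1_norm 0 (3 * \<tau>) (x k) \<le> (1 + 2 * C) * r k"
      by (rule C1_norm_le[OF bd C sol xr r(2)]) (use l(2)[of k] l(1) in auto)
    also have "\<dots> \<le> (1 + 2 * C) * (1 / real (Suc k))" using r(3) C by (intro mult_left_mono) auto
    finally show "norm (C1_norm 0 (3 * \<tau>) (x k)) \<le> (1 + 2 * C) * (1 / real (Suc k))"
      using order_trans[OF norm_ge_zero norm_le_C1_norm[OF l(1) sol, of 0]] by simp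
  qed
  ultimately show ?thesis unfolding bifurcation_point_def using l(1) x by blast
qed

theorem bifurcation_point_imp_resonances:
  assumes \<mu>: "\<mu> \<in> \<Lambda>" and bif: "bifurcation_point \<Lambda> \<tau> V \<mu>"
  shows "resonances \<mu> \<noteq> {}"
proof
  assume "resonances \<mu> = {}"
  from no_small_solutions_without_resonance[OF \<mu> this] obtain \<delta> r where \<delta>: "\<delta> > 0" "r > 0"
    and zero: "\<And>l x. l \<in> \<Lambda> \<Longrightarrow> \<bar>l - \<mu>\<bar> < \<delta> \<Longrightarrow> solution \<tau> V l x \<Longrightarrow> \<forall>t. norm (x t) \<le> r \<Longrightarrow> \<forall>t. x t = 0"
    by blast
  obtain l x where l: "\<And>k :: nat. l k \<in> \<Lambda>" "l \<longlonglongrightarrow> \<mu>" and x: "\<And>k. nonzero_solution \<tau> V (l k) (x k)"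
    and C1: "(\<lambda>k. C1_norm 0 (3 * \<tau>) (x k)) \<longlonglongrightarrow> 0"
    using bif unfolding bifurcation_point_def by blast
  have "\<forall>\<^sub>F k in sequentially. dist (l k) \<mu> < \<delta> \<and> dist (C1_norm 0 (3 * \<tau>) (x k)) 0 < r"
    using tendstoD[OF l(2) \<delta>(1)] tendstoD[OF C1 \<delta>(2)] by eventually_elim simp
  then obtain k where k: "\<bar>l k - \<mu>\<bar> < \<delta>" "\<bar>C1_norm 0 (3 * \<tau>) (x k)\<bar> < r"
    by (auto simp: eventually_sequentially dist_real_def)
  have sol: "solution \<tau> V (l k) (x k)" using x by (simp add: nonzero_solution_def)
  have "norm (x k t) \<le> r" for t using norm_le_C1_norm[OF l(1) sol, of t] k(2) by linarith
  then have "\<forall>t. x k t = 0" by (intro zero[OF l(1) k(1) sol] allI)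
  then show False using x by (auto simp: nonzero_solution_def)
qed

text \<open>Each solution is chosen smaller everywhere than the previous one is at some point, which makes
  them distinct.\<close>

lemma sequence_of_small_solutions:
  assumes \<mu>: "\<mu> \<in> \<Lambda>" and small: "\<And>r. r > 0 \<Longrightarrow> has_small_solution \<mu> r"
  shows "\<exists>x :: nat \<Rightarrow> real \<Rightarrow> real ^ 'n.
    (\<forall>i. nonzero_solution \<tau> V \<mu> (x i)) \<and> inj x \<and> tends_to_0_C1_loc x sequentially"
proof -
  have "\<exists>x. \<forall>n :: nat. (nonzero_solution \<tau> V \<mu> (x n) \<and> (\<forall>t. norm (x n t) \<le> 1 / real (Suc n)))
      \<and> (\<exists>t. \<forall>s. norm (x (Suc n) s) < norm (x n t))"
  proof (rule dependent_nat_choice)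
    show "\<exists>x. nonzero_solution \<tau> V \<mu> x \<and> (\<forall>t. norm (x t) \<le> 1 / real (Suc 0))"
      using small[of 1] by (simp add: has_small_solution_def)
    fix x and n :: nat
    assume "nonzero_solution \<tau> V \<mu> x \<and> (\<forall>t. norm (x t) \<le> 1 / real (Suc n))"
    then obtain t where t: "x t \<noteq> 0" by (auto simp: nonzero_solution_def)
    define r where "r = min (norm (x t) / 2) (1 / real (Suc (Suc n)))"
    have "r > 0" using t by (simp add: r_def)
    then obtain y where y: "nonzero_solution \<tau> V \<mu> y" "\<And>s. norm (y s) \<le> r"
      using small unfolding has_small_solution_def by blast
    have "r \<le> norm (x t) / 2" by (simp add: r_def)
    moreover have "norm (x t) > 0" using t by simp
    ultimately have "r < norm (x t)" by linarith
    then have "norm (y s) < norm (x t)" for s using y(2)[of s] by linarith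
    moreover have "norm (y s) \<le> 1 / real (Suc (Suc n))" for s using y(2)[of s] by (simp add: r_def)
    ultimately show "\<exists>y. (nonzero_solution \<tau> V \<mu> y \<and> (\<forall>t. norm (y t) \<le> 1 / real (Suc (Suc n))))
      \<and> (\<exists>t. \<forall>s. norm (y s) < norm (x t))" using y(1) by blast
  qed
  then obtain x where x: "\<And>n :: nat. nonzero_solution \<tau> V \<mu> (x n)" "\<And>n t. norm (x n t) \<le> 1 / real (Suc n)"
    and dec: "\<And>n. \<exists>t. \<forall>s. norm (x (Suc n) s) < norm (x n t)" by blast
  have lt: "\<exists>t. \<forall>s. norm (x n s) < norm (x m t)" if "m < n" for m n
    using that
  proof (induction n)
    case (Suc n)
    show ?case
    proof (cases "m = n")
      case True then show ?thesis using dec[of n] by simp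
    next
      case False
      then obtain t where "\<forall>s. norm (x n s) < norm (x m t)" using Suc by force
      moreover obtain t' where "\<forall>s. norm (x (Suc n) s) < norm (x n t')" using dec by blast
      ultimately show ?thesis by (meson less_trans)
    qed
  qed simp
  have "inj x"
  proof (rule injI)
    fix m n assume "x m = x n"
    then show "m = n" using lt[of m n] lt[of n m] by (metis less_irrefl linorder_neqE_nat)
  qed
  moreover have "tends_to_0_C1_loc x sequentially"
  proof (rule small_solutions_tend_to_0[OF \<mu>, where l = "\<lambda>_. \<mu>"])
    show "\<forall>\<^sub>F i in sequentially. \<mu> \<in> \<Lambda> \<and> \<bar>\<mu> - \<mu>\<bar> < \<delta> \<and> solution \<tau> V \<mu> (x i)" if "\<delta> > 0" for \<delta>
      using \<mu> x that by (simp add: nonzero_solution_def)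
    fix r :: real assume "r > 0"
    then obtain m where m: "1 / real (Suc m) < r" using nat_approx_posE by blast
    have "norm (x i t) \<le> r" if "i \<ge> m" for i t
    proof -
      have "1 / real (Suc i) \<le> 1 / real (Suc m)" using that by (intro divide_left_mono) auto
      then show ?thesis using x(2)[of i t] m by linarith
    qed
    then show "\<forall>\<^sub>F i in sequentially. \<forall>t. norm (x i t) \<le> r" by (auto simp: eventually_sequentially)
  qed
  ultimately show ?thesis using x(1) by blast
qed

text \<open>Some component of \<open>x\<close> is not identically zero. Being antiperiodic it attains all
  values between its value at one point and the negative of this value. Shifts that bring the fractions
  \<open>i / k\<close> of that value to time zero differ even up to sign.\<close>

lemma time_shifts_distinct:
  assumes x: "nonzero_solution \<tau> V l x"
  shows "\<exists>s :: nat \<Rightarrow> real. inj_on (\<lambda>i. {\<lambda>t. x (t + s i), \<lambda>t. - x (t + s i)}) {1..k}"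
proof -
  have sol: "solution \<tau> V l x" using x by (simp add: nonzero_solution_def)
  obtain t j where tj: "x t $ j \<noteq> 0" using x by (auto simp: nonzero_solution_def vec_eq_iff)
  have "\<exists>s. i \<in> {1..k} \<longrightarrow> x s $ j = real i / real k * x t $ j" for i
  proof (cases "i \<in> {1..k}")
    case True
    have "\<exists>s. x s $ j = real i / real k * x t $ j"
      by (rule antiperiodic_intermediate_values[of "3 * \<tau>" "\<lambda>s. x s $ j"])
        (use tau True solutionD(2)[OF sol] solutionD(3)[OF sol] in \<open>auto intro!: continuous_intros\<close>)
    then show ?thesis by blast
  qed auto
  then obtain s where s: "\<And>i. i \<in> {1..k} \<Longrightarrow> x (s i) $ j = real i / real k * x t $ j" by metis
  have "inj_on (\<lambda>i. {\<lambda>t. x (t + s i), \<lambda>t. - x (t + s i)}) {1..k}"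
  proof (rule inj_onI)
    fix i i' assume i: "i \<in> {1..k}" "i' \<in> {1..k}"
      and "{\<lambda>t. x (t + s i), \<lambda>t. - x (t + s i)} = {\<lambda>t. x (t + s i'), \<lambda>t. - x (t + s i')}"
    then have "(\<lambda>t. x (t + s i)) = (\<lambda>t. x (t + s i')) \<or> (\<lambda>t. x (t + s i)) = (\<lambda>t. - x (t + s i'))"
      by blast
    then have "x (0 + s i) = x (0 + s i') \<or> x (0 + s i) = - x (0 + s i')" by (meson fun_cong)
    then have "\<bar>x (s i) $ j\<bar> = \<bar>x (s i') $ j\<bar>" by auto
    then have "real i / real k * \<bar>x t $ j\<bar> = real i' / real k * \<bar>x t $ j\<bar>"
      using s[OF i(1)] s[OF i(2)] by (simp add: abs_mult)
    then show "i = i'" using tj i by simp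
  qed
  then show ?thesis by blast
qed

text \<open>Choose for each parameter one nonzero solution of nearly minimal size and take time shifts of it
  as the members of the \<open>k\<close> pairs.\<close>

lemma solution_pairs_if_small_solutions:
  assumes \<mu>: "\<mu> \<in> \<Lambda>" and S: "S \<subseteq> \<Lambda>"
    and small: "\<And>r. r > 0 \<Longrightarrow> \<exists>\<delta>>0. \<forall>l\<in>S - {\<mu>}. \<bar>l - \<mu>\<bar> < \<delta> \<longrightarrow> has_small_solution l r"
  shows "\<exists>\<delta>>0. has_solution_pairs \<tau> V \<mu> (S \<inter> {\<mu> - \<delta><..<\<mu> + \<delta>}) k"
proof -
  obtain \<delta> where \<delta>: "\<delta> > 0" "\<And>l. l \<in> S \<Longrightarrow> l \<noteq> \<mu> \<Longrightarrow> \<bar>l - \<mu>\<bar> < \<delta> \<Longrightarrow> has_small_solution l 1"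
    using small[of 1] by auto
  define S' where "S' = S \<inter> {\<mu> - \<delta><..<\<mu> + \<delta>}"
  have S'1: "has_small_solution l 1" if "l \<in> S' - {\<mu>}" for l
    using that by (intro \<delta>(2)) (auto simp: S'_def abs_less_iff)
  \<comment> \<open>Solutions of almost minimal size, so that they shrink as fast as the family permits.\<close>
  define m where "m l = Inf {r. has_small_solution l r}" for l
  have bdd: "bdd_below {r. has_small_solution l r}" for l
    using has_small_solution_pos by (intro bdd_belowI[of _ 0]) (auto intro: less_imp_le)
  have "\<exists>x. l \<in> S' - {\<mu>} \<longrightarrow> nonzero_solution \<tau> V l x \<and> (\<forall>t. norm (x t) \<le> m l + \<bar>l - \<mu>\<bar>)" for l
  proof (cases "l \<in> S' - {\<mu>}")
    case True
    then have "m l < m l + \<bar>l - \<mu>\<bar>" by simp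
    then obtain r where "has_small_solution l r" "r < m l + \<bar>l - \<mu>\<bar>"
      using cInf_less_iff[OF _ bdd, of l] S'1[OF True] unfolding m_def by blast
    then have "has_small_solution l (m l + \<bar>l - \<mu>\<bar>)"
      using has_small_solution_mono by (meson less_imp_le)
    then show ?thesis unfolding has_small_solution_def by blast
  qed auto
  then obtain X where X: "\<And>l. l \<in> S' - {\<mu>} \<Longrightarrow> nonzero_solution \<tau> V l (X l)"
    and Xm: "\<And>l t. l \<in> S' - {\<mu>} \<Longrightarrow> norm (X l t) \<le> m l + \<bar>l - \<mu>\<bar>" by metis
  have shifts: "\<exists>s :: nat \<Rightarrow> real. l \<in> S' - {\<mu>} \<longrightarrow>
      inj_on (\<lambda>i. {\<lambda>t. X l (t + s i), \<lambda>t. - X l (t + s i)}) {1..k}" for l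
  proof (cases "l \<in> S' - {\<mu>}")
    case True
    from time_shifts_distinct[OF X[OF True], of k] show ?thesis by blast
  qed auto
  have "\<exists>s :: real \<Rightarrow> nat \<Rightarrow> real. \<forall>l. l \<in> S' - {\<mu>} \<longrightarrow>
      inj_on (\<lambda>i. {\<lambda>t. X l (t + s l i), \<lambda>t. - X l (t + s l i)}) {1..k}"
    by (rule choice) (rule allI, rule shifts)
  then obtain s :: "real \<Rightarrow> nat \<Rightarrow> real" where s: "\<And>l. l \<in> S' - {\<mu>} \<Longrightarrow>
      inj_on (\<lambda>i. {\<lambda>t. X l (t + s l i), \<lambda>t. - X l (t + s l i)}) {1..k}" by blast
  have nzs: "nonzero_solution \<tau> V l (\<lambda>t. X l (t + s l i))" if l: "l \<in> S' - {\<mu>}" for l i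
  proof -
    obtain t where t: "X l t \<noteq> 0" using X[OF l] by (auto simp: nonzero_solution_def)
    then have "X l ((t - s l i) + s l i) \<noteq> 0" by simp
    then show ?thesis using solution_shift[of \<tau> V l "X l"] X[OF l]
      unfolding nonzero_solution_def by blast
  qed
  have ev: "\<forall>\<^sub>F l in at \<mu> within S'. l \<in> S' - {\<mu>} \<and> \<bar>l - \<mu>\<bar> < \<rho>" if "\<rho> > 0" for \<rho>
    using that by (auto simp: eventually_at dist_real_def intro!: exI[of _ \<rho>])
  have "tends_to_0_C1_loc (\<lambda>l t. X l (t + s l i)) (at \<mu> within S')" for i
  proof (rule small_solutions_tend_to_0[OF \<mu>, where l = "\<lambda>l. l"])
    show "\<forall>\<^sub>F l in at \<mu> within S'. l \<in> \<Lambda> \<and> \<bar>l - \<mu>\<bar> < \<rho> \<and> solution \<tau> V l (\<lambda>t. X l (t + s l i))"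
      if "\<rho> > 0" for \<rho>
      using ev[OF that]
      by eventually_elim (use nzs S in \<open>auto simp: nonzero_solution_def S'_def\<close>)
    fix r :: real assume "r > 0"
    then obtain \<rho> where \<rho>: "\<rho> > 0" "\<And>l. l \<in> S \<Longrightarrow> l \<noteq> \<mu> \<Longrightarrow> \<bar>l - \<mu>\<bar> < \<rho> \<Longrightarrow> has_small_solution l (r / 2)"
      using small[of "r / 2"] by auto
    have "min \<rho> (r / 2) > 0" using \<rho>(1) \<open>r > 0\<close> by simp
    from ev[OF this] show "\<forall>\<^sub>F l in at \<mu> within S'. \<forall>t. norm (X l (t + s l i)) \<le> r"
    proof eventually_elim
      case (elim l)
      then have "has_small_solution l (r / 2)" by (intro \<rho>(2)) (auto simp: S'_def)
      then have "m l \<le> r / 2" unfolding m_def by (intro cInf_lower bdd) simp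
      moreover have "\<bar>l - \<mu>\<bar> < r / 2" using elim by simp
      ultimately have "m l + \<bar>l - \<mu>\<bar> \<le> r" by linarith
      moreover have "norm (X l (t + s l i)) \<le> m l + \<bar>l - \<mu>\<bar>" for t
        by (rule Xm) (use elim in blast)
      ultimately show ?case by (blast intro: order_trans)
    qed
  qed
  then have "has_solution_pairs \<tau> V \<mu> S' k"
    unfolding has_solution_pairs_def using nzs s
    by (intro exI[of _ "\<lambda>i l t. X l (t + s l i)"]) auto
  then show ?thesis using \<delta>(1) unfolding S'_def by blast
qed

lemma has_solution_pairs_0: "has_solution_pairs \<tau> V \<mu> S 0"
  by (simp add: has_solution_pairs_def)

text \<open>If both alternatives failed, sequences of parameters without small solutions would approach
  \<open>\<mu>\<close> from either side. The eigenvalues move in opposite directions along the two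
  sequences, contrary to \<open>small_solution_exists\<close>.\<close>

lemma one_sided_small_solutions:
  assumes \<mu>: "\<mu> \<in> \<Lambda>" and ne: "resonances \<mu> \<noteq> {}"
    and isolated: "r0 > 0" "\<not> has_small_solution \<mu> r0"
    and \<epsilon>: "\<epsilon> > 0" "{\<mu> - \<epsilon><..<\<mu> + \<epsilon>} \<subseteq> \<Lambda>"
    and cross: "(\<forall>l\<in>{\<mu> - \<epsilon><..<\<mu>}. \<forall>l'\<in>{\<mu><..<\<mu> + \<epsilon>}. \<forall>j\<in>resonances \<mu>. e l j < e \<mu> j \<and> e \<mu> j < e l' j) \<or>
            (\<forall>l\<in>{\<mu> - \<epsilon><..<\<mu>}. \<forall>l'\<in>{\<mu><..<\<mu> + \<epsilon>}. \<forall>j\<in>resonances \<mu>. e l j > e \<mu> j \<and> e \<mu> j > e l' j)"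
  shows "(\<forall>r>0. \<exists>\<delta>>0. \<forall>l\<in>\<Lambda>. \<mu> - \<delta> < l \<longrightarrow> l < \<mu> \<longrightarrow> has_small_solution l r) \<or>
    (\<forall>r>0. \<exists>\<delta>>0. \<forall>l\<in>\<Lambda>. \<mu> < l \<longrightarrow> l < \<mu> + \<delta> \<longrightarrow> has_small_solution l r)"
proof (rule ccontr)
  let ?L = "\<lambda>r. \<exists>\<delta>>0. \<forall>l\<in>\<Lambda>. \<mu> - \<delta> < l \<longrightarrow> l < \<mu> \<longrightarrow> has_small_solution l r"
  let ?R = "\<lambda>r. \<exists>\<delta>>0. \<forall>l\<in>\<Lambda>. \<mu> < l \<longrightarrow> l < \<mu> + \<delta> \<longrightarrow> has_small_solution l r"
  assume "\<not> ((\<forall>r>0. ?L r) \<or> (\<forall>r>0. ?R r))"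
  then have "(\<exists>r>0. \<not> ?L r) \<and> (\<exists>r>0. \<not> ?R r)" by (simp only: de_Morgan_disj not_all not_imp)
  then obtain r1 r2 where r: "r1 > 0" "r2 > 0" and L: "\<not> ?L r1" and R: "\<not> ?R r2"
    by (elim conjE exE)
  have left: "\<exists>l\<in>\<Lambda>. \<mu> - \<delta> < l \<and> l < \<mu> \<and> \<not> has_small_solution l r1" if "\<delta> > 0" for \<delta>
  proof (rule ccontr)
    assume "\<not> ?thesis"
    then have "\<forall>l\<in>\<Lambda>. \<mu> - \<delta> < l \<longrightarrow> l < \<mu> \<longrightarrow> has_small_solution l r1" by blast
    with that have "?L r1" by (intro exI conjI)
    with L show False by (rule notE)
  qed
  have right: "\<exists>l\<in>\<Lambda>. \<mu> < l \<and> l < \<mu> + \<delta> \<and> \<not> has_small_solution l r2" if "\<delta> > 0" for \<delta>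
  proof (rule ccontr)
    assume "\<not> ?thesis"
    then have "\<forall>l\<in>\<Lambda>. \<mu> < l \<longrightarrow> l < \<mu> + \<delta> \<longrightarrow> has_small_solution l r2" by blast
    with that have "?R r2" by (intro exI conjI)
    with R show False by (rule notE)
  qed
  define \<delta> where "\<delta> k = min \<epsilon> (1 / real (Suc k))" for k
  have \<delta>: "\<delta> k > 0" "\<delta> k \<le> \<epsilon>" "\<delta> k \<le> 1 / real (Suc k)" for k using \<epsilon> by (auto simp: \<delta>_def)
  obtain a where a: "\<And>k. a k \<in> \<Lambda>" "\<And>k. \<mu> - \<delta> k < a k" "\<And>k. a k < \<mu>" "\<And>k. \<not> has_small_solution (a k) r1"
    using left[OF \<delta>(1)] by metis
  obtain b where b: "\<And>k. b k \<in> \<Lambda>" "\<And>k. b k < \<mu> + \<delta> k" "\<And>k. \<mu> < b k" "\<And>k. \<not> has_small_solution (b k) r2"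
    using right[OF \<delta>(1)] by metis
  have null: "(\<lambda>k. 1 / real (Suc k)) \<longlonglongrightarrow> 0"
    using LIMSEQ_inverse_real_of_nat by (simp add: inverse_eq_divide)
  have conv: "y \<longlonglongrightarrow> \<mu>" if "\<And>k. \<bar>y k - \<mu>\<bar> \<le> \<delta> k" for y
  proof -
    have "(\<lambda>k. y k - \<mu>) \<longlonglongrightarrow> 0"
      by (rule Lim_null_comparison[OF always_eventually null])
        (simp only: real_norm_def order_trans[OF that \<delta>(3)] simp_thms)
    then show ?thesis by (simp add: LIM_zero_iff)
  qed
  have "\<bar>a k - \<mu>\<bar> \<le> \<delta> k" "\<bar>b k - \<mu>\<bar> \<le> \<delta> k" for k
    using a(2,3)[of k] b(2,3)[of k] by linarith+
  then have a\<mu>: "a \<longlonglongrightarrow> \<mu>" and b\<mu>: "b \<longlonglongrightarrow> \<mu>" by (auto intro: conv)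
  have aI: "a k \<in> {\<mu> - \<epsilon><..<\<mu>}" and bI: "b k \<in> {\<mu><..<\<mu> + \<epsilon>}" for k
    using a(2,3)[of k] b(2,3)[of k] \<delta>(2)[of k] by auto
  define r where "r = min r0 (min r1 r2)"
  have r0: "r > 0" using r isolated by (simp add: r_def)
  from cross have "\<exists>l\<in>{\<mu>} \<union> range a \<union> range b. \<exists>x. nonzero_solution \<tau> V l x \<and> (\<forall>t. norm (x t) \<le> r)"
  proof
    assume "\<forall>l\<in>{\<mu> - \<epsilon><..<\<mu>}. \<forall>l'\<in>{\<mu><..<\<mu> + \<epsilon>}. \<forall>j\<in>resonances \<mu>. e l j < e \<mu> j \<and> e \<mu> j < e l' j"
    then show ?thesis
      using small_solution_exists[OF \<mu> ne r0 a(1) a\<mu> b(1) b\<mu>] aI bI by blast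
  next
    assume "\<forall>l\<in>{\<mu> - \<epsilon><..<\<mu>}. \<forall>l'\<in>{\<mu><..<\<mu> + \<epsilon>}. \<forall>j\<in>resonances \<mu>. e l j > e \<mu> j \<and> e \<mu> j > e l' j"
    then show ?thesis
      using small_solution_exists[OF \<mu> ne r0 b(1) b\<mu> a(1) a\<mu>] aI bI by blast
  qed
  then obtain l where "l \<in> {\<mu>} \<union> range a \<union> range b" "has_small_solution l r"
    unfolding has_small_solution_def by blast
  moreover have "r \<le> r0" "r \<le> r1" "r \<le> r2" by (auto simp: r_def)
  ultimately show False using isolated(2) a(4) b(4) has_small_solution_mono by blast
qed

end

theorem theorem3p1:
  fixes \<Lambda> :: "real set" and \<tau> :: real
    and V :: "real \<Rightarrow> real ^ 'n \<Rightarrow> real"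
    and e :: "real \<Rightarrow> nat \<Rightarrow> real"
    and N :: "real \<Rightarrow> nat set"
  assumes "is_interval \<Lambda>" and "\<tau> > 0"
    and "continuous_on (\<Lambda> \<times> UNIV) (\<lambda>(l, x). V l x)"
    and "\<And>l x. l \<in> \<Lambda> \<Longrightarrow> V l (- x) = V l x"
    and "\<And>l. l \<in> \<Lambda> \<Longrightarrow> class_C2 (V l)"
    and "continuous_on (\<Lambda> \<times> UNIV) (\<lambda>(l, x). gradient (V l) x)"
    and "continuous_on (\<Lambda> \<times> UNIV) (\<lambda>(l, x). hessian (V l) x)"
    and "\<And>l. l \<in> \<Lambda> \<Longrightarrow> ordered_eigenvalues (hessian (V l) 0) (e l)"
    and "\<And>l. N l = resonant_indices CARD('n) \<tau> (e l)"
  shows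
    "(\<forall>\<mu>\<in>\<Lambda>. bifurcation_point \<Lambda> \<tau> V \<mu> \<longrightarrow> N \<mu> \<noteq> {})
     \<and>
     (\<forall>\<mu>\<in>interior \<Lambda>.
        (\<forall>j\<in>{1..CARD('n)}. e \<mu> j > 0 \<longrightarrow> sqrt 3 * e \<mu> j * \<tau> \<notin> resonant_values) \<and>
        N \<mu> \<noteq> {} \<and>
        (\<exists>lm lp :: nat \<Rightarrow> real.
           range lm \<subseteq> \<Lambda> \<and> range lp \<subseteq> \<Lambda> \<and> lm \<longlonglongrightarrow> \<mu> \<and> lp \<longlonglongrightarrow> \<mu> \<and>
           (\<forall>m. \<forall>j\<in>N \<mu>. e (lm m) j < e \<mu> j \<and> e \<mu> j < e (lp m) j))
        \<longrightarrow> bifurcation_point \<Lambda> \<tau> V \<mu>)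
     \<and>
     (\<forall>\<mu>\<in>interior \<Lambda>.
        (\<forall>j\<in>{1..CARD('n)}. e \<mu> j > 0 \<longrightarrow> sqrt 3 * e \<mu> j * \<tau> \<notin> resonant_values) \<and>
        N \<mu> \<noteq> {} \<and>
        (\<exists>\<epsilon>>0. {\<mu> - \<epsilon><..<\<mu> + \<epsilon>} \<subseteq> \<Lambda> \<and>
           ((\<forall>l\<in>{\<mu> - \<epsilon><..<\<mu>}. \<forall>l'\<in>{\<mu><..<\<mu> + \<epsilon>}. \<forall>j\<in>N \<mu>. e l j < e \<mu> j \<and> e \<mu> j < e l' j) \<or>
            (\<forall>l\<in>{\<mu> - \<epsilon><..<\<mu>}. \<forall>l'\<in>{\<mu><..<\<mu> + \<epsilon>}. \<forall>j\<in>N \<mu>. e l j > e \<mu> j \<and> e \<mu> j > e l' j)))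
        \<longrightarrow>
        (\<exists>x :: nat \<Rightarrow> real \<Rightarrow> real ^ 'n.
           (\<forall>i. nonzero_solution \<tau> V \<mu> (x i)) \<and> inj x \<and> tends_to_0_C1_loc x sequentially) \<or>
        (\<exists>\<Lambda>m \<Lambda>p nm np.
           left_neighborhood \<Lambda> \<mu> \<Lambda>m \<and> right_neighborhood \<Lambda> \<mu> \<Lambda>p \<and>
           np + nm \<ge> 2 * card (N \<mu>) \<and>
           has_solution_pairs \<tau> V \<mu> \<Lambda>m nm \<and> has_solution_pairs \<tau> V \<mu> \<Lambda>p np))"
    (is "?I \<and> ?II \<and> ?III")
proof -
  interpret delay_family \<Lambda> \<tau> V e by unfold_locales (fact assms)+
  have N: "N \<mu> = resonances \<mu>" for \<mu> by (simp add: assms(9) resonances_def)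
  have int: "\<mu> \<in> \<Lambda>" if "\<mu> \<in> interior \<Lambda>" for \<mu> using that interior_subset by blast
  have ?I unfolding N using bifurcation_point_imp_resonances by blast
  moreover have ?II
  proof (intro ballI impI, elim conjE exE)
    fix \<mu> lm lp
    assume \<mu>: "\<mu> \<in> interior \<Lambda>" and ne: "N \<mu> \<noteq> {}" and l: "range lm \<subseteq> \<Lambda>" "range lp \<subseteq> \<Lambda>"
      and lim: "lm \<longlonglongrightarrow> \<mu>" "lp \<longlonglongrightarrow> \<mu>"
      and cross: "\<forall>m. \<forall>j\<in>N \<mu>. e (lm m) j < e \<mu> j \<and> e \<mu> j < e (lp m) j"
    show "bifurcation_point \<Lambda> \<tau> V \<mu>"
    proof (rule bifurcation_point_if_small_solutions[OF int[OF \<mu>]])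
      fix \<delta> r :: real assume \<delta>: "\<delta> > 0" and r: "r > 0"
      have "\<forall>\<^sub>F k in sequentially. dist (lm k) \<mu> < \<delta> \<and> dist (lp k) \<mu> < \<delta>"
        using tendstoD[OF lim(1) \<delta>] tendstoD[OF lim(2) \<delta>] by eventually_elim simp
      then obtain m where "\<forall>n\<ge>m. \<bar>lm n - \<mu>\<bar> < \<delta> \<and> \<bar>lp n - \<mu>\<bar> < \<delta>"
        by (auto simp: eventually_sequentially dist_real_def)
      then have m: "\<bar>lm (k + m) - \<mu>\<bar> < \<delta>" "\<bar>lp (k + m) - \<mu>\<bar> < \<delta>" for k by simp_all
      have "\<exists>l\<in>{\<mu>} \<union> range (\<lambda>k. lm (k + m)) \<union> range (\<lambda>k. lp (k + m)).
          \<exists>x. nonzero_solution \<tau> V l x \<and> (\<forall>t. norm (x t) \<le> r)"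
        by (rule small_solution_exists[OF int[OF \<mu>] _ r])
          (use ne l cross lim in \<open>auto simp: N intro: LIMSEQ_ignore_initial_segment\<close>)
      then obtain l' where l': "l' \<in> {\<mu>} \<union> range (\<lambda>k. lm (k + m)) \<union> range (\<lambda>k. lp (k + m))"
        and s: "has_small_solution l' r" unfolding has_small_solution_def by blast
      have "l' \<in> \<Lambda>" "\<bar>l' - \<mu>\<bar> < \<delta>" using l' l m int[OF \<mu>] \<delta> by auto
      then show "\<exists>l\<in>\<Lambda>. \<bar>l - \<mu>\<bar> < \<delta> \<and> has_small_solution l r" using s by blast
    qed
  qed
  moreover have ?III
  proof (intro ballI impI, elim conjE exE)
    fix \<mu> \<epsilon> :: real
    assume \<mu>i: "\<mu> \<in> interior \<Lambda>" and ne: "N \<mu> \<noteq> {}" and \<epsilon>: "\<epsilon> > 0" "{\<mu> - \<epsilon><..<\<mu> + \<epsilon>} \<subseteq> \<Lambda>"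
      and cross: "(\<forall>l\<in>{\<mu> - \<epsilon><..<\<mu>}. \<forall>l'\<in>{\<mu><..<\<mu> + \<epsilon>}. \<forall>j\<in>N \<mu>. e l j < e \<mu> j \<and> e \<mu> j < e l' j) \<or>
            (\<forall>l\<in>{\<mu> - \<epsilon><..<\<mu>}. \<forall>l'\<in>{\<mu><..<\<mu> + \<epsilon>}. \<forall>j\<in>N \<mu>. e l j > e \<mu> j \<and> e \<mu> j > e l' j)"
    note \<mu> = int[OF \<mu>i]
    let ?i = "\<exists>x :: nat \<Rightarrow> real \<Rightarrow> real ^ 'n.
           (\<forall>i. nonzero_solution \<tau> V \<mu> (x i)) \<and> inj x \<and> tends_to_0_C1_loc x sequentially"
    let ?ii = "\<exists>\<Lambda>m \<Lambda>p nm np.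
           left_neighborhood \<Lambda> \<mu> \<Lambda>m \<and> right_neighborhood \<Lambda> \<mu> \<Lambda>p \<and>
           np + nm \<ge> 2 * card (N \<mu>) \<and>
           has_solution_pairs \<tau> V \<mu> \<Lambda>m nm \<and> has_solution_pairs \<tau> V \<mu> \<Lambda>p np"
    \<comment> \<open>All pairs are found on one side of \<open>\<mu>\<close>; the number for the other side is then 0.\<close>
    define k where "k = 2 * card (N \<mu>)"
    have lnb: "left_neighborhood \<Lambda> \<mu> ((\<Lambda> \<inter> {..\<mu>}) \<inter> {\<mu> - \<delta><..<\<mu> + \<delta>})"
      and rnb: "right_neighborhood \<Lambda> \<mu> ((\<Lambda> \<inter> {\<mu>..}) \<inter> {\<mu> - \<delta><..<\<mu> + \<delta>})" if "\<delta> > 0" for \<delta>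
      using that by (auto simp: left_neighborhood_def right_neighborhood_def intro!: exI[of _ \<delta>])
    show "?i \<or> ?ii"
    proof (cases "\<forall>r>0. has_small_solution \<mu> r")
      case True
      then show ?thesis using sequence_of_small_solutions[OF \<mu>] by blast
    next
      case False
      then obtain r0 where r0: "r0 > 0" "\<not> has_small_solution \<mu> r0" by blast
      from one_sided_small_solutions[OF \<mu> ne[unfolded N] r0 \<epsilon> cross[unfolded N]] have ?ii
      proof
        assume left: "\<forall>r>0. \<exists>\<delta>>0. \<forall>l\<in>\<Lambda>. \<mu> - \<delta> < l \<longrightarrow> l < \<mu> \<longrightarrow> has_small_solution l r"
        have "\<exists>\<delta>>0. has_solution_pairs \<tau> V \<mu> ((\<Lambda> \<inter> {..\<mu>}) \<inter> {\<mu> - \<delta><..<\<mu> + \<delta>}) k"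
        proof (rule solution_pairs_if_small_solutions[OF \<mu>])
          fix r :: real assume "r > 0"
          then obtain \<delta> where \<delta>: "\<delta> > 0" "\<And>l. l \<in> \<Lambda> \<Longrightarrow> \<mu> - \<delta> < l \<Longrightarrow> l < \<mu> \<Longrightarrow> has_small_solution l r"
            using left by blast
          then show "\<exists>\<delta>>0. \<forall>l\<in>\<Lambda> \<inter> {..\<mu>} - {\<mu>}. \<bar>l - \<mu>\<bar> < \<delta> \<longrightarrow> has_small_solution l r"
            by (intro exI[of _ \<delta>]) auto
        qed auto
        then obtain \<delta> where "\<delta> > 0" "has_solution_pairs \<tau> V \<mu> ((\<Lambda> \<inter> {..\<mu>}) \<inter> {\<mu> - \<delta><..<\<mu> + \<delta>}) k"
          by blast
        moreover have "2 * card (N \<mu>) \<le> 0 + k" by (simp add: k_def)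
        ultimately show ?ii using lnb rnb has_solution_pairs_0 by blast
      next
        assume right: "\<forall>r>0. \<exists>\<delta>>0. \<forall>l\<in>\<Lambda>. \<mu> < l \<longrightarrow> l < \<mu> + \<delta> \<longrightarrow> has_small_solution l r"
        have "\<exists>\<delta>>0. has_solution_pairs \<tau> V \<mu> ((\<Lambda> \<inter> {\<mu>..}) \<inter> {\<mu> - \<delta><..<\<mu> + \<delta>}) k"
        proof (rule solution_pairs_if_small_solutions[OF \<mu>])
          fix r :: real assume "r > 0"
          then obtain \<delta> where \<delta>: "\<delta> > 0" "\<And>l. l \<in> \<Lambda> \<Longrightarrow> \<mu> < l \<Longrightarrow> l < \<mu> + \<delta> \<Longrightarrow> has_small_solution l r"
            using right by blast
          then show "\<exists>\<delta>>0. \<forall>l\<in>\<Lambda> \<inter> {\<mu>..} - {\<mu>}. \<bar>l - \<mu>\<bar> < \<delta> \<longrightarrow> has_small_solution l r"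
            by (intro exI[of _ \<delta>]) auto
        qed auto
        then obtain \<delta> where "\<delta> > 0" "has_solution_pairs \<tau> V \<mu> ((\<Lambda> \<inter> {\<mu>..}) \<inter> {\<mu> - \<delta><..<\<mu> + \<delta>}) k"
          by blast
        moreover have "2 * card (N \<mu>) \<le> k + 0" by (simp add: k_def)
        ultimately show ?ii using lnb rnb has_solution_pairs_0 by blast
      qed
      then show ?thesis ..
    qed
  qed
  ultimately show ?thesis by blast
qed

end
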